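(* Let $M$ be a null complete (time-orientable) Lorentzian manifold furnished with a timelike conformal vector field. If $\mathrm{Ric}(u)>0$ for all null vectors $u\in TM$, then there does not exist any embedded null hypersurface of $M$ which is closed in the topological sense.
   Context: Null complete means that every inextendible null geodesic is defined on all of $\mathbb R$. $\mathrm{Ric}(u)=\mathrm{Ric}(u,u)$ is the Ricci curvature; null vectors are nonzero vectors with $g(u,u)=0$. A vector field $\zeta$ is conformal if $L_\zeta g=2\sigma g$ for some function $\sigma$. A null hypersurface is a hypersurface on which the induced metric is degenerate. *)

theory Defs
  imports "HOL-Analysis.Analysis"
begin

section \<open>Smooth maps between open subsets of normed spaces\<close>

text \<open>The set \<open>S\<close> is always an open set below.\<close>

fun Ck_on :: "nat \<Rightarrow> 'a::real_normed_vector set \<Rightarrow> ('a \<Rightarrow> 'b::real_normed_vector) \<Rightarrow> bool" where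
  "Ck_on 0 S f \<longleftrightarrow> continuous_on S f"
| "Ck_on (Suc k) S f \<longleftrightarrow>
     (\<forall>x\<in>S. f differentiable (at x)) \<and> (\<forall>v. Ck_on k S (\<lambda>x. frechet_derivative f (at x) v))"

definition smooth_on :: "'a::real_normed_vector set \<Rightarrow> ('a \<Rightarrow> 'b::real_normed_vector) \<Rightarrow> bool" where
  "smooth_on S f \<longleftrightarrow> (\<forall>k. Ck_on k S f)"

definition pderiv_at :: "'n::finite \<Rightarrow> (real^'n \<Rightarrow> real) \<Rightarrow> real^'n \<Rightarrow> real" where
  "pderiv_at i f x = frechet_derivative f (at x) (axis i 1)"


section \<open>Smooth manifolds\<close>

text \<open>The manifold is the whole type \<open>'m\<close>, whose sort \<open>{t2_space, second_countable_topology}\<close>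
  makes it Hausdorff and second countable. A chart is a pair \<open>(U, \<phi>)\<close>; the values of \<open>\<phi>\<close>
  outside \<open>U\<close> are irrelevant. The dimension is \<open>CARD('n)\<close>.\<close>

type_synonym ('m, 'n) chart = "'m set \<times> ('m \<Rightarrow> real^'n)"

abbreviation chart_dom :: "('m, 'n::finite) chart \<Rightarrow> 'm set" where
  "chart_dom c \<equiv> fst c"

abbreviation chart_map :: "('m, 'n::finite) chart \<Rightarrow> 'm \<Rightarrow> real^'n" where
  "chart_map c \<equiv> snd c"

definition chart_image :: "('m, 'n::finite) chart \<Rightarrow> (real^'n) set" where
  "chart_image c = chart_map c ` chart_dom c"

definition chart_inv :: "('m, 'n::finite) chart \<Rightarrow> real^'n \<Rightarrow> 'm" where
  "chart_inv c = inv_into (chart_dom c) (chart_map c)"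

definition is_chart :: "('m::topological_space, 'n::finite) chart \<Rightarrow> bool" where
  "is_chart c \<longleftrightarrow> open (chart_dom c) \<and> open (chart_image c) \<and>
     homeomorphism (chart_dom c) (chart_image c) (chart_map c) (chart_inv c)"

definition transition :: "('m, 'n::finite) chart \<Rightarrow> ('m, 'n) chart \<Rightarrow> real^'n \<Rightarrow> real^'n" where
  "transition c d = chart_map d \<circ> chart_inv c"

definition compatible :: "('m, 'n::finite) chart \<Rightarrow> ('m, 'n) chart \<Rightarrow> bool" where
  "compatible c d \<longleftrightarrow>
     smooth_on (chart_map c ` (chart_dom c \<inter> chart_dom d)) (transition c d) \<and>
     smooth_on (chart_map d ` (chart_dom c \<inter> chart_dom d)) (transition d c)"

text \<open>A smooth structure is a maximal smooth atlas.\<close>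

definition smooth_structure ::
    "('m::{t2_space, second_countable_topology}, 'n::finite) chart set \<Rightarrow> bool" where
  "smooth_structure A \<longleftrightarrow>
     (\<forall>c\<in>A. is_chart c) \<and> (\<Union>c\<in>A. chart_dom c) = UNIV \<and>
     (\<forall>c\<in>A. \<forall>d\<in>A. compatible c d) \<and>
     (\<forall>c. is_chart c \<and> (\<forall>d\<in>A. compatible c d) \<longrightarrow> c \<in> A)"


section \<open>Tangent vectors and vector fields\<close>

text \<open>A tangent vector at \<open>p\<close> is represented by its family of components, one element of
  \<open>\<real>\<^sup>n\<close> for every chart around \<open>p\<close>, subject to the contravariant transformation law. It is
  required to vanish on all other pairs, so that distinct functions represent distinct vectors.
  The linear structure is the pointwise one.\<close>

type_synonym ('m, 'n) tvec = "('m, 'n) chart \<Rightarrow> real^'n"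

definition tangent_space ::
    "('m, 'n::finite) chart set \<Rightarrow> 'm \<Rightarrow> ('m, 'n) tvec set" where
  "tangent_space A p = {v.
     (\<forall>c\<in>A. \<forall>d\<in>A. p \<in> chart_dom c \<and> p \<in> chart_dom d \<longrightarrow>
        v d = frechet_derivative (transition c d) (at (chart_map c p)) (v c)) \<and>
     (\<forall>c. \<not> (c \<in> A \<and> p \<in> chart_dom c) \<longrightarrow> v c = 0)}"

text \<open>The coordinate vector \<open>\<partial>\<^sub>i\<close> of the chart \<open>c\<close> at \<open>p\<close>.\<close>

definition coord_vec ::
    "('m, 'n::finite) chart set \<Rightarrow> ('m, 'n) chart \<Rightarrow> 'm \<Rightarrow> 'n \<Rightarrow> ('m, 'n) tvec" where
  "coord_vec A c p i = (\<lambda>d. if d \<in> A \<and> p \<in> chart_dom d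
     then frechet_derivative (transition c d) (at (chart_map c p)) (axis i 1) else 0)"

definition smooth_vector_field ::
    "('m, 'n::finite) chart set \<Rightarrow> ('m \<Rightarrow> ('m, 'n) tvec) \<Rightarrow> bool" where
  "smooth_vector_field A X \<longleftrightarrow> (\<forall>p. X p \<in> tangent_space A p) \<and>
     (\<forall>c\<in>A. smooth_on (chart_image c) (\<lambda>x. X (chart_inv c x) c))"


section \<open>Lorentzian metrics\<close>

type_synonym ('m, 'n) metric = "'m \<Rightarrow> ('m, 'n) tvec \<Rightarrow> ('m, 'n) tvec \<Rightarrow> real"

text \<open>The matrix \<open>(g\<^sub>i\<^sub>j)\<close> in the chart \<open>c\<close>, as a function of the coordinates.\<close>

definition gmat ::
    "('m, 'n::finite) chart set \<Rightarrow> ('m, 'n) metric \<Rightarrow> ('m, 'n) chart \<Rightarrow> real^'n \<Rightarrow> real^'n^'n" where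
  "gmat A g c x = (\<chi> i j. let p = chart_inv c x in g p (coord_vec A c p i) (coord_vec A c p j))"

text \<open>In the last conjunct the \<open>n\<close> orthonormal vectors form a basis of the tangent space, so
  it says that \<open>g p\<close> is nondegenerate of signature \<open>(-,+,\<dots>,+)\<close>.\<close>

definition lorentzian_metric ::
    "('m::topological_space, 'n::finite) chart set \<Rightarrow> ('m, 'n) metric \<Rightarrow> bool" where
  "lorentzian_metric A g \<longleftrightarrow>
     (\<forall>p. \<forall>u\<in>tangent_space A p. \<forall>v\<in>tangent_space A p. g p u v = g p v u) \<and>
     (\<forall>p. \<forall>u\<in>tangent_space A p. \<forall>v\<in>tangent_space A p. \<forall>w\<in>tangent_space A p. \<forall>a b.
        g p (\<lambda>c. a *\<^sub>R u c + b *\<^sub>R v c) w = a * g p u w + b * g p v w) \<and>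
     (\<forall>c\<in>A. \<forall>i j. smooth_on (chart_image c) (\<lambda>x. gmat A g c x $ i $ j)) \<and>
     (\<forall>p. \<exists>(e :: 'n \<Rightarrow> ('m, 'n) tvec) k. (\<forall>i. e i \<in> tangent_space A p) \<and>
        (\<forall>i j. g p (e i) (e j) = (if i \<noteq> j then 0 else if i = k then -1 else 1)))"

definition lorentzian_manifold ::
    "('m::{t2_space, second_countable_topology}, 'n::finite) chart set \<Rightarrow> ('m, 'n) metric \<Rightarrow> bool" where
  "lorentzian_manifold A g \<longleftrightarrow> CARD('n) \<ge> 2 \<and> smooth_structure A \<and> lorentzian_metric A g"

definition null_vector ::
    "('m, 'n::finite) chart set \<Rightarrow> ('m, 'n) metric \<Rightarrow> 'm \<Rightarrow> ('m, 'n) tvec \<Rightarrow> bool" where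
  "null_vector A g p u \<longleftrightarrow> u \<in> tangent_space A p \<and> u \<noteq> (\<lambda>c. 0) \<and> g p u u = 0"

definition timelike_vector_field ::
    "('m, 'n::finite) chart set \<Rightarrow> ('m, 'n) metric \<Rightarrow> ('m \<Rightarrow> ('m, 'n) tvec) \<Rightarrow> bool" where
  "timelike_vector_field A g X \<longleftrightarrow> smooth_vector_field A X \<and> (\<forall>p. g p (X p) (X p) < 0)"

definition time_orientable ::
    "('m, 'n::finite) chart set \<Rightarrow> ('m, 'n) metric \<Rightarrow> bool" where
  "time_orientable A g \<longleftrightarrow> (\<exists>X. timelike_vector_field A g X)"


section \<open>Levi-Civita connection, curvature, Lie derivative of the metric\<close>

text \<open>\<open>\<Gamma>\<^sup>i\<^sub>j\<^sub>k\<close> in the chart \<open>c\<close>.\<close>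

definition christoffel ::
    "('m, 'n::finite) chart set \<Rightarrow> ('m, 'n) metric \<Rightarrow> ('m, 'n) chart \<Rightarrow>
     'n \<Rightarrow> 'n \<Rightarrow> 'n \<Rightarrow> real^'n \<Rightarrow> real" where
  "christoffel A g c i j k x = (1/2) * (\<Sum>l\<in>UNIV. matrix_inv (gmat A g c x) $ i $ l *
     (pderiv_at j (\<lambda>y. gmat A g c y $ l $ k) x + pderiv_at k (\<lambda>y. gmat A g c y $ l $ j) x
      - pderiv_at l (\<lambda>y. gmat A g c y $ j $ k) x))"

text \<open>\<open>R\<^sup>i\<^sub>j\<^sub>k\<^sub>l\<close> with \<open>R(\<partial>\<^sub>k, \<partial>\<^sub>l)\<partial>\<^sub>j = \<Sum>\<^sub>i R\<^sup>i\<^sub>j\<^sub>k\<^sub>l \<partial>\<^sub>i\<close> and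
  \<open>R(X, Y)Z = \<nabla>\<^sub>X \<nabla>\<^sub>Y Z - \<nabla>\<^sub>Y \<nabla>\<^sub>X Z - \<nabla>\<^bsub>[X, Y]\<^esub> Z\<close>.\<close>

definition riemann ::
    "('m, 'n::finite) chart set \<Rightarrow> ('m, 'n) metric \<Rightarrow> ('m, 'n) chart \<Rightarrow>
     'n \<Rightarrow> 'n \<Rightarrow> 'n \<Rightarrow> 'n \<Rightarrow> real^'n \<Rightarrow> real" where
  "riemann A g c i j k l x =
     pderiv_at k (christoffel A g c i l j) x - pderiv_at l (christoffel A g c i k j) x
     + (\<Sum>m\<in>UNIV. christoffel A g c i k m x * christoffel A g c m l j x
                 - christoffel A g c i l m x * christoffel A g c m k j x)"

text \<open>\<open>Ric(u, v)\<close> is the trace of \<open>X \<mapsto> R(X, v)u\<close>, so that round spheres have positive Ricci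
  curvature.\<close>

definition ricci_coeff ::
    "('m, 'n::finite) chart set \<Rightarrow> ('m, 'n) metric \<Rightarrow> ('m, 'n) chart \<Rightarrow>
     'n \<Rightarrow> 'n \<Rightarrow> real^'n \<Rightarrow> real" where
  "ricci_coeff A g c j l x = (\<Sum>i\<in>UNIV. riemann A g c i j i l x)"

text \<open>\<open>Ric(u) = Ric(u, u)\<close>. It is evaluated in some chart around \<open>p\<close>; the value does not depend
  on which one, Ricci curvature being a tensor.\<close>

definition ricci ::
    "('m, 'n::finite) chart set \<Rightarrow> ('m, 'n) metric \<Rightarrow> 'm \<Rightarrow> ('m, 'n) tvec \<Rightarrow> real" where
  "ricci A g p u = (let c = (SOME c. c \<in> A \<and> p \<in> chart_dom c) in
     \<Sum>j\<in>UNIV. \<Sum>l\<in>UNIV. ricci_coeff A g c j l (chart_map c p) * u c $ j * u c $ l)"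

text \<open>\<open>(L\<^sub>X g)\<^sub>i\<^sub>j = X\<^sup>k \<partial>\<^sub>k g\<^sub>i\<^sub>j + g\<^sub>k\<^sub>j \<partial>\<^sub>i X\<^sup>k + g\<^sub>i\<^sub>k \<partial>\<^sub>j X\<^sup>k\<close>.\<close>

definition lie_metric ::
    "('m, 'n::finite) chart set \<Rightarrow> ('m, 'n) metric \<Rightarrow> ('m \<Rightarrow> ('m, 'n) tvec) \<Rightarrow> ('m, 'n) chart \<Rightarrow>
     'n \<Rightarrow> 'n \<Rightarrow> real^'n \<Rightarrow> real" where
  "lie_metric A g X c i j x = (\<Sum>k\<in>UNIV.
       X (chart_inv c x) c $ k * pderiv_at k (\<lambda>y. gmat A g c y $ i $ j) x
     + gmat A g c x $ k $ j * pderiv_at i (\<lambda>y. X (chart_inv c y) c $ k) x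
     + gmat A g c x $ i $ k * pderiv_at j (\<lambda>y. X (chart_inv c y) c $ k) x)"

definition conformal_vector_field ::
    "('m, 'n::finite) chart set \<Rightarrow> ('m, 'n) metric \<Rightarrow> ('m \<Rightarrow> ('m, 'n) tvec) \<Rightarrow> bool" where
  "conformal_vector_field A g X \<longleftrightarrow> smooth_vector_field A X \<and>
     (\<exists>\<sigma> :: 'm \<Rightarrow> real. \<forall>c\<in>A. \<forall>p\<in>chart_dom c. \<forall>i j.
        lie_metric A g X c i j (chart_map c p) = 2 * \<sigma> p * gmat A g c (chart_map c p) $ i $ j)"


section \<open>Geodesics and null completeness\<close>

definition velocity ::
    "('m, 'n::finite) chart set \<Rightarrow> (real \<Rightarrow> 'm) \<Rightarrow> real \<Rightarrow> ('m, 'n) tvec" where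
  "velocity A \<gamma> t = (\<lambda>c. if c \<in> A \<and> \<gamma> t \<in> chart_dom c
     then vector_derivative (chart_map c \<circ> \<gamma>) (at t) else 0)"

text \<open>Solutions are automatically smooth, so it suffices to ask for two derivatives. Only the
  values of \<open>\<gamma>\<close> on the open interval \<open>I\<close> matter.\<close>

definition geodesic ::
    "('m::topological_space, 'n::finite) chart set \<Rightarrow> ('m, 'n) metric \<Rightarrow> real set \<Rightarrow> (real \<Rightarrow> 'm) \<Rightarrow> bool"
where
  "geodesic A g I \<gamma> \<longleftrightarrow> open I \<and> is_interval I \<and> I \<noteq> {} \<and> continuous_on I \<gamma> \<and>
     (\<forall>t\<in>I. \<forall>c\<in>A. \<gamma> t \<in> chart_dom c \<longrightarrow>
        (chart_map c \<circ> \<gamma>) differentiable (at t) \<and>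
        ((\<lambda>s. velocity A \<gamma> s c) has_vector_derivative
           (\<chi> i. - (\<Sum>j\<in>UNIV. \<Sum>k\<in>UNIV. christoffel A g c i j k (chart_map c (\<gamma> t)) *
                      velocity A \<gamma> t c $ j * velocity A \<gamma> t c $ k))) (at t))"

definition null_geodesic ::
    "('m::topological_space, 'n::finite) chart set \<Rightarrow> ('m, 'n) metric \<Rightarrow> real set \<Rightarrow> (real \<Rightarrow> 'm) \<Rightarrow> bool"
where
  "null_geodesic A g I \<gamma> \<longleftrightarrow> geodesic A g I \<gamma> \<and> (\<forall>t\<in>I. null_vector A g (\<gamma> t) (velocity A \<gamma> t))"

definition inextendible ::
    "('m::topological_space, 'n::finite) chart set \<Rightarrow> ('m, 'n) metric \<Rightarrow> real set \<Rightarrow> (real \<Rightarrow> 'm) \<Rightarrow> bool"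
where
  "inextendible A g I \<gamma> \<longleftrightarrow> \<not> (\<exists>J \<delta>. geodesic A g J \<delta> \<and> I \<subset> J \<and> (\<forall>t\<in>I. \<delta> t = \<gamma> t))"

definition null_complete ::
    "('m::topological_space, 'n::finite) chart set \<Rightarrow> ('m, 'n) metric \<Rightarrow> bool" where
  "null_complete A g \<longleftrightarrow>
     (\<forall>I \<gamma>. null_geodesic A g I \<gamma> \<and> inextendible A g I \<gamma> \<longrightarrow> I = UNIV)"


section \<open>Embedded null hypersurfaces\<close>

text \<open>\<open>L\<close> is cut out in the domain of \<open>c\<close> by the vanishing of the \<open>k\<close>-th coordinate.\<close>

definition slice_chart ::
    "('m, 'n::finite) chart set \<Rightarrow> 'm set \<Rightarrow> ('m, 'n) chart \<Rightarrow> 'n \<Rightarrow> bool" where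
  "slice_chart A L c k \<longleftrightarrow> c \<in> A \<and> L \<inter> chart_dom c = {q \<in> chart_dom c. chart_map c q $ k = 0}"

definition embedded_hypersurface ::
    "('m, 'n::finite) chart set \<Rightarrow> 'm set \<Rightarrow> bool" where
  "embedded_hypersurface A L \<longleftrightarrow> L \<noteq> {} \<and> (\<forall>p\<in>L. \<exists>c k. slice_chart A L c k \<and> p \<in> chart_dom c)"

text \<open>The tangent space of \<open>L\<close> at \<open>p\<close>, as a subspace of that of the ambient manifold. All slice
  charts around \<open>p\<close> give the same subspace.\<close>

definition hypersurface_tangent_space ::
    "('m, 'n::finite) chart set \<Rightarrow> 'm set \<Rightarrow> 'm \<Rightarrow> ('m, 'n) tvec set" where
  "hypersurface_tangent_space A L p = {v \<in> tangent_space A p.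
     \<exists>c k. slice_chart A L c k \<and> p \<in> chart_dom c \<and> v c $ k = 0}"

definition null_hypersurface ::
    "('m, 'n::finite) chart set \<Rightarrow> ('m, 'n) metric \<Rightarrow> 'm set \<Rightarrow> bool" where
  "null_hypersurface A g L \<longleftrightarrow> embedded_hypersurface A L \<and>
     (\<forall>p\<in>L. \<exists>u\<in>hypersurface_tangent_space A L p. u \<noteq> (\<lambda>c. 0) \<and>
        (\<forall>w\<in>hypersurface_tangent_space A L p. g p u w = 0))"

end

theory Submission
  imports Defs
begin

text \<open>Normalise the null normal \<open>\<xi>\<close> of a closed null hypersurface \<open>L\<close> by \<open>g(\<xi>, \<zeta>) = -1\<close>. Since \<open>\<zeta>\<close>
  is conformal, \<open>\<nabla>\<^sub>\<xi> \<xi> = 0\<close>, so the integral curves of \<open>\<xi>\<close> in \<open>L\<close> are null geodesics. A maximal one is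
  inextendible: a geodesic extension past an endpoint \<open>b\<close> meets \<open>L\<close> at \<open>b\<close> because \<open>L\<close> is closed, has
  velocity \<open>\<xi>\<close> there by continuity, and the integral curve starting at that point could be glued on.
  By null completeness it is defined on all of \<open>\<real>\<close>. Along it the null expansion \<open>\<theta>\<close> satisfies
  Raychaudhuri's inequality \<open>\<theta>' \<le> - \<theta>\<^sup>2 / n - Ric(\<xi>)\<close>, and \<open>\<theta>' < - \<theta>\<^sup>2 / n\<close> has no solution on \<open>\<real>\<close>.

  The expansion at \<open>p\<close> is computed as the divergence, in an arbitrary chart, of an extension \<open>X\<close> of \<open>\<xi>\<close>
  for which \<open>g(X, X)\<close> vanishes to second order on \<open>L\<close>; this makes it independent of the chart and of the
  extension. Raychaudhuri's inequality is then Bochner's formula for \<open>X\<close>.\<close>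

section \<open>Smooth functions\<close>

text \<open>The obstacle is that \<xi> lives on \<open>L\<close> only, while Bochner's formula needs
  a field on an open set. Two extensions agreeing on \<open>{f = 0}\<close> have derivatives that
  differ by \<open>df \<otimes> Y\<close>, hence divergences that differ by \<open>df(Y)\<close>, a
  multiple of \<open>g(X, Y)\<close>; this is zero if \<open>g(X, X)\<close> vanishes to second
  order for both. The same device removes the term div(\<nabla>_X X) of Bochner's formula:
  \<nabla>_X X vanishes on \<open>L\<close> alone, but its derivative is
  \<open>df \<otimes> Y\<close> with \<open>g(X, Y) = 0\<close>. For the geodesic property, symmetry
  of the second fundamental form makes \<nabla>_\<xi> \<xi> orthogonal to \<open>L\<close>.
  Differentiating \<open>g(\<xi>, \<zeta>) = -1\<close> along \<xi> gives \<open>g(\<nabla>_\<xi>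
  \<xi>, \<zeta>) = - (1/2) (L_\<zeta> g)(\<xi>, \<xi>)\<close>, which is a multiple of
  \<open>g(\<xi>, \<xi>) = 0\<close>. Both together leave only \<nabla>_\<xi> \<xi> = 0. Since
  \<open>g\<close> is indefinite, \<open>(tr A)^2 \<le> n tr(A^2)\<close> may fail for
  \<open>g\<close>-symmetric maps. It holds for the shape operator because that descends to the
  vectors orthogonal to \<xi> modulo \<xi>, where \<open>g\<close> is Euclidean.\<close>

lemma frechet_derivative_eqI:
  "(f has_derivative f') (at x) \<Longrightarrow> frechet_derivative f (at x) = f'"
  by (metis frechet_derivative_at)

lemma Ck_on_lower: "Ck_on (Suc k) S f \<Longrightarrow> Ck_on k S f"
proof (induction k arbitrary: f)
  case 0
  then show ?case
    by (auto intro!: continuous_at_imp_continuous_on differentiable_imp_continuous_within)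
next
  case (Suc k)
  then show ?case by (metis Ck_on.simps(2))
qed

lemma Ck_on_cong:
  assumes "open S" "\<And>x. x \<in> S \<Longrightarrow> f x = h x" "Ck_on k S f"
  shows "Ck_on k S h"
  using assms(2,3)
proof (induction k arbitrary: f h)
  case 0
  then show ?case by (metis Ck_on.simps(1) continuous_on_cong)
next
  case (Suc k)
  have der: "(h has_derivative frechet_derivative f (at x)) (at x)" if "x \<in> S" for x
  proof -
    have "(f has_derivative frechet_derivative f (at x)) (at x)"
      using Suc.prems(2) that by (simp add: frechet_derivative_works)
    then show ?thesis
      using has_derivative_transform_within_open[OF _ \<open>open S\<close> that] Suc.prems(1) by blast
  qed
  have "frechet_derivative h (at x) = frechet_derivative f (at x)" if "x \<in> S" for x
    using der[OF that] by (rule frechet_derivative_eqI)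
  then have "Ck_on k S (\<lambda>x. frechet_derivative h (at x) v)" for v
    using Suc.IH[of "\<lambda>x. frechet_derivative f (at x) v"] Suc.prems(2) by simp
  then show ?case using der by (auto simp: differentiable_def)
qed

lemma Ck_on_subset: "Ck_on k S f \<Longrightarrow> T \<subseteq> S \<Longrightarrow> Ck_on k T f"
  by (induction k arbitrary: f) (auto intro: continuous_on_subset)

lemma Ck_on_SucI:
  assumes "open S" "\<And>x. x \<in> S \<Longrightarrow> (f has_derivative f' x) (at x)"
    and "\<And>v. Ck_on k S (\<lambda>x. f' x v)"
  shows "Ck_on (Suc k) S f"
proof -
  have "Ck_on k S (\<lambda>x. frechet_derivative f (at x) v)" for v
    by (rule Ck_on_cong[OF assms(1) _ assms(3)[of v]])
       (simp add: frechet_derivative_eqI[OF assms(2)])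
  then show ?thesis using assms(2) by (auto simp: differentiable_def)
qed

lemma Ck_on_Suc_derivative:
  "Ck_on (Suc k) S f \<Longrightarrow> x \<in> S \<Longrightarrow> (f has_derivative frechet_derivative f (at x)) (at x)"
  by (simp add: frechet_derivative_works)

lemma Ck_on_const: "Ck_on k S (\<lambda>x. c)"
  by (induction k arbitrary: c) auto

lemma Ck_on_bilinear:
  assumes "open S" "bounded_bilinear p" "Ck_on k S f" "Ck_on k S h"
  shows "Ck_on k S (\<lambda>x. p (f x) (h x))"
  using assms(3,4)
proof (induction k arbitrary: f h)
  case 0
  then show ?case using bounded_bilinear.continuous_on[OF assms(2)] by auto
next
  case (Suc k)
  have add: "Ck_on j S (\<lambda>x. u x + w x)" if "Ck_on j S u" "Ck_on j S w" for j and u w :: "'a \<Rightarrow> 'd"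
    using that
  proof (induction j arbitrary: u w)
    case 0
    then show ?case by (auto intro: continuous_on_add)
  next
    case (Suc j)
    show ?case
      by (rule Ck_on_SucI[OF assms(1) has_derivative_add[OF Ck_on_Suc_derivative[OF Suc.prems(1)]
              Ck_on_Suc_derivative[OF Suc.prems(2)]]])
         (use Suc in auto)
  qed
  show ?case
  proof (rule Ck_on_SucI[OF assms(1) bounded_bilinear.FDERIV[OF assms(2)
          Ck_on_Suc_derivative[OF Suc.prems(1)] Ck_on_Suc_derivative[OF Suc.prems(2)]]])
    fix v
    show "Ck_on k S (\<lambda>x. p (f x) (frechet_derivative h (at x) v)
                       + p (frechet_derivative f (at x) v) (h x))"
      using Suc.prems Suc.prems[THEN Ck_on_lower] by (intro add Suc.IH) simp_all
  qed auto
qed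

lemma Ck_on_add:
  assumes "open S" "Ck_on k S f" "Ck_on k S h"
  shows "Ck_on k S (\<lambda>x. f x + h x)"
  using assms(2,3)
proof (induction k arbitrary: f h)
  case 0
  then show ?case by (auto intro: continuous_on_add)
next
  case (Suc k)
  show ?case
    by (rule Ck_on_SucI[OF assms(1) has_derivative_add[OF Ck_on_Suc_derivative[OF Suc.prems(1)]
            Ck_on_Suc_derivative[OF Suc.prems(2)]]])
       (use Suc in auto)
qed

lemma Ck_on_sum:
  assumes "open S" "\<And>i. i \<in> I \<Longrightarrow> Ck_on k S (f i)"
  shows "Ck_on k S (\<lambda>x. \<Sum>i\<in>I. f i x)"
  using assms(2)
  by (induction I rule: infinite_finite_induct)
     (auto intro!: Ck_on_add[OF assms(1)] Ck_on_const)

lemma Ck_on_inverse: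
  fixes f :: "'a::real_normed_vector \<Rightarrow> real"
  assumes "open S" "\<And>x. x \<in> S \<Longrightarrow> f x \<noteq> 0" "Ck_on k S f"
  shows "Ck_on k S (\<lambda>x. inverse (f x))"
  using assms(3)
proof (induction k)
  case 0
  then show ?case using assms(2) by (auto intro!: continuous_intros)
next
  case (Suc k)
  note mult = Ck_on_bilinear[OF assms(1) bounded_bilinear_mult]
  show ?case
  proof (rule Ck_on_SucI[OF assms(1) Deriv.has_derivative_inverse])
    fix v
    have "Ck_on k S (\<lambda>x. inverse (f x))" by (rule Suc.IH[OF Ck_on_lower[OF Suc.prems]])
    moreover have "Ck_on k S (\<lambda>x. frechet_derivative f (at x) v)" using Suc.prems by simp
    ultimately have "Ck_on k S (\<lambda>x. (- 1) * (inverse (f x) * frechet_derivative f (at x) v * inverse (f x)))"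
      by (intro mult Ck_on_const)
    then show "Ck_on k S (\<lambda>x. - (inverse (f x) * frechet_derivative f (at x) v * inverse (f x)))"
      by simp
  qed (fact assms(2) Ck_on_Suc_derivative[OF Suc.prems])+
qed

lemma linear_euclidean_expansion:
  fixes L :: "'b::euclidean_space \<Rightarrow> 'c::real_vector"
  assumes "linear L"
  shows "(\<Sum>b\<in>Basis. (w \<bullet> b) *\<^sub>R L b) = L w"
proof -
  have "L w = L (\<Sum>b\<in>Basis. (w \<bullet> b) *\<^sub>R b)" by (simp only: euclidean_representation)
  then show ?thesis by (simp add: linear_sum[OF assms] linear_scale[OF assms])
qed

text \<open>The chain rule evaluates the derivative of \<open>f\<close> in a direction that varies
  with \<open>x\<close>, whereas \<open>Ck_on\<close> speaks of fixed directions. Expanding that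
  direction in the basis separates the two dependences, so that the induction hypothesis applies to
  each directional derivative of \<open>f\<close>.\<close>

lemma Ck_on_compose:
  fixes \<phi> :: "'a::real_normed_vector \<Rightarrow> 'b::euclidean_space"
  assumes "open S" "\<phi> ` S \<subseteq> T" "Ck_on k S \<phi>" "Ck_on k T f"
  shows "Ck_on k S (\<lambda>x. f (\<phi> x))"
  using assms(3,4)
proof (induction k arbitrary: f)
  case 0
  then show ?case using assms(2) by (auto intro: continuous_on_compose2)
next
  case (Suc k)
  let ?D = "\<lambda>x v. \<Sum>b\<in>Basis. (frechet_derivative \<phi> (at x) v \<bullet> b) *\<^sub>R frechet_derivative f (at (\<phi> x)) b"
  show ?case
  proof (rule Ck_on_SucI[OF assms(1)])
    fix x assume x: "x \<in> S"
    have f: "(f has_derivative frechet_derivative f (at (\<phi> x))) (at (\<phi> x))"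
      by (rule Ck_on_Suc_derivative[OF Suc.prems(2)]) (use assms(2) x in blast)
    have "((\<lambda>x. f (\<phi> x)) has_derivative (\<lambda>v. frechet_derivative f (at (\<phi> x)) (frechet_derivative \<phi> (at x) v))) (at x)"
      by (rule has_derivative_compose[OF Ck_on_Suc_derivative[OF Suc.prems(1) x] f])
    then show "((\<lambda>x. f (\<phi> x)) has_derivative ?D x) (at x)"
      by (simp only: linear_euclidean_expansion[OF has_derivative_linear[OF f]])
  next
    fix v
    have \<phi>: "Ck_on k S \<phi>" by (rule Ck_on_lower[OF Suc.prems(1)])
    have "Ck_on k S (\<lambda>x. frechet_derivative \<phi> (at x) v)"
      using Suc.prems(1) by (simp only: Ck_on.simps(2))
    then have "Ck_on k S (\<lambda>x. frechet_derivative \<phi> (at x) v \<bullet> b)" for b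
      by (rule Ck_on_bilinear[OF assms(1) bounded_bilinear_inner]) (rule Ck_on_const)
    moreover have "Ck_on k S (\<lambda>x. frechet_derivative f (at (\<phi> x)) b)" for b
      by (rule Suc.IH[OF \<phi>]) (use Suc.prems(2) in \<open>simp only: Ck_on.simps(2)\<close>)
    ultimately show "Ck_on k S (\<lambda>x. ?D x v)"
      by (intro Ck_on_sum[OF assms(1)] Ck_on_bilinear[OF assms(1) bounded_bilinear_scaleR])
  qed
qed

lemma smooth_on_cong: "open S \<Longrightarrow> (\<And>x. x \<in> S \<Longrightarrow> f x = h x) \<Longrightarrow> smooth_on S f \<Longrightarrow> smooth_on S h"
  unfolding smooth_on_def using Ck_on_cong by blast

lemma smooth_on_subset: "smooth_on S f \<Longrightarrow> T \<subseteq> S \<Longrightarrow> smooth_on T f"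
  unfolding smooth_on_def using Ck_on_subset by blast

lemma smooth_on_const: "smooth_on S (\<lambda>x. c)"
  by (simp add: smooth_on_def Ck_on_const)

lemma smooth_on_add:
  "open S \<Longrightarrow> smooth_on S f \<Longrightarrow> smooth_on S h \<Longrightarrow> smooth_on S (\<lambda>x. f x + h x)"
  by (simp add: smooth_on_def Ck_on_add)

lemma smooth_on_bilinear:
  "open S \<Longrightarrow> bounded_bilinear p \<Longrightarrow> smooth_on S f \<Longrightarrow> smooth_on S h \<Longrightarrow> smooth_on S (\<lambda>x. p (f x) (h x))"
  by (simp add: smooth_on_def Ck_on_bilinear)

lemma smooth_on_mult:
  fixes f h :: "'a::real_normed_vector \<Rightarrow> real"
  shows "open S \<Longrightarrow> smooth_on S f \<Longrightarrow> smooth_on S h \<Longrightarrow> smooth_on S (\<lambda>x. f x * h x)"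
  by (rule smooth_on_bilinear[OF _ bounded_bilinear_mult])

lemma smooth_on_sum:
  "open S \<Longrightarrow> (\<And>i. i \<in> I \<Longrightarrow> smooth_on S (f i)) \<Longrightarrow> smooth_on S (\<lambda>x. \<Sum>i\<in>I. f i x)"
  by (simp add: smooth_on_def Ck_on_sum)

lemma smooth_on_uminus:
  fixes f :: "'a::real_normed_vector \<Rightarrow> real"
  assumes "open S" "smooth_on S f" shows "smooth_on S (\<lambda>x. - f x)"
  using smooth_on_mult[OF assms(1) smooth_on_const[of S "-1"] assms(2)] by simp

lemma smooth_on_diff:
  fixes f h :: "'a::real_normed_vector \<Rightarrow> real"
  assumes "open S" "smooth_on S f" "smooth_on S h" shows "smooth_on S (\<lambda>x. f x - h x)"
  using smooth_on_add[OF assms(1,2) smooth_on_uminus[OF assms(1,3)]] by simp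

lemma smooth_on_prod:
  fixes f :: "'i \<Rightarrow> 'a::real_normed_vector \<Rightarrow> real"
  assumes "open S" "\<And>i. i \<in> I \<Longrightarrow> smooth_on S (f i)"
  shows "smooth_on S (\<lambda>x. \<Prod>i\<in>I. f i x)"
  using assms(2)
  by (induction I rule: infinite_finite_induct)
     (auto intro!: smooth_on_mult[OF assms(1)] smooth_on_const)

lemma smooth_on_inverse:
  fixes f :: "'a::real_normed_vector \<Rightarrow> real"
  shows "open S \<Longrightarrow> (\<And>x. x \<in> S \<Longrightarrow> f x \<noteq> 0) \<Longrightarrow> smooth_on S f \<Longrightarrow> smooth_on S (\<lambda>x. inverse (f x))"
  by (simp add: smooth_on_def Ck_on_inverse)

lemma smooth_on_divide:
  fixes f h :: "'a::real_normed_vector \<Rightarrow> real"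
  shows "open S \<Longrightarrow> (\<And>x. x \<in> S \<Longrightarrow> h x \<noteq> 0) \<Longrightarrow> smooth_on S f \<Longrightarrow> smooth_on S h \<Longrightarrow> smooth_on S (\<lambda>x. f x / h x)"
  by (simp add: divide_inverse smooth_on_mult smooth_on_inverse)

lemma smooth_on_compose:
  fixes \<phi> :: "'a::real_normed_vector \<Rightarrow> 'b::euclidean_space"
  shows "open S \<Longrightarrow> \<phi> ` S \<subseteq> T \<Longrightarrow> smooth_on S \<phi> \<Longrightarrow> smooth_on T f \<Longrightarrow> smooth_on S (\<lambda>x. f (\<phi> x))"
  unfolding smooth_on_def using Ck_on_compose by blast

lemma smooth_on_nth:
  fixes f :: "'a::real_normed_vector \<Rightarrow> real^'n"
  assumes "open S" "smooth_on S f" shows "smooth_on S (\<lambda>x. f x $ i)"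
  using smooth_on_bilinear[OF assms(1) bounded_bilinear_inner assms(2) smooth_on_const[of S "axis i 1"]]
  by (simp add: inner_axis)

lemma smooth_on_vecI:
  fixes f :: "'a::real_normed_vector \<Rightarrow> real^'n"
  assumes "open S" "\<And>i. smooth_on S (\<lambda>x. f x $ i)" shows "smooth_on S f"
proof -
  have "smooth_on S (\<lambda>x. \<Sum>i\<in>UNIV. f x $ i *\<^sub>R axis i (1::real))"
    by (intro smooth_on_sum smooth_on_bilinear[OF assms(1) bounded_bilinear_scaleR] assms smooth_on_const)
  moreover have "(\<Sum>i\<in>UNIV. f x $ i *\<^sub>R axis i (1::real)) = f x" for x
    using basis_expansion[of "f x"] by (simp add: scalar_mult_eq_scaleR)
  ultimately show ?thesis by simp
qed

lemma smooth_on_has_derivative: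
  "smooth_on S f \<Longrightarrow> x \<in> S \<Longrightarrow> (f has_derivative frechet_derivative f (at x)) (at x)"
  unfolding smooth_on_def using Ck_on_Suc_derivative by blast

lemma smooth_on_differentiable: "smooth_on S f \<Longrightarrow> x \<in> S \<Longrightarrow> f differentiable (at x)"
  using smooth_on_has_derivative by (auto simp: differentiable_def)

lemma smooth_on_continuous_on: "smooth_on S f \<Longrightarrow> continuous_on S f"
  unfolding smooth_on_def by (metis Ck_on.simps(1))

lemma smooth_on_frechet: "smooth_on S f \<Longrightarrow> smooth_on S (\<lambda>x. frechet_derivative f (at x) v)"
  unfolding smooth_on_def by (metis Ck_on.simps(2))

lemma smooth_on_pderiv: "smooth_on S f \<Longrightarrow> smooth_on S (pderiv_at i f)"
  unfolding pderiv_at_def by (rule smooth_on_frechet)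

lemma smooth_on_det:
  fixes M :: "'a::real_normed_vector \<Rightarrow> real^'n^'n"
  assumes "open S" "\<And>i j. smooth_on S (\<lambda>x. M x $ i $ j)"
  shows "smooth_on S (\<lambda>x. det (M x))"
  unfolding det_def
  by (intro smooth_on_sum smooth_on_mult smooth_on_prod smooth_on_const assms)

lemma matrix_inv_inverse:
  fixes M :: "real^'n^'n"
  assumes "invertible M"
  shows "M ** matrix_inv M = mat 1" "matrix_inv M ** M = mat 1"
  using someI_ex[of "\<lambda>A'. M ** A' = mat 1 \<and> A' ** M = mat 1"] assms
  unfolding invertible_def matrix_inv_def by auto

text \<open>Cramer's rule writes each entry as a quotient of determinants, which are polynomials in
  the entries of \<open>M\<close>.\<close>

lemma smooth_on_matrix_inv:
  fixes M :: "'a::real_normed_vector \<Rightarrow> real^'n^'n"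
  assumes "open S" "\<And>i j. smooth_on S (\<lambda>x. M x $ i $ j)" "\<And>x. x \<in> S \<Longrightarrow> invertible (M x)"
  shows "smooth_on S (\<lambda>x. matrix_inv (M x) $ k $ l)"
proof -
  let ?C = "\<lambda>x. (\<chi> i j. if j = k then axis l 1 $ i else M x $ i $ j) :: real^'n^'n"
  have "matrix_inv (M x) $ k $ l = det (?C x) / det (M x)" if "x \<in> S" for x
  proof -
    have "M x *v (matrix_inv (M x) *v axis l 1) = axis l 1"
      using matrix_inv_inverse(1)[OF assms(3)[OF that]]
      by (simp add: matrix_vector_mul_assoc)
    then have "matrix_inv (M x) *v axis l 1 = (\<chi> k. det (\<chi> i j. if j = k then axis l 1 $ i else M x $ i $ j) / det (M x))"
      using cramer[of "M x"] assms(3)[OF that] invertible_det_nz by blast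
    then have "(matrix_inv (M x) *v axis l 1) $ k = det (?C x) / det (M x)" by simp
    then show ?thesis by (simp add: matrix_vector_mul_component inner_axis row_def)
  qed
  moreover have "smooth_on S (\<lambda>x. det (?C x) / det (M x))"
  proof (intro smooth_on_divide smooth_on_det assms)
    show "smooth_on S (\<lambda>x. ?C x $ i $ j)" for i j
      using assms(2) by (cases "j = k") (auto intro: smooth_on_const)
    show "det (M x) \<noteq> 0" if "x \<in> S" for x using assms(3)[OF that] invertible_det_nz by blast
  qed
  ultimately show ?thesis
    using smooth_on_cong[OF assms(1), of "\<lambda>x. det (?C x) / det (M x)"] by simp
qed

section \<open>Partial derivatives\<close>

lemma frechet_derivative_pderiv:
  fixes f :: "real^'n \<Rightarrow> real"
  assumes "f differentiable (at x)"
  shows "frechet_derivative f (at x) v = (\<Sum>i\<in>UNIV. v $ i * pderiv_at i f x)"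
proof -
  have lin: "linear (frechet_derivative f (at x))" by (rule linear_frechet_derivative[OF assms])
  have "v = (\<Sum>i\<in>UNIV. v $ i *\<^sub>R axis i 1)"
    using basis_expansion[of v] by (simp add: scalar_mult_eq_scaleR)
  then have "frechet_derivative f (at x) v = frechet_derivative f (at x) (\<Sum>i\<in>UNIV. v $ i *\<^sub>R axis i 1)"
    by simp
  also have "\<dots> = (\<Sum>i\<in>UNIV. v $ i * pderiv_at i f x)"
    by (simp add: linear_sum[OF lin] linear_scale[OF lin] pderiv_at_def)
  finally show ?thesis .
qed

lemma pderiv_at_eqI: "(f has_derivative f') (at x) \<Longrightarrow> pderiv_at i f x = f' (axis i 1)"
  by (simp add: pderiv_at_def frechet_derivative_eqI)

lemma pderiv_const [simp]: "pderiv_at i (\<lambda>x. c) x = 0"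
  by (simp add: pderiv_at_def)

lemma pderiv_cong:
  assumes "open S" "x \<in> S" "\<And>y. y \<in> S \<Longrightarrow> f y = h y" "f differentiable (at x)"
  shows "pderiv_at i h x = pderiv_at i f x"
  using frechet_derivative_transform_within_open[OF assms(4,1,2,3)] by (simp add: pderiv_at_def)

lemma differentiable_frechetD:
  "f differentiable (at x) \<Longrightarrow> (f has_derivative frechet_derivative f (at x)) (at x)"
  by (rule frechet_derivative_works[THEN iffD1])

lemma pderiv_add:
  assumes "f differentiable (at x)" "h differentiable (at x)"
  shows "pderiv_at i (\<lambda>x. f x + h x) x = pderiv_at i f x + pderiv_at i h x"
  using pderiv_at_eqI[OF has_derivative_add[OF assms[THEN differentiable_frechetD]]]
  by (simp only: pderiv_at_def)

lemma pderiv_diff: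
  assumes "f differentiable (at x)" "h differentiable (at x)"
  shows "pderiv_at i (\<lambda>x. f x - h x) x = pderiv_at i f x - pderiv_at i h x"
  using pderiv_at_eqI[OF has_derivative_diff[OF assms[THEN differentiable_frechetD]]]
  by (simp only: pderiv_at_def)

lemma pderiv_mult:
  fixes f h :: "real^'n \<Rightarrow> real"
  assumes "f differentiable (at x)" "h differentiable (at x)"
  shows "pderiv_at i (\<lambda>x. f x * h x) x = pderiv_at i f x * h x + f x * pderiv_at i h x"
  using pderiv_at_eqI[OF has_derivative_mult[OF assms[THEN differentiable_frechetD]]]
  by (simp only: pderiv_at_def add.commute)

lemma pderiv_sum:
  assumes "\<And>j. j \<in> I \<Longrightarrow> f j differentiable (at x)"
  shows "pderiv_at i (\<lambda>x. \<Sum>j\<in>I. f j x) x = (\<Sum>j\<in>I. pderiv_at i (f j) x)"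
  using pderiv_at_eqI[OF has_derivative_sum[OF assms[THEN differentiable_frechetD]]]
  by (simp only: pderiv_at_def)

lemma differentiable_nth:
  fixes \<phi> :: "'a::real_normed_vector \<Rightarrow> real^'n"
  assumes "\<phi> differentiable (at x)"
  shows "(\<lambda>y. \<phi> y $ a) differentiable (at x)"
    and "frechet_derivative (\<lambda>y. \<phi> y $ a) (at x) v = frechet_derivative \<phi> (at x) v $ a"
proof -
  have "((\<lambda>y. \<phi> y $ a) has_derivative (\<lambda>v. frechet_derivative \<phi> (at x) v $ a)) (at x)"
    using assms by (intro bounded_linear.has_derivative[OF bounded_linear_vec_nth])
                   (simp add: frechet_derivative_works)
  then show "(\<lambda>y. \<phi> y $ a) differentiable (at x)"
    and "frechet_derivative (\<lambda>y. \<phi> y $ a) (at x) v = frechet_derivative \<phi> (at x) v $ a"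
    by (auto simp: differentiable_def frechet_derivative_eqI)
qed

lemma pderiv_compose:
  fixes \<phi> :: "real^'m \<Rightarrow> real^'n"
  assumes "\<phi> differentiable (at x)" "f differentiable (at (\<phi> x))"
  shows "pderiv_at i (\<lambda>z. f (\<phi> z)) x = (\<Sum>a\<in>UNIV. pderiv_at i (\<lambda>z. \<phi> z $ a) x * pderiv_at a f (\<phi> x))"
proof -
  have "((\<lambda>z. f (\<phi> z)) has_derivative (\<lambda>v. frechet_derivative f (at (\<phi> x)) (frechet_derivative \<phi> (at x) v))) (at x)"
    by (rule has_derivative_compose[OF assms[THEN differentiable_frechetD]])
  then have "pderiv_at i (\<lambda>z. f (\<phi> z)) x = frechet_derivative f (at (\<phi> x)) (frechet_derivative \<phi> (at x) (axis i 1))"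
    by (rule pderiv_at_eqI)
  also have "\<dots> = (\<Sum>a\<in>UNIV. frechet_derivative \<phi> (at x) (axis i 1) $ a * pderiv_at a f (\<phi> x))"
    by (rule frechet_derivative_pderiv[OF assms(2)])
  finally show ?thesis by (simp only: pderiv_at_def[of i] differentiable_nth(2)[OF assms(1)])
qed

text \<open>The mean value theorem is applied twice, first in direction \<open>i\<close> to the
  difference of two parallel edges of the square, then in direction \<open>j\<close> to
  \<open>pderiv_at i f\<close>. The left side is symmetric in \<open>i\<close> and \<open>j\<close>,
  which is what \<open>pderiv_commute\<close> exploits.\<close>

lemma second_difference_mvt:
  fixes f :: "real^'n \<Rightarrow> real"
  assumes "smooth_on S f" "0 < r" "cball x (2 * r) \<subseteq> S"
  shows "\<exists>y\<in>cball x (2 * r).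
    f (x + r *\<^sub>R axis i 1 + r *\<^sub>R axis j 1) - f (x + r *\<^sub>R axis i 1) - f (x + r *\<^sub>R axis j 1) + f x
    = r * r * pderiv_at j (pderiv_at i f) y"
proof -
  let ?e = "axis i 1 :: real^'n" and ?d = "axis j 1 :: real^'n"
  have inS: "x + s *\<^sub>R ?e + t *\<^sub>R ?d \<in> cball x (2 * r)" if "0 \<le> s" "s \<le> r" "0 \<le> t" "t \<le> r" for s t
  proof -
    have "norm (s *\<^sub>R ?e + t *\<^sub>R ?d) \<le> norm (s *\<^sub>R ?e) + norm (t *\<^sub>R ?d)" by (rule norm_triangle_ineq)
    also have "\<dots> \<le> 2 * r" using that by simp
    finally have "dist (x + (s *\<^sub>R ?e + t *\<^sub>R ?d)) x \<le> 2 * r" by (simp add: dist_norm)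
    then show ?thesis by (simp add: dist_commute add.assoc)
  qed
  have D: "((\<lambda>s. F (p + s *\<^sub>R axis k 1)) has_real_derivative pderiv_at k F (p + s *\<^sub>R axis k 1)) (at s)"
    if "F differentiable (at (p + s *\<^sub>R axis k 1))" for F p and k :: 'n and s
  proof -
    have "((\<lambda>s. p + s *\<^sub>R axis k 1) has_derivative (\<lambda>h. h *\<^sub>R axis k 1)) (at s)"
      by (auto intro!: derivative_eq_intros)
    from has_derivative_compose[OF this] that
    have "((\<lambda>s. F (p + s *\<^sub>R axis k 1)) has_derivative (\<lambda>h. frechet_derivative F (at (p + s *\<^sub>R axis k 1)) (h *\<^sub>R axis k 1))) (at s)"
      by (metis differentiable_frechetD)
    then show ?thesis
      by (simp add: has_field_derivative_def pderiv_at_def mult_commute_abs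
          linear_scale[OF linear_frechet_derivative[OF that]])
  qed
  have df: "f differentiable (at (x + s *\<^sub>R ?e + t *\<^sub>R ?d))"
    and dpf: "pderiv_at i f differentiable (at (x + s *\<^sub>R ?e + t *\<^sub>R ?d))"
    if "0 \<le> s" "s \<le> r" "0 \<le> t" "t \<le> r" for s t
    using smooth_on_differentiable[OF assms(1)] smooth_on_differentiable[OF smooth_on_pderiv[OF assms(1)]]
      inS[OF that] assms(3) by blast+
  let ?\<phi> = "\<lambda>s. f ((x + r *\<^sub>R ?d) + s *\<^sub>R ?e) - f (x + s *\<^sub>R ?e)"
  have "\<exists>s>0. s < r \<and> ?\<phi> r - ?\<phi> 0 = (r - 0) * (pderiv_at i f ((x + r *\<^sub>R ?d) + s *\<^sub>R ?e) - pderiv_at i f (x + s *\<^sub>R ?e))"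
  proof (rule MVT2[OF \<open>0 < r\<close>])
    fix s assume s: "0 \<le> s" "s \<le> r"
    show "(?\<phi> has_real_derivative pderiv_at i f ((x + r *\<^sub>R ?d) + s *\<^sub>R ?e) - pderiv_at i f (x + s *\<^sub>R ?e)) (at s)"
      using df[OF s, of r] df[OF s, of 0] \<open>0 < r\<close> by (intro DERIV_diff D) (simp_all add: add.commute add.left_commute)
  qed
  then obtain s where s: "0 < s" "s < r" "?\<phi> r - ?\<phi> 0 = r * (pderiv_at i f ((x + r *\<^sub>R ?d) + s *\<^sub>R ?e) - pderiv_at i f (x + s *\<^sub>R ?e))"
    by auto
  let ?\<psi> = "\<lambda>t. pderiv_at i f ((x + s *\<^sub>R ?e) + t *\<^sub>R ?d)"
  have "\<exists>t>0. t < r \<and> ?\<psi> r - ?\<psi> 0 = (r - 0) * pderiv_at j (pderiv_at i f) ((x + s *\<^sub>R ?e) + t *\<^sub>R ?d)"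
    using dpf[of s] s by (intro MVT2[OF \<open>0 < r\<close>] D) auto
  then obtain t where t: "0 < t" "t < r" "?\<psi> r - ?\<psi> 0 = r * pderiv_at j (pderiv_at i f) ((x + s *\<^sub>R ?e) + t *\<^sub>R ?d)"
    by auto
  have "f (x + r *\<^sub>R ?e + r *\<^sub>R ?d) - f (x + r *\<^sub>R ?e) - f (x + r *\<^sub>R ?d) + f x = ?\<phi> r - ?\<phi> 0"
    by (simp add: add.commute add.left_commute)
  also have "\<dots> = r * (?\<psi> r - ?\<psi> 0)" unfolding s(3) by (simp add: add.commute add.left_commute)
  also have "\<dots> = r * r * pderiv_at j (pderiv_at i f) ((x + s *\<^sub>R ?e) + t *\<^sub>R ?d)"
    unfolding t(3) by simp
  finally show ?thesis using inS[of s t] s(1,2) t(1,2) by (intro bexI) (assumption, simp)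
qed

text \<open>Both orders of differentiation express the same second difference, so the two mixed
  derivatives agree at points \<open>z\<close> and \<open>y\<close> within \<open>2 * r\<close> of
  \<open>x\<close>; continuity at \<open>x\<close> carries this over to \<open>x\<close>.\<close>

lemma pderiv_commute:
  fixes f :: "real^'n \<Rightarrow> real"
  assumes "open S" "smooth_on S f" "x \<in> S"
  shows "pderiv_at i (pderiv_at j f) x = pderiv_at j (pderiv_at i f) x"
proof (rule ccontr)
  let ?a = "pderiv_at i (pderiv_at j f)" and ?b = "pderiv_at j (pderiv_at i f)"
  assume "?a x \<noteq> ?b x"
  then have e: "0 < \<bar>?a x - ?b x\<bar> / 2" (is "0 < ?e") by simp
  have "continuous (at x) ?a" "continuous (at x) ?b"
    using smooth_on_continuous_on[OF smooth_on_pderiv[OF smooth_on_pderiv[OF assms(2)]]] assms(3)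
    by (simp_all only: continuous_on_eq_continuous_at[OF assms(1)])
  moreover have "\<exists>d>0. \<forall>y. dist y x < d \<longrightarrow> dist (h y) (h x) < ?e"
    if "continuous (at x) h" for h :: "real^'n \<Rightarrow> real"
    using that[unfolded continuous_at_eps_delta, THEN spec, THEN mp, OF e] .
  ultimately have "\<exists>d>0. \<forall>y. dist y x < d \<longrightarrow> dist (?a y) (?a x) < ?e"
    "\<exists>d>0. \<forall>y. dist y x < d \<longrightarrow> dist (?b y) (?b x) < ?e"
    by (simp_all only:)
  then obtain d1 d2 where d: "d1 > 0" "d2 > 0" "\<And>y. dist y x < d1 \<Longrightarrow> dist (?a y) (?a x) < ?e"
      "\<And>y. dist y x < d2 \<Longrightarrow> dist (?b y) (?b x) < ?e"
    by blast
  obtain d3 where d3: "d3 > 0" "cball x d3 \<subseteq> S" using assms open_contains_cball by blast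
  define r where "r = min d3 (min (d1 / 2) (d2 / 2)) / 2"
  have r: "r > 0" "2 * r < d1" "2 * r < d2" "2 * r \<le> d3" using d(1,2) d3(1) by (auto simp: r_def)
  then have sub: "cball x (2 * r) \<subseteq> S" using d3(2) subset_cball[of "2 * r" d3 x] by simp
  obtain y where y: "y \<in> cball x (2*r)" "f (x + r *\<^sub>R axis i 1 + r *\<^sub>R axis j 1) - f (x + r *\<^sub>R axis i 1) - f (x + r *\<^sub>R axis j 1) + f x
    = r * r * ?b y" using second_difference_mvt[OF assms(2) r(1) sub] by blast
  obtain z where z: "z \<in> cball x (2*r)" "f (x + r *\<^sub>R axis j 1 + r *\<^sub>R axis i 1) - f (x + r *\<^sub>R axis j 1) - f (x + r *\<^sub>R axis i 1) + f x
    = r * r * ?a z" using second_difference_mvt[OF assms(2) r(1) sub] by blast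
  have "x + r *\<^sub>R axis j 1 + r *\<^sub>R axis i 1 = x + r *\<^sub>R axis i 1 + r *\<^sub>R axis j 1"
    by (simp add: add.commute add.left_commute)
  then have "f (x + r *\<^sub>R axis j 1 + r *\<^sub>R axis i 1) = f (x + r *\<^sub>R axis i 1 + r *\<^sub>R axis j 1)"
    by (simp only:)
  with y(2) z(2) have "r * r * ?a z = r * r * ?b y" by linarith
  then have "?a z = ?b y" using r(1) by simp
  moreover have "dist (?a z) (?a x) < ?e" "dist (?b y) (?b x) < ?e"
    using y(1) z(1) r d(3)[of z] d(4)[of y] by (simp_all add: dist_commute)
  moreover have False if "u = w" "\<bar>u - a\<bar> < \<bar>a - b\<bar> / 2" "\<bar>w - b\<bar> < \<bar>a - b\<bar> / 2" for u w a b :: real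
    using that by (simp add: abs_if split: if_splits)
  ultimately show False unfolding dist_real_def by blast
qed

section \<open>Linear algebra of Lorentzian forms\<close>

definition minkowski :: "'n::finite \<Rightarrow> real^'n^'n" where
  "minkowski k = (\<chi> i j. if i \<noteq> j then 0 else if i = k then -1 else 1)"

text \<open>The columns of \<open>E\<close> form an orthonormal frame whose timelike member is the
  \<open>k\<close>-th.\<close>

definition lorentz_form :: "real^'n^'n \<Rightarrow> bool" where
  "lorentz_form G \<longleftrightarrow> (\<exists>(E :: real^'n^'n) k. transpose E ** G ** E = minkowski k)"

definition outer :: "real^'n \<Rightarrow> real^'n \<Rightarrow> real^'n^'n" where
  "outer u v = (\<chi> i j. u $ i * v $ j)"

lemma matrix_inner_transpose:
  fixes A :: "real^'n^'n"
  shows "(A *v u) \<bullet> v = u \<bullet> (transpose A *v v)"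
  by (metis dot_lmul_matrix inner_commute transpose_matrix_vector)

lemma outer_vector [simp]: "outer u v *v x = (v \<bullet> x) *\<^sub>R u"
  by (simp add: vec_eq_iff outer_def matrix_vector_mult_def inner_vec_def sum_distrib_left mult_ac)

lemma outer_mult_right: "outer u v ** A = outer u (transpose A *v v)"
  by (simp add: vec_eq_iff outer_def matrix_vector_mult_def matrix_matrix_mult_def transpose_def sum_distrib_left mult_ac)

lemma trace_outer: "trace (outer u v) = u \<bullet> v"
  by (simp add: trace_def outer_def inner_vec_def)

text \<open>Cauchy-Schwarz on the diagonal entries. By symmetry \<open>trace (B ** B)\<close> is the
  sum of the squares of all entries, so the off-diagonal ones only help.\<close>

lemma trace_square_symmetric:
  fixes B :: "real^'n^'n"
  assumes "transpose B = B"
  shows "(trace B)\<^sup>2 \<le> of_nat CARD('n) * trace (B ** B)"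
proof -
  have B: "B $ j $ i = B $ i $ j" for i j
    using arg_cong[OF assms, of "\<lambda>M. M $ i $ j"] by (simp add: transpose_def)
  have "(trace B)\<^sup>2 \<le> of_nat CARD('n) * (\<Sum>i\<in>UNIV. (B $ i $ i)\<^sup>2)"
    using sum_squared_le_sum_of_squares[of "\<lambda>i. B $ i $ i" UNIV] by (simp add: trace_def mult.commute)
  also have "(\<Sum>i\<in>UNIV. (B $ i $ i)\<^sup>2) \<le> (\<Sum>i\<in>UNIV. \<Sum>j\<in>UNIV. (B $ i $ j)\<^sup>2)"
    by (rule sum_mono) (rule member_le_sum, auto)
  also have "\<dots> = trace (B ** B)"
    by (simp add: trace_def matrix_matrix_mult_def power2_eq_square B)
  finally show ?thesis by (simp add: mult_left_mono)
qed

lemma axis_inner_nth: "axis k (1::real) \<bullet> v = v $ k" "axis k (1::real) $ k = 1"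
  by (simp add: inner_axis') (simp add: axis_def)

lemma minkowski_vector: "minkowski k *v v = v - (2 * v $ k) *\<^sub>R axis k 1"
proof -
  have "(minkowski k *v v) $ i = v $ i - 2 * v $ k * (if i = k then 1 else 0)" for i
  proof -
    have "(minkowski k *v v) $ i = (\<Sum>j\<in>UNIV. (if i = j then (if i = k then - v $ j else v $ j) else 0))"
      unfolding minkowski_def matrix_vector_mult_def by (simp only: vec_lambda_beta) (rule sum.cong, auto)
    then show ?thesis by simp
  qed
  then show ?thesis by (simp add: vec_eq_iff axis_def)
qed

lemma minkowski_square: "minkowski k *v (minkowski k *v v) = v"
  by (simp add: minkowski_vector vec_eq_iff axis_def)

lemma transpose_minkowski: "transpose (minkowski k) = minkowski k"
  by (auto simp: vec_eq_iff minkowski_def transpose_def)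

text \<open>A degenerate direction \<open>y\<close> reduces \<open>M\<close> to a symmetric map of the Euclidean complement of
  \<open>y\<close> and its time reflection, on which \<open>M\<close> and \<open>M\<^sup>2\<close> have the same traces.\<close>

lemma minkowski_trace_square:
  fixes M :: "real^'n^'n" and k :: 'n
  defines "\<eta> \<equiv> minkowski k"
  assumes My: "M *v y = 0" and yM: "\<And>v. (M *v v) \<bullet> (\<eta> *v y) = 0"
    and sym: "\<And>v w. v \<bullet> (\<eta> *v y) = 0 \<Longrightarrow> w \<bullet> (\<eta> *v y) = 0 \<Longrightarrow>
        (M *v v) \<bullet> (\<eta> *v w) = (M *v w) \<bullet> (\<eta> *v v)"
    and null: "y \<bullet> (\<eta> *v y) = 0" and "y \<noteq> 0"
  shows "(trace M)\<^sup>2 \<le> of_nat CARD('n) * trace (M ** M)"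
proof -
  define z where "z = \<eta> *v y"
  define c where "c = inverse (y \<bullet> y)"
  have yy: "y \<bullet> y \<noteq> 0" "c * (y \<bullet> y) = 1" using \<open>y \<noteq> 0\<close> by (auto simp: c_def)
  have zz: "z \<bullet> z = y \<bullet> y"
    using matrix_inner_transpose[of \<eta> y "\<eta> *v y"]
    by (simp add: z_def \<eta>_def transpose_minkowski minkowski_square)
  have yz: "y \<bullet> z = 0" "z \<bullet> y = 0" using null by (simp_all add: z_def inner_commute)
  have z: "z = y - (2 * y $ k) *\<^sub>R axis k 1" by (simp add: z_def \<eta>_def minkowski_vector)
  have yk: "y \<bullet> y = 2 * (y $ k)\<^sup>2"
    using yz(1) unfolding z by (simp add: inner_diff_right inner_axis power2_eq_square)
  \<comment> \<open>Since \<open>y\<close> is null, \<open>y\<close> and its time reflection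
    \<open>z\<close> are orthogonal and of equal length in the Euclidean sense. \<open>P\<close> is
    the Euclidean orthogonal projection that annihilates both.\<close>
  define P where "P = mat 1 - c *\<^sub>R outer y y - c *\<^sub>R outer z z"
  have Pv: "P *v v = v - (c * (y \<bullet> v)) *\<^sub>R y - (c * (z \<bullet> v)) *\<^sub>R z" for v
    by (simp add: P_def matrix_vector_mult_diff_rdistrib scaleR_matrix_vector_assoc[symmetric])
  have tP: "transpose P = P"
    by (simp add: P_def vec_eq_iff transpose_def mat_def outer_def mult_ac)
  have Py: "P *v y = 0" and Pz: "P *v z = 0"
    using yy by (simp_all add: Pv yz zz)
  have PP: "P *v (P *v v) = P *v v" for v
    unfolding Pv[of v] by (simp add: matrix_vector_mult_diff_distrib matrix_vector_mult_scaleR Py Pz) (simp add: Pv)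
  then have PPm: "P ** P = P"
    by (simp add: matrix_eq matrix_vector_mul_assoc[symmetric])
  \<comment> \<open>As \<open>z = y - 2 y_k e_k\<close> with \<open>y_k\<close> nonzero, the time
    axis lies in the span of \<open>y\<close> and \<open>z\<close>. The image of \<open>P\<close> is
    therefore spatial, and there \<eta> acts as the identity.\<close>
  have Pk: "(P *v v) $ k = 0" for v
  proof -
    have zv: "z \<bullet> v = y \<bullet> v - 2 * y $ k * v $ k" and zk: "z $ k = - y $ k"
      unfolding z by (simp_all add: inner_diff_left axis_inner_nth)
    have "(P *v v) $ k = v $ k - c * (y \<bullet> y) * v $ k"
      unfolding yk by (simp add: Pv zv zk power2_eq_square algebra_simps)
    then show ?thesis using yy(2) by simp
  qed
  then have etaP: "\<eta> *v (P *v v) = P *v v" for v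
    by (simp add: \<eta>_def minkowski_vector)
  have Pperp: "(P *v v) \<bullet> z = 0" for v
    using matrix_inner_transpose[of P v z] by (simp add: tP Pz)
  define B where "B = P ** M ** P"
  have Bs: "(B *v u) \<bullet> v = u \<bullet> (B *v v)" for u v
  proof -
    have "(B *v u) \<bullet> v = (M *v (P *v u)) \<bullet> (\<eta> *v (P *v v))"
      by (simp add: B_def matrix_vector_mul_assoc[symmetric] matrix_inner_transpose[of P] tP etaP)
    also have "\<dots> = (M *v (P *v v)) \<bullet> (\<eta> *v (P *v u))"
      using Pperp by (intro sym) (simp_all add: z_def)
    also have "\<dots> = u \<bullet> (B *v v)"
      by (simp add: B_def matrix_vector_mul_assoc[symmetric] matrix_inner_transpose[of P, symmetric]
          tP etaP inner_commute[of u] matrix_inner_transpose[of P _ u])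
    finally show ?thesis .
  qed
  have tB: "transpose B = B"
  proof -
    have "u \<bullet> (transpose B *v v) = u \<bullet> (B *v v)" for u v
      using Bs[of u v] by (simp add: matrix_inner_transpose)
    then have "transpose B *v v = B *v v" for v
      by (meson vector_eq_ldot)
    then show ?thesis by (simp add: matrix_eq)
  qed
  have zM: "z \<bullet> (M *v v) = 0" for v
    using yM[of v] by (simp only: z_def inner_commute)
  have tM: "(transpose M *v u) \<bullet> v = u \<bullet> (M *v v)" for u v
    using matrix_inner_transpose[of M v u] by (simp only: inner_commute)
  \<comment> \<open>\<open>K\<close> is the part of \<open>M\<close> that \<open>P\<close> removes:
    values of \<open>M\<close> are orthogonal to \<open>z\<close>, so only their \<open>y\<close>
    component is lost. Both \<open>K\<close> and \<open>K ** M\<close> are trace free because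
    \<open>M *v y = 0\<close>.\<close>
  define K where "K = outer y (c *\<^sub>R (transpose M *v y))"
  have Kv: "K *v v = (c * (y \<bullet> (M *v v))) *\<^sub>R y" for v
    by (simp only: K_def outer_vector inner_scaleR_left tM)
  have PMv: "(P ** M) *v v = M *v v - K *v v" for v
    by (simp only: matrix_vector_mul_assoc[symmetric] Pv Kv zM) simp
  then have PM: "P ** M = M - K"
    by (simp only: matrix_eq matrix_vector_mult_diff_rdistrib) blast
  have trK: "trace K = 0"
    using tM[of y y] by (simp add: K_def trace_outer inner_commute My)
  have trKM: "trace (K ** M) = 0"
    unfolding K_def outer_mult_right trace_outer inner_commute[of y] tM inner_scaleR_left My
    by (simp add: tM My)
  have "trace B = trace (P ** (P ** M))"
    unfolding B_def by (rule trace_mul_sym)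
  also have "\<dots> = trace (P ** M)" by (simp add: matrix_mul_assoc PPm)
  also have "\<dots> = trace M" by (simp add: PM trace_sub trK)
  finally have 1: "trace B = trace M" .
  have "trace (B ** B) = trace ((P ** M ** P) ** (P ** M ** P))" by (simp add: B_def)
  also have "\<dots> = trace (P ** ((P ** M ** P) ** (P ** M)))"
    using trace_mul_sym[of "(P ** M ** P) ** (P ** M)" P] by (simp add: matrix_mul_assoc)
  also have "\<dots> = trace ((P ** M) ** (P ** M))"
    by (simp add: matrix_mul_assoc PPm)
       (simp add: matrix_mul_assoc[symmetric] PPm)
  also have "\<dots> = trace (M ** M)"
  proof -
    have "((P ** M) ** (P ** M)) *v v = (M ** M - K ** M) *v v" for v
      by (simp only: matrix_vector_mul_assoc[symmetric, of "P ** M"] PMv)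
         (simp add: matrix_vector_mult_diff_rdistrib matrix_vector_mult_diff_distrib
            matrix_vector_mul_assoc[symmetric] Kv matrix_vector_mult_scaleR My)
    then have "(P ** M) ** (P ** M) = M ** M - K ** M" by (simp only: matrix_eq) blast
    then show ?thesis by (simp add: trace_sub trKM)
  qed
  finally have 2: "trace (B ** B) = trace (M ** M)" .
  show ?thesis using trace_square_symmetric[OF tB] by (simp add: 1 2)
qed

lemma lorentz_formE:
  fixes G :: "real^'n^'n"
  assumes "lorentz_form G"
  obtains E F :: "real^'n^'n" and k where "transpose E ** G ** E = minkowski k" "E ** F = mat 1" "F ** E = mat 1" "invertible G"
proof -
  obtain E :: "real^'n^'n" and k where E: "transpose E ** G ** E = minkowski k" using assms by (auto simp: lorentz_form_def)
  have "minkowski k ** minkowski k = mat 1"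
    by (simp add: matrix_eq matrix_vector_mul_assoc[symmetric] minkowski_square)
  then have "invertible (minkowski k)" unfolding invertible_def by blast
  then have "det (transpose E ** G ** E) \<noteq> 0" by (simp add: E invertible_det_nz)
  then have "det E \<noteq> 0" "det G \<noteq> 0" by (auto simp: det_mul)
  then have "invertible E" "invertible G" by (auto simp: invertible_det_nz)
  then show ?thesis using that E matrix_inv_inverse[of E] by blast
qed

text \<open>Conjugation by an orthonormal frame turns \<open>G\<close> into
  \<open>minkowski k\<close> and preserves both traces. The hypotheses are what a shape operator
  satisfies for a geodesic null normal \<open>x\<close>: it kills \<open>x\<close>, takes values
  orthogonal to \<open>x\<close>, and is symmetric on the vectors orthogonal to
  \<open>x\<close>.\<close>

lemma lorentz_trace_square:
  fixes A G :: "real^'n^'n"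
  assumes "lorentz_form G"
    and Ax: "A *v x = 0" and xA: "\<And>v. (A *v v) \<bullet> (G *v x) = 0"
    and sym: "\<And>v w. v \<bullet> (G *v x) = 0 \<Longrightarrow> w \<bullet> (G *v x) = 0 \<Longrightarrow>
        (A *v v) \<bullet> (G *v w) = (A *v w) \<bullet> (G *v v)"
    and null: "x \<bullet> (G *v x) = 0" and "x \<noteq> 0"
  shows "(trace A)\<^sup>2 \<le> of_nat CARD('n) * trace (A ** A)"
proof -
  obtain E F :: "real^'n^'n" and k where E: "transpose E ** G ** E = minkowski k" "E ** F = mat 1" "F ** E = mat 1"
    using lorentz_formE[OF assms(1)] by metis
  have EF: "E *v (F *v v) = v" for v by (simp add: matrix_vector_mul_assoc E)
  have ip: "v \<bullet> (minkowski k *v w) = (E *v v) \<bullet> (G *v (E *v w))" for v w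
    by (simp add: E(1)[symmetric] matrix_vector_mul_assoc[symmetric] matrix_inner_transpose[of E])
  define M where "M = F ** A ** E"
  define y where "y = F *v x"
  have EM: "E *v (M *v v) = A *v (E *v v)" for v
    by (simp add: M_def matrix_vector_mul_assoc[symmetric] EF)
  have Ey: "E *v y = x" by (simp add: y_def EF)
  have "(trace M)\<^sup>2 \<le> of_nat CARD('n) * trace (M ** M)"
  proof (rule minkowski_trace_square[of M y k])
    show "M *v y = 0" by (simp add: M_def matrix_vector_mul_assoc[symmetric] Ey Ax)
    show "y \<noteq> 0" using Ey \<open>x \<noteq> 0\<close> by auto
  qed (simp_all add: ip EM Ey xA null sym)
  moreover have "trace M = trace A"
    by (simp add: M_def trace_mul_sym[of _ E] matrix_mul_assoc E)
  moreover have "trace (M ** M) = trace (A ** A)"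
  proof -
    have "M ** M = F ** A ** (E ** F) ** A ** E" by (simp add: M_def matrix_mul_assoc)
    also have "\<dots> = F ** (A ** A) ** E" by (simp add: E matrix_mul_assoc)
    finally show ?thesis by (simp add: trace_mul_sym[of _ E] matrix_mul_assoc E)
  qed
  ultimately show ?thesis by simp
qed

text \<open>In a frame let \<open>p\<close> and \<open>q\<close> be the spatial parts.
  Cauchy-Schwarz for them contradicts \<open>q \<bullet> q < (b $ k)\<^sup>2\<close> unless the time
  component of \<open>u\<close> vanishes, and a null vector without time component is zero.\<close>

lemma lorentz_timelike_null_orthogonal:
  fixes G :: "real^'n^'n"
  assumes "lorentz_form G" "u \<bullet> (G *v u) = 0" "z \<bullet> (G *v z) < 0" "u \<bullet> (G *v z) = 0"
  shows "u = 0"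
proof -
  obtain E F :: "real^'n^'n" and k where E: "transpose E ** G ** E = minkowski k" "E ** F = mat 1"
    using lorentz_formE[OF assms(1)] by metis
  have EF: "E *v (F *v v) = v" for v by (simp add: matrix_vector_mul_assoc E)
  have ip: "v \<bullet> (minkowski k *v w) = (E *v v) \<bullet> (G *v (E *v w))" for v w
    by (simp add: E(1)[symmetric] matrix_vector_mul_assoc[symmetric] matrix_inner_transpose[of E])
  define a b where "a = F *v u" and "b = F *v z"
  have m: "a \<bullet> (minkowski k *v a) = 0" "b \<bullet> (minkowski k *v b) < 0" "a \<bullet> (minkowski k *v b) = 0"
    using assms by (simp_all add: ip EF a_def b_def)
  define p q where "p = a - a $ k *\<^sub>R axis k 1" and "q = b - b $ k *\<^sub>R axis k 1"
  have pq: "p \<bullet> p = (a $ k)\<^sup>2" "q \<bullet> q < (b $ k)\<^sup>2" "p \<bullet> q = a $ k * b $ k"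
    using m by (simp_all add: p_def q_def minkowski_vector inner_diff_left inner_diff_right inner_axis
        axis_inner_nth power2_eq_square algebra_simps)
  have "(p \<bullet> q)\<^sup>2 \<le> (p \<bullet> p) * (q \<bullet> q)" by (rule Cauchy_Schwarz_ineq)
  then have "(a $ k)\<^sup>2 * (b $ k)\<^sup>2 \<le> (a $ k)\<^sup>2 * (q \<bullet> q)" by (simp add: pq power_mult_distrib)
  then have ak: "a $ k = 0" using pq(2) by (cases "a $ k = 0") auto
  then have "p = 0" using pq(1) by simp
  then have "a = 0" using ak by (simp add: p_def)
  then show ?thesis using EF[of u] by (simp add: a_def)
qed

section \<open>Metrics in a coordinate domain\<close>

text \<open>The formulas of \<open>christoffel\<close> and \<open>ricci_coeff\<close> for an
  arbitrary matrix field, so that the tensor calculus can be done on an open set of coordinates.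
  \<open>christoffel_eq\<close> and \<open>ricci_coeff_eq\<close> provide the link to the
  manifold.\<close>

definition chr :: "(real^'n \<Rightarrow> real^'n^'n) \<Rightarrow> 'n \<Rightarrow> 'n \<Rightarrow> 'n \<Rightarrow> real^'n \<Rightarrow> real" where
  "chr G i j k x = (1/2) * (\<Sum>l\<in>UNIV. matrix_inv (G x) $ i $ l *
     (pderiv_at j (\<lambda>y. G y $ l $ k) x + pderiv_at k (\<lambda>y. G y $ l $ j) x
      - pderiv_at l (\<lambda>y. G y $ j $ k) x))"

definition chr_ricci :: "(real^'n \<Rightarrow> real^'n^'n) \<Rightarrow> 'n \<Rightarrow> 'n \<Rightarrow> real^'n \<Rightarrow> real" where
  "chr_ricci G j l x = (\<Sum>i\<in>UNIV. pderiv_at i (chr G i l j) x - pderiv_at l (chr G i i j) x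
     + (\<Sum>m\<in>UNIV. chr G i i m x * chr G m l j x - chr G i l m x * chr G m i j x))"

text \<open>\<open>cov G X i\<close> is the covariant derivative of \<open>X\<close> along \<open>\<partial>\<^sub>i\<close>, and \<open>acc G X\<close> that of \<open>X\<close> along \<open>X\<close>.\<close>

definition cov :: "(real^'n \<Rightarrow> real^'n^'n) \<Rightarrow> (real^'n \<Rightarrow> real^'n) \<Rightarrow> 'n \<Rightarrow> real^'n \<Rightarrow> real^'n" where
  "cov G X i x = (\<chi> j. pderiv_at i (\<lambda>y. X y $ j) x + (\<Sum>k\<in>UNIV. chr G j i k x * X x $ k))"

definition divg :: "(real^'n \<Rightarrow> real^'n^'n) \<Rightarrow> (real^'n \<Rightarrow> real^'n) \<Rightarrow> real^'n \<Rightarrow> real" where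
  "divg G X x = (\<Sum>i\<in>UNIV. cov G X i x $ i)"

definition acc :: "(real^'n \<Rightarrow> real^'n^'n) \<Rightarrow> (real^'n \<Rightarrow> real^'n) \<Rightarrow> real^'n \<Rightarrow> real^'n" where
  "acc G X x = (\<Sum>i\<in>UNIV. X x $ i *\<^sub>R cov G X i x)"

lemma sum_rotate3:
  "(\<Sum>a\<in>A. \<Sum>b\<in>B. \<Sum>c\<in>C. F a b c) = (\<Sum>b\<in>B. \<Sum>c\<in>C. \<Sum>a\<in>A. (F a b c :: real))"
  by (subst sum.swap) (intro sum.cong refl sum.swap)

lemma sum_swap_pairs:
  "(\<Sum>a\<in>A. \<Sum>b\<in>B. \<Sum>c\<in>C. \<Sum>d\<in>D. F a b c d) = (\<Sum>c\<in>C. \<Sum>d\<in>D. \<Sum>a\<in>A. \<Sum>b\<in>B. (F a b c d :: real))"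
proof -
  have "(\<Sum>a\<in>A. \<Sum>b\<in>B. \<Sum>c\<in>C. \<Sum>d\<in>D. F a b c d) = (\<Sum>a\<in>A. \<Sum>c\<in>C. \<Sum>d\<in>D. \<Sum>b\<in>B. F a b c d)"
    by (intro sum.cong refl sum_rotate3)
  also have "\<dots> = (\<Sum>c\<in>C. \<Sum>d\<in>D. \<Sum>a\<in>A. \<Sum>b\<in>B. F a b c d)" by (rule sum_rotate3)
  finally show ?thesis .
qed

text \<open>Once the second derivatives of \<open>X\<close> have cancelled by symmetry, Bochner's formula is an
  algebraic identity at a single point.\<close>

lemma bochner_algebra:
  fixes X :: "'n::finite \<Rightarrow> real" and dX :: "'n \<Rightarrow> 'n \<Rightarrow> real" and ddX :: "'n \<Rightarrow> 'n \<Rightarrow> 'n \<Rightarrow> real"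
    and C :: "'n \<Rightarrow> 'n \<Rightarrow> 'n \<Rightarrow> real" and dC :: "'n \<Rightarrow> 'n \<Rightarrow> 'n \<Rightarrow> 'n \<Rightarrow> real"
  assumes ddX: "\<And>i j k. ddX i j k = ddX j i k" and C: "\<And>i j k. C i j k = C i k j"
  shows "(\<Sum>k\<in>UNIV. X k * (\<Sum>i\<in>UNIV. ddX k i i + (\<Sum>j\<in>UNIV. dC k i i j * X j + C i i j * dX k j))) =
    (\<Sum>i\<in>UNIV. (\<Sum>k\<in>UNIV. dX i k * (dX k i + (\<Sum>j\<in>UNIV. C i k j * X j))
         + X k * (ddX i k i + (\<Sum>j\<in>UNIV. dC i i k j * X j + C i k j * dX i j)))
       + (\<Sum>m\<in>UNIV. C i i m * (\<Sum>k\<in>UNIV. X k * (dX k m + (\<Sum>j\<in>UNIV. C m k j * X j)))))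
    - (\<Sum>i\<in>UNIV. \<Sum>k\<in>UNIV. (dX i k + (\<Sum>j\<in>UNIV. C k i j * X j)) * (dX k i + (\<Sum>l\<in>UNIV. C i k l * X l)))
    - (\<Sum>j\<in>UNIV. \<Sum>l\<in>UNIV. (\<Sum>i\<in>UNIV. dC i i l j - dC l i i j
         + (\<Sum>m\<in>UNIV. C i i m * C m l j - C i l m * C m i j)) * X j * X l)"
proof -
  \<comment> \<open>These are the monomials of both sides up to renaming of summation indices. In
    \<open>D - T - R\<close> the sums \<open>s4\<close>, \<open>s6\<close>, \<open>s7\<close>,
    \<open>s9\<close> and \<open>s10\<close> cancel, leaving \<open>s1 + s2 + s3\<close>.\<close>
  define s1 where "s1 = (\<Sum>k\<in>UNIV. \<Sum>i\<in>UNIV. X k * ddX k i i)"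
  define s2 where "s2 = (\<Sum>k\<in>UNIV. \<Sum>i\<in>UNIV. \<Sum>j\<in>UNIV. X k * (dC k i i j * X j))"
  define s3 where "s3 = (\<Sum>k\<in>UNIV. \<Sum>i\<in>UNIV. \<Sum>j\<in>UNIV. X k * (C i i j * dX k j))"
  define s4 where "s4 = (\<Sum>i\<in>UNIV. \<Sum>k\<in>UNIV. dX i k * dX k i)"
  define s6 where "s6 = (\<Sum>i\<in>UNIV. \<Sum>k\<in>UNIV. \<Sum>j\<in>UNIV. X k * (dC i i k j * X j))"
  define s7 where "s7 = (\<Sum>i\<in>UNIV. \<Sum>k\<in>UNIV. \<Sum>j\<in>UNIV. dX i k * (C i k j * X j))"
  define s9 where "s9 = (\<Sum>i\<in>UNIV. \<Sum>m\<in>UNIV. \<Sum>k\<in>UNIV. \<Sum>j\<in>UNIV. C i i m * (X k * (C m k j * X j)))"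
  define s10 where "s10 = (\<Sum>i\<in>UNIV. \<Sum>k\<in>UNIV. (\<Sum>j\<in>UNIV. C k i j * X j) * (\<Sum>l\<in>UNIV. C i k l * X l))"
  have L: "(\<Sum>k\<in>UNIV. X k * (\<Sum>i\<in>UNIV. ddX k i i + (\<Sum>j\<in>UNIV. dC k i i j * X j + C i i j * dX k j)))
     = s1 + s2 + s3"
    by (simp add: s1_def s2_def s3_def sum_distrib_left distrib_left sum.distrib)
  have s5: "(\<Sum>i\<in>UNIV. \<Sum>k\<in>UNIV. X k * ddX i k i) = s1"
    unfolding s1_def by (subst sum.swap) (simp add: ddX[of _ _])
  have s7': "(\<Sum>i\<in>UNIV. \<Sum>k\<in>UNIV. \<Sum>j\<in>UNIV. X k * (C i k j * dX i j)) = s7"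
    unfolding s7_def by (rule sum.cong[OF refl], subst sum.swap) (simp add: C mult_ac)
  have s8: "(\<Sum>i\<in>UNIV. \<Sum>m\<in>UNIV. \<Sum>k\<in>UNIV. C i i m * (X k * dX k m)) = s3"
    unfolding s3_def by (subst (2) sum_rotate3) (simp only: mult_ac)
  have D: "(\<Sum>i\<in>UNIV. (\<Sum>k\<in>UNIV. dX i k * (dX k i + (\<Sum>j\<in>UNIV. C i k j * X j))
         + X k * (ddX i k i + (\<Sum>j\<in>UNIV. dC i i k j * X j + C i k j * dX i j)))
       + (\<Sum>m\<in>UNIV. C i i m * (\<Sum>k\<in>UNIV. X k * (dX k m + (\<Sum>j\<in>UNIV. C m k j * X j)))))
     = s4 + s7 + s1 + s6 + s7 + s3 + s9"
    unfolding s5[symmetric] s8[symmetric]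
    by (simp add: s4_def s6_def s9_def sum_distrib_left distrib_left sum.distrib s7')
       (simp add: s7_def)
  have t7: "(\<Sum>i\<in>UNIV. \<Sum>k\<in>UNIV. (\<Sum>j\<in>UNIV. C k i j * X j) * dX k i) = s7"
    unfolding s7_def by (subst sum.swap) (simp add: sum_distrib_left sum_distrib_right mult_ac)
  have T: "(\<Sum>i\<in>UNIV. \<Sum>k\<in>UNIV. (dX i k + (\<Sum>j\<in>UNIV. C k i j * X j)) * (dX k i + (\<Sum>l\<in>UNIV. C i k l * X l)))
     = s4 + s7 + s7 + s10"
  proof -
    have "(\<Sum>i\<in>UNIV. \<Sum>k\<in>UNIV. dX i k * (\<Sum>l\<in>UNIV. C i k l * X l)) = s7"
      by (simp add: s7_def sum_distrib_left)
    then show ?thesis by (simp add: distrib_left distrib_right sum.distrib t7 s4_def s10_def)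
  qed
  have r2: "(\<Sum>j\<in>UNIV. \<Sum>l\<in>UNIV. \<Sum>i\<in>UNIV. dC l i i j * X j * X l) = s2"
    unfolding s2_def by (subst sum_rotate3) (simp only: mult_ac)
  have r6: "(\<Sum>j\<in>UNIV. \<Sum>l\<in>UNIV. \<Sum>i\<in>UNIV. dC i i l j * X j * X l) = s6"
    unfolding s6_def by (subst (2) sum_rotate3, subst sum.swap) (simp only: mult_ac)
  have r9: "(\<Sum>j\<in>UNIV. \<Sum>l\<in>UNIV. \<Sum>i\<in>UNIV. \<Sum>m\<in>UNIV. C i i m * C m l j * X j * X l) = s9"
    unfolding s9_def by (subst (2) sum_swap_pairs, subst sum.swap) (simp only: mult_ac)
  have r10: "(\<Sum>j\<in>UNIV. \<Sum>l\<in>UNIV. \<Sum>i\<in>UNIV. \<Sum>m\<in>UNIV. C i l m * C m i j * X j * X l) = s10"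
  proof -
    have "s10 = (\<Sum>i\<in>UNIV. \<Sum>m\<in>UNIV. \<Sum>j\<in>UNIV. \<Sum>l\<in>UNIV. C m i j * X j * (C i l m * X l))"
      unfolding s10_def sum_product by (intro sum.cong refl arg_cong2[of _ _ _ _ "(*)"] C)
    then show ?thesis by (subst sum_swap_pairs) (simp only: mult_ac)
  qed
  have R: "(\<Sum>j\<in>UNIV. \<Sum>l\<in>UNIV. (\<Sum>i\<in>UNIV. dC i i l j - dC l i i j
         + (\<Sum>m\<in>UNIV. C i i m * C m l j - C i l m * C m i j)) * X j * X l) = s6 - s2 + s9 - s10"
    unfolding r2[symmetric] r6[symmetric] r9[symmetric] r10[symmetric]
    by (simp add: sum_distrib_right left_diff_distrib distrib_right sum.distrib sum_subtractf)
  show ?thesis unfolding L D T R by simp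
qed

lemma pderiv_bilinear:
  assumes "\<And>i. (\<lambda>y. X y $ i) differentiable (at x)" "\<And>i. (\<lambda>y. Y y $ i) differentiable (at x)"
    and "\<And>i j. (\<lambda>y. (G y :: real^'n^'m) $ i $ j) differentiable (at x)"
  shows "pderiv_at i (\<lambda>y. X y \<bullet> (G y *v Y y)) x =
    (\<chi> j. pderiv_at i (\<lambda>y. X y $ j) x) \<bullet> (G x *v Y x)
    + X x \<bullet> ((\<chi> j k. pderiv_at i (\<lambda>y. G y $ j $ k) x) *v Y x)
    + X x \<bullet> (G x *v (\<chi> j. pderiv_at i (\<lambda>y. Y y $ j) x))"
proof -
  have "(\<lambda>y. X y \<bullet> (G y *v Y y)) = (\<lambda>y. \<Sum>j\<in>UNIV. \<Sum>k\<in>UNIV. X y $ j * (G y $ j $ k * Y y $ k))"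
    by (simp add: inner_vec_def matrix_vector_mult_def sum_distrib_left)
  moreover have "pderiv_at i (\<lambda>y. \<Sum>j\<in>UNIV. \<Sum>k\<in>UNIV. X y $ j * (G y $ j $ k * Y y $ k)) x
      = (\<Sum>j\<in>UNIV. \<Sum>k\<in>UNIV. pderiv_at i (\<lambda>y. X y $ j) x * (G x $ j $ k * Y x $ k)
           + X x $ j * (pderiv_at i (\<lambda>y. G y $ j $ k) x * Y x $ k + G x $ j $ k * pderiv_at i (\<lambda>y. Y y $ k) x))"
    by (simp add: pderiv_sum pderiv_mult assms differentiable_mult)
  ultimately show ?thesis
    by (simp add: inner_vec_def matrix_vector_mult_def sum_distrib_left distrib_left sum.distrib)
qed

lemma pderiv_matrix_vector:
  assumes "\<And>i. (\<lambda>y. Y y $ i) differentiable (at x)"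
    and "\<And>i j. (\<lambda>y. (G y :: real^'n^'m) $ i $ j) differentiable (at x)"
  shows "pderiv_at i (\<lambda>y. (G y *v Y y) $ l) x =
    ((\<chi> j k. pderiv_at i (\<lambda>y. G y $ j $ k) x) *v Y x) $ l + (G x *v (\<chi> j. pderiv_at i (\<lambda>y. Y y $ j) x)) $ l"
proof -
  have "pderiv_at i (\<lambda>y. \<Sum>k\<in>UNIV. G y $ l $ k * Y y $ k) x
      = (\<Sum>k\<in>UNIV. pderiv_at i (\<lambda>y. G y $ l $ k) x * Y x $ k + G x $ l $ k * pderiv_at i (\<lambda>y. Y y $ k) x)"
    by (simp add: pderiv_sum pderiv_mult assms differentiable_mult)
  then show ?thesis by (simp add: matrix_vector_mult_def sum.distrib)
qed

locale metric_chart =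
  fixes W :: "(real^'n) set" and G :: "real^'n \<Rightarrow> real^'n^'n"
  assumes open_W: "open W"
    and smooth_G: "\<And>i j. smooth_on W (\<lambda>x. G x $ i $ j)"
    and sym_G: "\<And>x. x \<in> W \<Longrightarrow> transpose (G x) = G x"
    and lorentz_G: "\<And>x. x \<in> W \<Longrightarrow> lorentz_form (G x)"
begin

lemma G_sym: "x \<in> W \<Longrightarrow> G x $ i $ j = G x $ j $ i"
  using arg_cong[OF sym_G, of x "\<lambda>M. M $ i $ j"] by (simp add: transpose_def)

lemma inner_G_commute: "x \<in> W \<Longrightarrow> u \<bullet> (G x *v v) = v \<bullet> (G x *v u)"
  using matrix_inner_transpose[of "G x" u v] by (simp only: sym_G inner_commute)

lemma dG_sym: "x \<in> W \<Longrightarrow> pderiv_at l (\<lambda>y. G y $ i $ j) x = pderiv_at l (\<lambda>y. G y $ j $ i) x"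
  by (rule pderiv_cong[OF open_W]) (auto intro: G_sym smooth_on_differentiable[OF smooth_G])

lemma invertible_G: "x \<in> W \<Longrightarrow> invertible (G x)"
  by (rule lorentz_formE[OF lorentz_G])

lemma inv_G: "x \<in> W \<Longrightarrow> G x ** matrix_inv (G x) = mat 1" "x \<in> W \<Longrightarrow> matrix_inv (G x) ** G x = mat 1"
  by (simp_all only: matrix_inv_inverse invertible_G)

lemma smooth_inv_G: "smooth_on W (\<lambda>x. matrix_inv (G x) $ i $ j)"
  by (rule smooth_on_matrix_inv[OF open_W smooth_G invertible_G])

lemma inv_G_sym: "x \<in> W \<Longrightarrow> transpose (matrix_inv (G x)) = matrix_inv (G x)"
proof -
  assume x: "x \<in> W"
  have "transpose (matrix_inv (G x)) ** G x = mat 1"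
    using arg_cong[OF inv_G(1)[OF x], of transpose] by (simp only: matrix_transpose_mul sym_G[OF x] transpose_mat)
  then have "transpose (matrix_inv (G x)) ** G x ** matrix_inv (G x) = matrix_inv (G x)" by simp
  then show ?thesis by (simp only: matrix_mul_assoc[symmetric] inv_G(1)[OF x] matrix_mul_rid)
qed

lemma smooth_chr: "smooth_on W (chr G i j k)"
  unfolding chr_def[abs_def]
  by (intro smooth_on_mult smooth_on_sum smooth_on_const smooth_on_add smooth_on_diff smooth_inv_G
      smooth_on_pderiv[of W "\<lambda>y. G y $ _ $ _"] smooth_G open_W)

lemma chr_sym: "x \<in> W \<Longrightarrow> chr G i j k x = chr G i k j x"
  by (simp add: chr_def dG_sym[of x _ j k] add.commute)

lemma lower_chr:
  assumes "x \<in> W"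
  shows "(\<Sum>i\<in>UNIV. G x $ m $ i * chr G i j k x) = (1/2) *
    (pderiv_at j (\<lambda>y. G y $ m $ k) x + pderiv_at k (\<lambda>y. G y $ m $ j) x - pderiv_at m (\<lambda>y. G y $ j $ k) x)"
proof -
  let ?D = "\<lambda>l. pderiv_at j (\<lambda>y. G y $ l $ k) x + pderiv_at k (\<lambda>y. G y $ l $ j) x - pderiv_at l (\<lambda>y. G y $ j $ k) x"
  have "(\<Sum>i\<in>UNIV. G x $ m $ i * matrix_inv (G x) $ i $ l) = (if m = l then 1 else 0)" for l
    using arg_cong[OF inv_G(1)[OF assms], of "\<lambda>M. M $ m $ l"]
    by (simp add: matrix_matrix_mult_def mat_def)
  then have "(\<Sum>l\<in>UNIV. (\<Sum>i\<in>UNIV. G x $ m $ i * matrix_inv (G x) $ i $ l) * ?D l) = ?D m"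
    by (simp add: if_distrib[of "\<lambda>t. t * _"] cong: if_cong)
  moreover have "(\<Sum>i\<in>UNIV. G x $ m $ i * chr G i j k x)
      = (1/2) * (\<Sum>i\<in>UNIV. \<Sum>l\<in>UNIV. G x $ m $ i * matrix_inv (G x) $ i $ l * ?D l)"
    unfolding chr_def by (simp only: sum_distrib_left mult_ac)
  moreover have "(\<Sum>i\<in>UNIV. \<Sum>l\<in>UNIV. G x $ m $ i * matrix_inv (G x) $ i $ l * ?D l)
      = (\<Sum>l\<in>UNIV. (\<Sum>i\<in>UNIV. G x $ m $ i * matrix_inv (G x) $ i $ l) * ?D l)"
    by (subst sum.swap) (simp only: sum_distrib_right)
  ultimately show ?thesis by simp
qed

abbreviation "chrm i x \<equiv> (\<chi> m k. chr G m i k x)"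

lemma cov_chrm: "cov G X i x = (\<chi> j. pderiv_at i (\<lambda>y. X y $ j) x) + chrm i x *v X x"
  by (simp add: cov_def vec_eq_iff matrix_vector_mult_def)

lemma lower_chrm:
  assumes "x \<in> W"
  shows "(G x ** chrm j x) $ m $ k = (1/2) *
    (pderiv_at j (\<lambda>y. G y $ m $ k) x + pderiv_at k (\<lambda>y. G y $ m $ j) x - pderiv_at m (\<lambda>y. G y $ j $ k) x)"
  using lower_chr[OF assms] by (simp add: matrix_matrix_mult_def)

text \<open>This is \<nabla>\<open>g = 0\<close>. In the lowered symbol the last two terms are
  antisymmetric in the two indices that the transpose exchanges, so only the derivative along
  \<open>i\<close> survives.\<close>

lemma metric_compatible:
  assumes "x \<in> W"
  shows "(\<chi> j k. pderiv_at i (\<lambda>y. G y $ j $ k) x) = G x ** chrm i x + transpose (G x ** chrm i x)"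
  using dG_sym[OF assms]
  by (simp add: vec_eq_iff transpose_def lower_chrm[OF assms] field_simps)

lemma pderiv_inner:
  assumes x: "x \<in> W" and "smooth_on W X" "smooth_on W Y"
  shows "pderiv_at i (\<lambda>y. X y \<bullet> (G y *v Y y)) x = cov G X i x \<bullet> (G x *v Y x) + X x \<bullet> (G x *v cov G Y i x)"
proof -
  let ?C = "chrm i x"
  have "X x \<bullet> ((G x ** ?C + transpose (G x ** ?C)) *v Y x) = X x \<bullet> (G x *v (?C *v Y x)) + (?C *v X x) \<bullet> (G x *v Y x)"
    by (simp only: matrix_vector_mult_add_rdistrib inner_add_right matrix_inner_transpose[symmetric]
        matrix_vector_mul_assoc[symmetric])
       (simp only: matrix_inner_transpose[of "G x"] sym_G[OF x])
  then show ?thesis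
    by (subst pderiv_bilinear)
       (auto intro!: smooth_on_differentiable[OF _ x] smooth_G smooth_on_nth[OF open_W] assms
         simp: metric_compatible[OF x] cov_chrm inner_add_left inner_add_right matrix_vector_right_distrib)
qed

text \<open>Both sides are minus the lowered Christoffel symbol contracted with \<open>X\<close> in
  its upper index, and that symbol is symmetric in \<open>i\<close> and \<open>l\<close>. Hence the
  antisymmetric part of the covariant derivative of \<open>X\<close> is the exterior derivative of
  the covector \<open>G X\<close>.\<close>

lemma torsion_free:
  assumes x: "x \<in> W" and "smooth_on W X"
  shows "(G x *v cov G X i x) $ l - pderiv_at i (\<lambda>y. (G y *v X y) $ l) x
       = (G x *v cov G X l x) $ i - pderiv_at l (\<lambda>y. (G y *v X y) $ i) x"
proof -
  have *: "(G x *v cov G X i x) $ l - pderiv_at i (\<lambda>y. (G y *v X y) $ l) x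
      = (\<Sum>k\<in>UNIV. (1/2) * (pderiv_at k (\<lambda>y. G y $ l $ i) x - pderiv_at l (\<lambda>y. G y $ i $ k) x
            - pderiv_at i (\<lambda>y. G y $ l $ k) x) * X x $ k)" for i l
  proof -
    have "(G x *v cov G X i x) $ l - pderiv_at i (\<lambda>y. (G y *v X y) $ l) x
      = ((G x ** chrm i x) *v X x) $ l - ((\<chi> j k. pderiv_at i (\<lambda>y. G y $ j $ k) x) *v X x) $ l"
      by (subst pderiv_matrix_vector)
         (auto intro!: smooth_on_differentiable[OF _ x] smooth_G smooth_on_nth[OF open_W] assms
           simp: cov_chrm matrix_vector_right_distrib matrix_vector_mul_assoc)
    also have "\<dots> = (\<Sum>k\<in>UNIV. (G x ** chrm i x) $ l $ k * X x $ k - pderiv_at i (\<lambda>y. G y $ l $ k) x * X x $ k)"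
      by (simp add: matrix_vector_mult_def sum_subtractf)
    also have "\<dots> = (\<Sum>k\<in>UNIV. (1/2) * (pderiv_at k (\<lambda>y. G y $ l $ i) x - pderiv_at l (\<lambda>y. G y $ i $ k) x
            - pderiv_at i (\<lambda>y. G y $ l $ k) x) * X x $ k)"
      unfolding lower_chrm[OF x] by (intro sum.cong refl) (simp add: field_simps)
    finally show ?thesis .
  qed
  show ?thesis
    unfolding * dG_sym[OF x, of _ i l] by (intro sum.cong refl) (simp add: algebra_simps)
qed

lemma smooth_cov: "smooth_on W X \<Longrightarrow> smooth_on W (\<lambda>x. cov G X i x $ j)"
  unfolding cov_def
  by (simp, intro smooth_on_mult smooth_on_sum smooth_on_add smooth_chr smooth_on_nth open_W
       smooth_on_pderiv[of W "\<lambda>y. X y $ _"])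

lemma smooth_divg: "smooth_on W X \<Longrightarrow> smooth_on W (divg G X)"
  unfolding divg_def[abs_def] by (rule smooth_on_sum[OF open_W smooth_cov])

lemma acc_nth: "acc G X x $ j = (\<Sum>i\<in>UNIV. X x $ i * cov G X i x $ j)"
  by (simp add: acc_def)

lemma smooth_acc:
  assumes "smooth_on W X"
  shows "smooth_on W (acc G X)"
proof (rule smooth_on_vecI[OF open_W])
  fix j
  show "smooth_on W (\<lambda>x. acc G X x $ j)"
    unfolding acc_nth
    by (rule smooth_on_sum[OF open_W smooth_on_mult[OF open_W smooth_on_nth[OF open_W assms] smooth_cov[OF assms]]])
qed

text \<open>The Ricci term is the commutator of the two covariant derivatives when the derivative
  along \<open>X\<close> is exchanged with the trace. On a null hypersurface the left side becomes
  the derivative of the expansion along a generator.\<close>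

lemma bochner:
  assumes x: "x \<in> W" and X: "smooth_on W X"
  shows "(\<Sum>k\<in>UNIV. X x $ k * pderiv_at k (divg G X) x) = divg G (acc G X) x
    - (\<Sum>i\<in>UNIV. \<Sum>k\<in>UNIV. cov G X i x $ k * cov G X k x $ i)
    - (\<Sum>j\<in>UNIV. \<Sum>l\<in>UNIV. chr_ricci G j l x * X x $ j * X x $ l)"
proof -
  let ?X = "\<lambda>k. X x $ k" and ?dX = "\<lambda>i k. pderiv_at i (\<lambda>y. X y $ k) x"
  let ?ddX = "\<lambda>i j k. pderiv_at i (pderiv_at j (\<lambda>y. X y $ k)) x"
  let ?C = "\<lambda>i j k. chr G i j k x" and ?dC = "\<lambda>l i j k. pderiv_at l (chr G i j k) x"
  have X': "smooth_on W (\<lambda>y. X y $ k)" for k by (rule smooth_on_nth[OF open_W X])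
  have d: "(\<lambda>y. X y $ k) differentiable (at x)" "pderiv_at j (\<lambda>y. X y $ k) differentiable (at x)"
      "chr G i j k differentiable (at x)" for i j k
    by (auto intro!: smooth_on_differentiable[OF _ x] X' smooth_on_pderiv smooth_chr)
  have dcov: "pderiv_at k (\<lambda>y. cov G X i y $ j) x = ?ddX k i j + (\<Sum>m\<in>UNIV. ?dC k j i m * ?X m + ?C j i m * ?dX k m)" for i j k
    unfolding cov_def by (simp add: pderiv_add pderiv_sum pderiv_mult d differentiable_mult differentiable_add differentiable_sum)
  have dc: "(\<lambda>y. cov G X i y $ j) differentiable (at x)" for i j
    by (rule smooth_on_differentiable[OF smooth_cov[OF X] x])
  have 1: "pderiv_at k (divg G X) x = (\<Sum>i\<in>UNIV. ?ddX k i i + (\<Sum>j\<in>UNIV. ?dC k i i j * ?X j + ?C i i j * ?dX k j))" for k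
    unfolding divg_def[abs_def] by (subst pderiv_sum) (simp_all add: dc dcov)
  have 2: "pderiv_at i (\<lambda>y. acc G X y $ j) x = (\<Sum>k\<in>UNIV. ?dX i k * (?dX k j + (\<Sum>m\<in>UNIV. ?C j k m * ?X m))
      + ?X k * (?ddX i k j + (\<Sum>m\<in>UNIV. ?dC i j k m * ?X m + ?C j k m * ?dX i m)))" for i j
    unfolding acc_nth by (simp add: pderiv_sum pderiv_mult dc d differentiable_mult dcov) (simp add: cov_def)
  have 3: "divg G (acc G X) x = (\<Sum>i\<in>UNIV. (\<Sum>k\<in>UNIV. ?dX i k * (?dX k i + (\<Sum>j\<in>UNIV. ?C i k j * ?X j))
         + ?X k * (?ddX i k i + (\<Sum>j\<in>UNIV. ?dC i i k j * ?X j + ?C i k j * ?dX i j)))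
       + (\<Sum>m\<in>UNIV. ?C i i m * (\<Sum>k\<in>UNIV. ?X k * (?dX k m + (\<Sum>j\<in>UNIV. ?C m k j * ?X j)))))"
    unfolding divg_def cov_def[of _ "acc G X"] by (simp only: vec_lambda_beta 2) (simp add: acc_nth cov_def)
  have 4: "(\<Sum>i\<in>UNIV. \<Sum>k\<in>UNIV. cov G X i x $ k * cov G X k x $ i)
    = (\<Sum>i\<in>UNIV. \<Sum>k\<in>UNIV. (?dX i k + (\<Sum>j\<in>UNIV. ?C k i j * ?X j)) * (?dX k i + (\<Sum>l\<in>UNIV. ?C i k l * ?X l)))"
    by (simp add: cov_def)
  show ?thesis
    unfolding 1 3 4 chr_ricci_def
    by (rule bochner_algebra[of ?ddX ?C ?X ?dC ?dX])
       (auto intro: pderiv_commute[OF open_W X' x] chr_sym[OF x])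
qed

end

section \<open>Null hypersurfaces in a coordinate domain\<close>

lemma axis_inner_vec: "v \<bullet> axis i (1::real) = v $ i" "axis i (1::real) \<bullet> v = v $ i"
  by (simp_all add: inner_axis inner_axis')

lemma inner_vec_sum: "(u::real^'n) \<bullet> v = (\<Sum>i\<in>UNIV. u $ i * v $ i)"
  by (simp add: inner_vec_def)

definition grad_vec :: "(real^'n \<Rightarrow> real) \<Rightarrow> real^'n \<Rightarrow> real^'n" where
  "grad_vec f x = (\<chi> i. pderiv_at i f x)"

text \<open>The field \<open>X\<close> restricts to the null normal \<open>\<xi>\<close> of \<open>{f = 0}\<close> with \<open>g(\<xi>, Z) = -1\<close>. Off the
  hypersurface the correction along \<open>Z\<close> makes \<open>g(X, X)\<close> vanish to second order in \<open>f\<close>, so that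
  the divergence of \<open>X\<close> is the null expansion.\<close>

definition null_transversal ::
    "(real^'n \<Rightarrow> real^'n^'n) \<Rightarrow> (real^'n \<Rightarrow> real^'n) \<Rightarrow> (real^'n \<Rightarrow> real) \<Rightarrow> real^'n \<Rightarrow> real^'n" where
  "null_transversal G Z f x = (let V = matrix_inv (G x) *v grad_vec f x; w = Z x \<bullet> grad_vec f x in
     (- inverse w) *\<^sub>R V + (V \<bullet> grad_vec f x * inverse w * inverse w * (1/2)) *\<^sub>R Z x)"

text \<open>\<open>null\<close> says that the gradient of \<open>f\<close> is null on
  \<open>{f = 0}\<close>, that is, that this hypersurface is degenerate. \<open>curve\<close> states
  its smoothness in the only form used: tangential vectors are velocities of curves inside it.
  \<open>conformal\<close> is \<open>L_Z g = 2 r g\<close> in coordinates.\<close>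

locale null_chart = metric_chart W G
  for W :: "(real^'n) set" and G :: "real^'n \<Rightarrow> real^'n^'n" +
  fixes Z :: "real^'n \<Rightarrow> real^'n" and f :: "real^'n \<Rightarrow> real"
  assumes smooth_Z: "smooth_on W Z" and smooth_f: "smooth_on W f"
    and transversal: "\<And>x. x \<in> W \<Longrightarrow> Z x \<bullet> grad_vec f x \<noteq> 0"
    and null: "\<And>x. x \<in> W \<Longrightarrow> f x = 0 \<Longrightarrow> (matrix_inv (G x) *v grad_vec f x) \<bullet> grad_vec f x = 0"
    and curve: "\<And>x v. x \<in> W \<Longrightarrow> f x = 0 \<Longrightarrow> v \<bullet> grad_vec f x = 0 \<Longrightarrow>
        \<exists>\<beta>. \<beta> 0 = x \<and> (\<beta> has_vector_derivative v) (at 0) \<and> (\<forall>\<^sub>F t in at 0. f (\<beta> t) = 0)"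
    and conformal: "\<And>x. x \<in> W \<Longrightarrow> \<exists>r. \<forall>i j.
        (\<Sum>k\<in>UNIV. Z x $ k * pderiv_at k (\<lambda>y. G y $ i $ j) x + G x $ k $ j * pderiv_at i (\<lambda>y. Z y $ k) x
           + G x $ i $ k * pderiv_at j (\<lambda>y. Z y $ k) x) = 2 * r * G x $ i $ j"
begin

text \<open>\<open>V\<close> is the gradient of \<open>f\<close>, \<open>w\<close> the derivative of
  \<open>f\<close> along \<open>Z\<close>, and \<open>h = g(V, V)\<close>, which vanishes on
  \<open>{f = 0}\<close>. \<open>q\<close> is the factor in
  \<open>g(X, X) = h * h * q\<close>.\<close>

definition "V x = matrix_inv (G x) *v grad_vec f x"
definition "w x = Z x \<bullet> grad_vec f x"
definition "h x = V x \<bullet> grad_vec f x"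
definition "q x = Z x \<bullet> (G x *v Z x) * (inverse (w x) * inverse (w x) * inverse (w x) * inverse (w x) * (1/4))"
abbreviation "X \<equiv> null_transversal G Z f"

lemma X_eq: "X x = (- inverse (w x)) *\<^sub>R V x + (h x * inverse (w x) * inverse (w x) * (1/2)) *\<^sub>R Z x"
  by (simp add: null_transversal_def Let_def V_def w_def h_def)

lemma w_nz: "x \<in> W \<Longrightarrow> w x \<noteq> 0"
  by (simp add: w_def transversal)

lemma smooth_grad: "smooth_on W (\<lambda>x. grad_vec f x $ i)"
  unfolding grad_vec_def vec_lambda_beta by (rule smooth_on_pderiv[OF smooth_f])

lemma smooth_V: "smooth_on W V"
proof (rule smooth_on_vecI[OF open_W])
  fix i
  show "smooth_on W (\<lambda>x. V x $ i)"
    unfolding V_def matrix_vector_mult_def vec_lambda_beta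
    by (rule smooth_on_sum[OF open_W smooth_on_mult[OF open_W smooth_inv_G smooth_grad]])
qed

lemma smooth_inner:
  assumes "smooth_on W A" "smooth_on W B"
  shows "smooth_on W (\<lambda>x. A x \<bullet> B x)"
  by (rule smooth_on_bilinear[OF open_W bounded_bilinear_inner assms])

lemma smooth_grad_vec: "smooth_on W (grad_vec f)"
  by (rule smooth_on_vecI[OF open_W smooth_grad])

lemma smooth_w: "smooth_on W w"
  unfolding w_def[abs_def] by (rule smooth_inner[OF smooth_Z smooth_grad_vec])

lemma smooth_h: "smooth_on W h"
  unfolding h_def[abs_def] by (rule smooth_inner[OF smooth_V smooth_grad_vec])

lemma smooth_inv_w: "smooth_on W (\<lambda>x. inverse (w x))"
  by (rule smooth_on_inverse[OF open_W w_nz smooth_w])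

lemma smooth_GY: "smooth_on W Y \<Longrightarrow> smooth_on W (\<lambda>x. G x *v Y x)"
proof (rule smooth_on_vecI[OF open_W])
  fix i assume Y: "smooth_on W Y"
  show "smooth_on W (\<lambda>x. (G x *v Y x) $ i)"
    unfolding matrix_vector_mult_def vec_lambda_beta
    by (rule smooth_on_sum[OF open_W smooth_on_mult[OF open_W smooth_G smooth_on_nth[OF open_W Y]]])
qed

lemma smooth_q: "smooth_on W q"
  unfolding q_def[abs_def]
  by (rule smooth_on_mult[OF open_W smooth_inner[OF smooth_Z smooth_GY[OF smooth_Z]]])
     (intro smooth_on_mult open_W smooth_inv_w smooth_on_const)

lemma smooth_X: "smooth_on W X"
  unfolding X_eq[abs_def]
  by (rule smooth_on_add[OF open_W]; rule smooth_on_bilinear[OF open_W bounded_bilinear_scaleR])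
     (rule smooth_V smooth_Z | intro smooth_on_mult smooth_on_uminus open_W smooth_inv_w smooth_h smooth_on_const)+

lemma GV: "x \<in> W \<Longrightarrow> G x *v V x = grad_vec f x"
  by (simp add: V_def matrix_vector_mul_assoc inv_G)

lemma GX: "x \<in> W \<Longrightarrow> G x *v X x =
    (- inverse (w x)) *\<^sub>R grad_vec f x + (h x * inverse (w x) * inverse (w x) * (1/2)) *\<^sub>R (G x *v Z x)"
  by (simp only: X_eq matrix_vector_right_distrib matrix_vector_mult_scaleR GV)

text \<open>Write \<open>X = a V + b Z\<close> with \<open>a = - 1 / w\<close> and
  \<open>b = h / (2 w^2)\<close>. Then \<open>a^2 h + 2 a b w = 0\<close>, which is how
  \<open>b\<close> was chosen, and only \<open>b^2 g(Z, Z)\<close> is left, quadratic in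
  \<open>h\<close>.\<close>

lemma inner_XX: "x \<in> W \<Longrightarrow> X x \<bullet> (G x *v X x) = h x * h x * q x"
proof -
  assume x: "x \<in> W"
  have "V x \<bullet> (G x *v Z x) = w x" using inner_G_commute[OF x, of "V x" "Z x"] by (simp add: GV[OF x] w_def)
  moreover have "a * (a * h x + b * w x) + b * (a * w x + b * c) = h x * h x * (c * (inverse (w x) * inverse (w x) * inverse (w x) * inverse (w x) * (1/4)))"
    if "a = - inverse (w x)" "b = h x * inverse (w x) * inverse (w x) * (1/2)" for a b c
    using w_nz[OF x] unfolding that by (simp add: field_simps)
  ultimately show ?thesis
    unfolding GX[OF x] unfolding X_eq q_def
    by (simp only: inner_add_left inner_add_right inner_scaleR_left inner_scaleR_right h_def[symmetric] w_def[symmetric])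
qed

section \<open>First-order identities at a point of the hypersurface\<close>

context
  fixes x
  assumes x: "x \<in> W" and fx: "f x = 0"
begin

lemma h0: "h x = 0"
  using null[OF x fx] by (simp add: h_def V_def)

lemma GX0: "G x *v X x = (- inverse (w x)) *\<^sub>R grad_vec f x"
  by (simp add: GX[OF x] h0)

lemma XZ: "X x \<bullet> (G x *v Z x) = -1"
proof -
  have "X x \<bullet> (G x *v Z x) = - inverse (w x) * w x"
    unfolding inner_G_commute[OF x, of "X x" "Z x"] GX0 w_def by (simp only: inner_scaleR_right)
  then show ?thesis using w_nz[OF x] by simp
qed

lemma X_nonzero: "X x \<noteq> 0"
proof
  assume "X x = 0"
  with XZ show False by (simp only: inner_zero_left)
qed

lemma XX0: "X x \<bullet> (G x *v X x) = 0"
  unfolding inner_XX[OF x] h0 by simp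

lemma orth_grad: "v \<bullet> (G x *v X x) = 0 \<longleftrightarrow> v \<bullet> grad_vec f x = 0"
  unfolding GX0 inner_scaleR_right using w_nz[OF x] by simp

lemma Xf: "X x \<bullet> grad_vec f x = 0"
  using XX0 by (rule orth_grad[THEN iffD1])

text \<open>By \<open>curve\<close> there is a curve in \<open>{f = 0}\<close> with velocity
  \<open>v\<close>; along it \<open>u\<close> is constantly zero near parameter 0, and the chain
  rule reads off the derivative.\<close>

lemma tangential_derivative:
  assumes u: "smooth_on W u" "\<And>y. y \<in> W \<Longrightarrow> f y = 0 \<Longrightarrow> u y = (0::real)" and v: "v \<bullet> grad_vec f x = 0"
  shows "v \<bullet> grad_vec u x = 0"
proof -
  obtain \<beta> where \<beta>: "\<beta> 0 = x" "(\<beta> has_vector_derivative v) (at 0)" "\<forall>\<^sub>F t in at 0. f (\<beta> t) = 0"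
    using curve[OF x fx v] by blast
  have "isCont \<beta> 0" using \<beta>(2) by (rule has_vector_derivative_continuous)
  then have "(\<beta> \<longlongrightarrow> x) (at 0)" using \<beta>(1) by (simp add: isCont_def)
  then have "\<forall>\<^sub>F t in at 0. \<beta> t \<in> W" using open_W x topological_tendstoD by blast
  with \<beta>(3) have ev: "\<forall>\<^sub>F t in at 0. u (\<beta> t) = 0"
    by eventually_elim (rule u(2))
  have du: "u differentiable (at x)" by (rule smooth_on_differentiable[OF u(1) x])
  have "((\<lambda>t. u (\<beta> t)) has_derivative (\<lambda>t. frechet_derivative u (at x) (t *\<^sub>R v))) (at 0)"
    using has_derivative_compose[OF \<beta>(2)[unfolded has_vector_derivative_def], of u "frechet_derivative u (at x)"]
      differentiable_frechetD[OF du] \<beta>(1) by simp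
  moreover have "((\<lambda>t. u (\<beta> t)) has_derivative (\<lambda>t. 0)) (at 0)"
  proof (rule has_derivative_transform_eventually[of "\<lambda>t. 0" _ 0 UNIV])
    show "\<forall>\<^sub>F t in at 0. 0 = u (\<beta> t)" using ev by eventually_elim simp
    show "0 = u (\<beta> 0)" using u(2)[OF x fx] \<beta>(1) by simp
  qed auto
  ultimately have "(\<lambda>t::real. frechet_derivative u (at x) (t *\<^sub>R v)) = (\<lambda>t. 0)"
    by (rule has_derivative_unique)
  from fun_cong[OF this, of 1] have "frechet_derivative u (at x) v = 0" by simp
  then show ?thesis
    unfolding frechet_derivative_pderiv[OF du] by (simp add: inner_vec_sum grad_vec_def)
qed

text \<open>Subtracting a multiple of the transversal \<open>Z\<close> makes each coordinate vector
  tangential, so \<open>tangential_derivative\<close> applies. Thus \<open>du\<close> is a multiple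
  of \<open>df\<close>, with factor \<open>Z u / Z f\<close>.\<close>

lemma derivative_proportional:
  assumes u: "smooth_on W u" "\<And>y. y \<in> W \<Longrightarrow> f y = 0 \<Longrightarrow> u y = (0::real)"
  shows "pderiv_at i u x = grad_vec f x $ i * (Z x \<bullet> grad_vec u x * inverse (w x))"
proof -
  let ?v = "axis i 1 - (grad_vec f x $ i * inverse (w x)) *\<^sub>R Z x"
  have "?v \<bullet> grad_vec f x = 0"
    using w_nz[OF x] by (simp add: inner_diff_left axis_inner_vec w_def[symmetric])
  from tangential_derivative[OF u this] show ?thesis
    by (simp add: inner_diff_left axis_inner_vec mult_ac) (simp add: grad_vec_def)
qed

lemma dh: "X x \<bullet> grad_vec h x = 0"
  by (rule tangential_derivative[OF smooth_h _ Xf]) (simp add: h_def V_def null)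

lemma dH0: "pderiv_at i (\<lambda>y. X y \<bullet> (G y *v X y)) x = 0"
proof -
  have "pderiv_at i (\<lambda>y. X y \<bullet> (G y *v X y)) x = pderiv_at i (\<lambda>y. h y * (h y * q y)) x"
    by (rule pderiv_cong[OF open_W x])
       (auto simp: inner_XX intro!: differentiable_mult smooth_on_differentiable[OF smooth_h x] smooth_on_differentiable[OF smooth_q x])
  also have "\<dots> = 0"
    by (simp add: pderiv_mult differentiable_mult smooth_on_differentiable[OF smooth_h x] smooth_on_differentiable[OF smooth_q x] h0)
  finally show ?thesis .
qed

text \<open>Half of \<open>dH0\<close> by metric compatibility. The second-order vanishing of
  \<open>g(X, X)\<close> gives this for every direction, including the transversal one, so the whole
  image of \<open>shape\<close> is orthogonal to \<open>X\<close>.\<close>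

lemma cov_X: "cov G X i x \<bullet> (G x *v X x) = 0"
  using dH0[of i] pderiv_inner[OF x smooth_X smooth_X, of i] inner_G_commute[OF x, of "X x" "cov G X i x"]
  by simp

definition "shape = (\<chi> j i. cov G X i x $ j)"

lemma shape_vector: "shape *v v = (\<Sum>i\<in>UNIV. v $ i *\<^sub>R cov G X i x)"
  by (simp add: shape_def vec_eq_iff matrix_vector_mult_def mult.commute)

lemma shape_X: "shape *v X x = acc G X x"
  by (simp add: shape_vector acc_def)

lemma shape_null: "(shape *v v) \<bullet> (G x *v X x) = 0"
  by (simp add: shape_vector inner_sum_left cov_X)

text \<open>On \<open>{f = 0}\<close> the covector \<open>G X\<close> equals
  \<open>- df / w\<close>, so its exterior derivative there consists of terms with a factor
  \<open>df\<close>, the Hessian of \<open>f\<close> cancelling by symmetry. Such terms vanish on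
  two tangential vectors, and \<open>torsion_free\<close> transfers this to the covariant
  derivative.\<close>

lemma shape_symmetric:
  assumes u: "u \<bullet> grad_vec f x = 0" and v: "v \<bullet> grad_vec f x = 0"
  shows "(shape *v u) \<bullet> (G x *v v) = (shape *v v) \<bullet> (G x *v u)"
proof -
  \<comment> \<open>The factor that \<open>derivative_proportional\<close> assigns to the component
    \<open>l\<close> of the covector \<open>G X + df / w\<close>, which vanishes on the
    hypersurface.\<close>
  define \<mu> where "\<mu> l = Z x \<bullet> grad_vec (\<lambda>y. (G y *v X y) $ l + inverse (w y) * grad_vec f y $ l) x * inverse (w x)" for l
  have sGX: "smooth_on W (\<lambda>y. (G y *v X y) $ l)" for l
    by (rule smooth_on_nth[OF open_W smooth_GY[OF smooth_X]])
  have s2: "smooth_on W (\<lambda>y. inverse (w y) * grad_vec f y $ l)" for l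
    by (rule smooth_on_mult[OF open_W smooth_inv_w smooth_grad])
  have d: "pderiv_at i (\<lambda>y. (G y *v X y) $ l) x = grad_vec f x $ i * \<mu> l
      - pderiv_at i (\<lambda>y. inverse (w y)) x * grad_vec f x $ l - inverse (w x) * pderiv_at i (pderiv_at l f) x" for i l
  proof -
    have "pderiv_at i (\<lambda>y. (G y *v X y) $ l + inverse (w y) * grad_vec f y $ l) x = grad_vec f x $ i * \<mu> l"
      unfolding \<mu>_def
    proof (rule derivative_proportional)
      show "smooth_on W (\<lambda>y. (G y *v X y) $ l + inverse (w y) * grad_vec f y $ l)"
        by (rule smooth_on_add[OF open_W sGX s2])
      show "(G y *v X y) $ l + inverse (w y) * grad_vec f y $ l = 0" if "y \<in> W" "f y = 0" for y
        using null[OF that] by (simp add: GX[OF that(1)] h_def V_def)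
    qed
    moreover have "pderiv_at i (\<lambda>y. (G y *v X y) $ l + inverse (w y) * grad_vec f y $ l) x
       = pderiv_at i (\<lambda>y. (G y *v X y) $ l) x + (pderiv_at i (\<lambda>y. inverse (w y)) x * grad_vec f x $ l
           + inverse (w x) * pderiv_at i (\<lambda>y. grad_vec f y $ l) x)"
      by (simp add: pderiv_add pderiv_mult smooth_on_differentiable[OF sGX x] smooth_on_differentiable[OF s2 x]
          smooth_on_differentiable[OF smooth_inv_w x] smooth_on_differentiable[OF smooth_grad x])
    ultimately show ?thesis by (simp add: grad_vec_def)
  qed
  define t where "t a b = (shape *v a) \<bullet> (G x *v b)" for a b :: "real^'n"
  have t: "t a b = (\<Sum>i\<in>UNIV. \<Sum>l\<in>UNIV. a $ i * b $ l * (G x *v cov G X i x) $ l)" for a b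
  proof -
    have "t a b = (\<Sum>i\<in>UNIV. a $ i * (b \<bullet> (G x *v cov G X i x)))"
      by (simp add: t_def shape_vector inner_sum_left inner_G_commute[OF x, of b])
    then show ?thesis by (simp add: inner_vec_sum sum_distrib_left mult_ac)
  qed
  have "t u v - t v u = (\<Sum>i\<in>UNIV. \<Sum>l\<in>UNIV. u $ i * v $ l * ((G x *v cov G X i x) $ l - (G x *v cov G X l x) $ i))"
  proof -
    have "t v u = (\<Sum>i\<in>UNIV. \<Sum>l\<in>UNIV. u $ i * v $ l * (G x *v cov G X l x) $ i)"
      unfolding t by (subst sum.swap) (simp add: mult_ac)
    then show ?thesis by (simp add: t sum_subtractf right_diff_distrib)
  qed
  also have "\<dots> = (\<Sum>i\<in>UNIV. \<Sum>l\<in>UNIV. u $ i * v $ l *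
      (pderiv_at i (\<lambda>y. (G y *v X y) $ l) x - pderiv_at l (\<lambda>y. (G y *v X y) $ i) x))"
  proof (intro sum.cong refl)
    fix i l
    have "(G x *v cov G X i x) $ l - (G x *v cov G X l x) $ i =
        pderiv_at i (\<lambda>y. (G y *v X y) $ l) x - pderiv_at l (\<lambda>y. (G y *v X y) $ i) x"
      using torsion_free[OF x smooth_X, of i l] by linarith
    then show "u $ i * v $ l * ((G x *v cov G X i x) $ l - (G x *v cov G X l x) $ i) =
        u $ i * v $ l * (pderiv_at i (\<lambda>y. (G y *v X y) $ l) x - pderiv_at l (\<lambda>y. (G y *v X y) $ i) x)"
      by (simp only:)
  qed
  also have "\<dots> = (\<Sum>i\<in>UNIV. \<Sum>l\<in>UNIV. (u $ i * grad_vec f x $ i) * (v $ l * (\<mu> l + pderiv_at l (\<lambda>y. inverse (w y)) x))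
      - (u $ i * (\<mu> i + pderiv_at i (\<lambda>y. inverse (w y)) x)) * (v $ l * grad_vec f x $ l))"
  proof (intro sum.cong refl)
    fix i l
    show "u $ i * v $ l * (pderiv_at i (\<lambda>y. (G y *v X y) $ l) x - pderiv_at l (\<lambda>y. (G y *v X y) $ i) x)
      = (u $ i * grad_vec f x $ i) * (v $ l * (\<mu> l + pderiv_at l (\<lambda>y. inverse (w y)) x))
      - (u $ i * (\<mu> i + pderiv_at i (\<lambda>y. inverse (w y)) x)) * (v $ l * grad_vec f x $ l)"
      unfolding d pderiv_commute[OF open_W smooth_f x, of i l] by (simp add: algebra_simps)
  qed
  also have "\<dots> = (\<Sum>i\<in>UNIV. \<Sum>l\<in>UNIV. (u $ i * grad_vec f x $ i) * (v $ l * (\<mu> l + pderiv_at l (\<lambda>y. inverse (w y)) x)))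
      - (\<Sum>i\<in>UNIV. \<Sum>l\<in>UNIV. (u $ i * (\<mu> i + pderiv_at i (\<lambda>y. inverse (w y)) x)) * (v $ l * grad_vec f x $ l))"
    by (simp only: sum_subtractf)
  also have "\<dots> = (u \<bullet> grad_vec f x) * (\<Sum>l\<in>UNIV. v $ l * (\<mu> l + pderiv_at l (\<lambda>y. inverse (w y)) x))
      - (\<Sum>i\<in>UNIV. u $ i * (\<mu> i + pderiv_at i (\<lambda>y. inverse (w y)) x)) * (v \<bullet> grad_vec f x)"
    by (simp only: sum_product inner_vec_sum)
  finally show ?thesis using u v by (simp add: t_def)
qed

text \<open>Invariantly,
  \<open>2 g(X, \<nabla>_X Z) = (L_Z g)(X, X) = 2 r g(X, X) = 0\<close>.\<close>

lemma lie_XX: "(\<Sum>i\<in>UNIV. X x $ i * (X x \<bullet> (G x *v cov G Z i x))) = 0"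
proof -
  obtain r where r: "\<forall>i j. (\<Sum>k\<in>UNIV. Z x $ k * pderiv_at k (\<lambda>y. G y $ i $ j) x + G x $ k $ j * pderiv_at i (\<lambda>y. Z y $ k) x
      + G x $ i $ k * pderiv_at j (\<lambda>y. Z y $ k) x) = 2 * r * G x $ i $ j"
    using conformal[OF x] by blast
  let ?u = "\<lambda>i. X x $ i"
  let ?dZ = "\<lambda>i k. pderiv_at i (\<lambda>y. Z y $ k) x"
  let ?dG = "\<lambda>k i j. pderiv_at k (\<lambda>y. G y $ i $ j) x"
  \<comment> \<open>\<open>2 * s1 + s2\<close> is \<open>(L_Z g)(X, X)\<close>. The sum
    \<open>s3\<close> comes from the Christoffel symbols in \<nabla>\<open>Z\<close> and cancels
    upon exchanging the two indices contracted with \<open>X\<close>.\<close>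
  define s1 where "s1 = (\<Sum>i\<in>UNIV. \<Sum>m\<in>UNIV. \<Sum>k\<in>UNIV. ?u i * ?u m * (G x $ m $ k * ?dZ i k))"
  define s2 where "s2 = (\<Sum>i\<in>UNIV. \<Sum>m\<in>UNIV. \<Sum>k\<in>UNIV. ?u i * ?u m * (Z x $ k * ?dG k m i))"
  define s3 where "s3 = (\<Sum>i\<in>UNIV. \<Sum>m\<in>UNIV. \<Sum>k\<in>UNIV. ?u i * ?u m * (Z x $ k * ?dG i m k))"
  have s3': "(\<Sum>i\<in>UNIV. \<Sum>m\<in>UNIV. \<Sum>k\<in>UNIV. ?u i * ?u m * (Z x $ k * ?dG m i k)) = s3"
    unfolding s3_def by (subst sum.swap) (simp only: mult_ac)
  have s1': "(\<Sum>i\<in>UNIV. \<Sum>j\<in>UNIV. \<Sum>k\<in>UNIV. ?u i * ?u j * (G x $ i $ k * ?dZ j k)) = s1"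
    unfolding s1_def by (subst sum.swap) (simp only: mult_ac)
  have cZ: "(G x *v cov G Z i x) $ m = (\<Sum>k\<in>UNIV. G x $ m $ k * ?dZ i k)
      + (\<Sum>k\<in>UNIV. (1/2) * (?dG i m k + ?dG k m i - ?dG m i k) * Z x $ k)" for i m
  proof -
    have "(G x *v cov G Z i x) $ m = (G x *v (\<chi> k. ?dZ i k)) $ m + ((G x ** chrm i x) *v Z x) $ m"
      by (simp add: cov_chrm matrix_vector_right_distrib matrix_vector_mul_assoc)
    moreover have "((G x ** chrm i x) *v Z x) $ m = (\<Sum>k\<in>UNIV. (G x ** chrm i x) $ m $ k * Z x $ k)"
      unfolding matrix_vector_mult_def by simp
    ultimately show ?thesis
      unfolding lower_chrm[OF x] by (simp add: matrix_vector_mult_def)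
  qed
  have "(\<Sum>i\<in>UNIV. ?u i * (X x \<bullet> (G x *v cov G Z i x)))
      = (\<Sum>i\<in>UNIV. \<Sum>m\<in>UNIV. \<Sum>k\<in>UNIV. ?u i * ?u m * (G x $ m $ k * ?dZ i k)
          + (1/2) * (?u i * ?u m * (Z x $ k * ?dG i m k) + ?u i * ?u m * (Z x $ k * ?dG k m i)
              - ?u i * ?u m * (Z x $ k * ?dG m i k)))"
    unfolding inner_vec_sum cZ
    by (simp add: sum_distrib_left sum.distrib[symmetric] distrib_left[symmetric] sum_subtractf[symmetric])
       (intro sum.cong refl, simp add: algebra_simps)
  also have "\<dots> = s1 + (1/2) * (s3 + s2 - (\<Sum>i\<in>UNIV. \<Sum>m\<in>UNIV. \<Sum>k\<in>UNIV. ?u i * ?u m * (Z x $ k * ?dG m i k)))"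
    by (simp only: s1_def s2_def s3_def sum.distrib sum_subtractf sum_distrib_left[symmetric])
  also have "\<dots> = s1 + (1/2) * (s3 + s2 - s3)" by (simp only: s3')
  finally have 1: "2 * (\<Sum>i\<in>UNIV. ?u i * (X x \<bullet> (G x *v cov G Z i x))) = 2 * s1 + s2" by simp
  have "(\<Sum>i\<in>UNIV. \<Sum>j\<in>UNIV. ?u i * ?u j * (2 * r * G x $ i $ j)) = s2 + s1 + s1"
  proof -
    have "(\<Sum>i\<in>UNIV. \<Sum>j\<in>UNIV. ?u i * ?u j * (2 * r * G x $ i $ j))
      = (\<Sum>i\<in>UNIV. \<Sum>j\<in>UNIV. \<Sum>k\<in>UNIV. ?u i * ?u j * (Z x $ k * ?dG k j i)
          + ?u i * ?u j * (G x $ j $ k * ?dZ i k) + ?u i * ?u j * (G x $ i $ k * ?dZ j k))"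
    proof (intro sum.cong refl)
      fix i j
      have "2 * r * G x $ i $ j = (\<Sum>k\<in>UNIV. Z x $ k * ?dG k j i + G x $ j $ k * ?dZ i k + G x $ i $ k * ?dZ j k)"
        unfolding r[rule_format, of i j, symmetric]
      proof (intro sum.cong refl)
        fix k
        show "Z x $ k * ?dG k i j + G x $ k $ j * ?dZ i k + G x $ i $ k * ?dZ j k
            = Z x $ k * ?dG k j i + G x $ j $ k * ?dZ i k + G x $ i $ k * ?dZ j k"
          unfolding dG_sym[OF x, of k i j] G_sym[OF x, of k j] ..
      qed
      then show "?u i * ?u j * (2 * r * G x $ i $ j) = (\<Sum>k\<in>UNIV. ?u i * ?u j * (Z x $ k * ?dG k j i)
          + ?u i * ?u j * (G x $ j $ k * ?dZ i k) + ?u i * ?u j * (G x $ i $ k * ?dZ j k))"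
        by (simp only: sum_distrib_left distrib_left)
    qed
    then show ?thesis
      by (simp add: sum.distrib s1') (simp add: s1_def s2_def)
  qed
  moreover have "(\<Sum>i\<in>UNIV. \<Sum>j\<in>UNIV. ?u i * ?u j * (2 * r * G x $ i $ j)) = 2 * r * (X x \<bullet> (G x *v X x))"
    by (simp add: inner_vec_sum matrix_vector_mult_def sum_distrib_left mult_ac)
  ultimately show ?thesis using 1 XX0 by simp
qed

end

section \<open>Geodesic generators and Raychaudhuri's inequality\<close>

text \<open>For tangential \<open>v\<close>, \<open>shape_symmetric\<close> gives
  \<open>g(shape X, v) = g(shape v, X) = 0\<close>. For \<open>Z\<close>, differentiating
  \<open>g(X, Z) = -1\<close> along the tangential vector \<open>X\<close> leaves only the term
  killed by \<open>lie_XX\<close>. Tangential vectors and \<open>Z\<close> span everything.\<close>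

lemma acc0:
  assumes x: "x \<in> W" and fx: "f x = 0"
  shows "acc G X x = 0"
proof -
  have "X x \<bullet> grad_vec (\<lambda>y. X y \<bullet> (G y *v Z y) + 1) x = 0"
  proof (rule tangential_derivative[OF x fx _ _ Xf[OF x fx]])
    show "smooth_on W (\<lambda>y. X y \<bullet> (G y *v Z y) + 1)"
      by (rule smooth_on_add[OF open_W smooth_inner[OF smooth_X smooth_GY[OF smooth_Z]] smooth_on_const])
  qed (simp add: XZ)
  moreover have "pderiv_at i (\<lambda>y. X y \<bullet> (G y *v Z y) + 1) x = cov G X i x \<bullet> (G x *v Z x) + X x \<bullet> (G x *v cov G Z i x)" for i
    using smooth_on_differentiable[OF smooth_inner[OF smooth_X smooth_GY[OF smooth_Z]] x]
    by (simp add: pderiv_add pderiv_inner[OF x smooth_X smooth_Z])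
  ultimately have "(\<Sum>i\<in>UNIV. X x $ i * (cov G X i x \<bullet> (G x *v Z x))) + (\<Sum>i\<in>UNIV. X x $ i * (X x \<bullet> (G x *v cov G Z i x))) = 0"
    by (simp only: inner_vec_sum[of "X x" "grad_vec _ x"])
       (simp add: grad_vec_def distrib_left sum.distrib)
  then have aZ: "acc G X x \<bullet> (G x *v Z x) = 0"
    by (simp add: acc_def inner_sum_left lie_XX[OF x fx])
  have "(G x *v acc G X x) $ i = 0" for i
  proof -
    let ?v = "axis i 1 - (grad_vec f x $ i * inverse (w x)) *\<^sub>R Z x"
    have v: "?v \<bullet> grad_vec f x = 0"
      using w_nz[OF x] by (simp add: inner_diff_left axis_inner_vec w_def[symmetric])
    have "acc G X x \<bullet> (G x *v ?v) = 0"
      using shape_symmetric[OF x fx Xf[OF x fx] v] shape_null[OF x fx, of ?v] by (simp add: shape_X[OF x fx])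
    then have "?v \<bullet> (G x *v acc G X x) = 0" by (simp only: inner_G_commute[OF x, of ?v])
    moreover have "Z x \<bullet> (G x *v acc G X x) = 0" using aZ by (simp only: inner_G_commute[OF x, of "Z x"])
    ultimately show ?thesis by (simp add: inner_diff_left axis_inner_vec)
  qed
  then have "G x *v acc G X x = 0" by (simp add: vec_eq_iff)
  then have "matrix_inv (G x) *v (G x *v acc G X x) = 0" by simp
  then show ?thesis by (simp add: matrix_vector_mul_assoc inv_G(2)[OF x])
qed

text \<open>The acceleration vanishes on the hypersurface only, so its covariant derivative there is
  \<open>df \<otimes> Y\<close> and its divergence \<open>df(Y)\<close>. To see that this is zero,
  \<open>g(acc, X)\<close> is written as half the derivative of \<open>g(X, X)\<close> along
  \<open>X\<close>, a product of two functions both vanishing at \<open>x\<close>.\<close>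

lemma divg_acc:
  assumes x: "x \<in> W" and fx: "f x = 0"
  shows "divg G (acc G X) x = 0"
proof -
  define Y where "Y = (\<chi> j. Z x \<bullet> grad_vec (\<lambda>y. acc G X y $ j) x * inverse (w x))"
  have sa: "smooth_on W (acc G X)" by (rule smooth_acc[OF smooth_X])
  have "pderiv_at i (\<lambda>y. acc G X y $ j) x = grad_vec f x $ i * Y $ j" for i j
    unfolding Y_def vec_lambda_beta
    by (rule derivative_proportional[OF x fx smooth_on_nth[OF open_W sa]]) (simp add: acc0)
  then have covY: "cov G (acc G X) i x = grad_vec f x $ i *\<^sub>R Y" for i
    by (simp add: cov_def vec_eq_iff acc0[OF x fx])
  \<comment> \<open>Half of the derivative of \<open>h * h * q\<close> along \<open>X\<close>,
    divided by \<open>h\<close>. At \<open>x\<close> it vanishes as well, because \<open>h\<close>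
    is zero on the hypersurface and \<open>X\<close> is tangential.\<close>
  define s where "s y = (\<Sum>k\<in>UNIV. X y $ k * (q y * pderiv_at k h y + (1/2) * (h y * pderiv_at k q y)))" for y
  have ss: "smooth_on W s"
    unfolding s_def[abs_def]
    by (rule smooth_on_sum[OF open_W]) (intro smooth_on_mult smooth_on_add open_W smooth_on_nth[OF open_W smooth_X]
        smooth_q smooth_h smooth_on_const smooth_on_pderiv[OF smooth_h] smooth_on_pderiv[OF smooth_q])
  have acX: "acc G X y \<bullet> (G y *v X y) = h y * s y" if y: "y \<in> W" for y
  proof -
    note d = smooth_on_differentiable[OF smooth_h y] smooth_on_differentiable[OF smooth_q y]
    have "2 * (cov G X i y \<bullet> (G y *v X y)) = 2 * (h y * (q y * pderiv_at i h y + (1/2) * (h y * pderiv_at i q y)))" for i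
    proof -
      have "2 * (cov G X i y \<bullet> (G y *v X y)) = pderiv_at i (\<lambda>y. X y \<bullet> (G y *v X y)) y"
        using pderiv_inner[OF y smooth_X smooth_X, of i] inner_G_commute[OF y, of "X y" "cov G X i y"] by simp
      also have "\<dots> = pderiv_at i (\<lambda>y. h y * (h y * q y)) y"
        by (rule pderiv_cong[OF open_W y]) (simp_all add: inner_XX differentiable_mult d)
      also have "\<dots> = 2 * (h y * (q y * pderiv_at i h y + (1/2) * (h y * pderiv_at i q y)))"
        by (simp add: pderiv_mult differentiable_mult d algebra_simps)
      finally show ?thesis .
    qed
    then have "cov G X i y \<bullet> (G y *v X y) = h y * (q y * pderiv_at i h y + (1/2) * (h y * pderiv_at i q y))" for i
      by simp
    then show ?thesis
      by (simp only: acc_def inner_sum_left inner_scaleR_left s_def sum_distrib_left mult.left_commute)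
  qed
  have s0: "s x = 0"
  proof -
    have "s x = q x * (X x \<bullet> grad_vec h x)"
      by (simp add: s_def h0[OF x fx] inner_vec_sum grad_vec_def sum_distrib_left mult_ac)
    then show ?thesis by (simp add: dh[OF x fx])
  qed
  have "grad_vec f x $ i * (Y \<bullet> (G x *v X x)) = 0" for i
  proof -
    note d = smooth_on_differentiable[OF smooth_h x] smooth_on_differentiable[OF ss x]
    have "grad_vec f x $ i * (Y \<bullet> (G x *v X x)) = pderiv_at i (\<lambda>y. acc G X y \<bullet> (G y *v X y)) x"
      by (simp add: pderiv_inner[OF x sa smooth_X] covY acc0[OF x fx])
    also have "\<dots> = pderiv_at i (\<lambda>y. h y * s y) x"
      by (rule pderiv_cong[OF open_W x]) (simp_all add: acX differentiable_mult d)
    also have "\<dots> = 0" by (simp add: pderiv_mult d s0 h0[OF x fx])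
    finally show ?thesis .
  qed
  \<comment> \<open>Contracting with \<open>Z\<close> replaces \<open>df\<close> by the nonzero
    number \<open>w x\<close>, so that it can be cancelled.\<close>
  then have "(\<Sum>i\<in>UNIV. Z x $ i * (grad_vec f x $ i * (Y \<bullet> (G x *v X x)))) = 0"
    by (simp only: mult_zero_right sum.neutral_const)
  then have "w x * (Y \<bullet> (G x *v X x)) = 0"
    by (simp only: w_def inner_vec_sum[of "Z x"] sum_distrib_right mult.assoc)
  then have "Y \<bullet> (G x *v X x) = 0" using w_nz[OF x] by simp
  then have "Y \<bullet> grad_vec f x = 0" by (simp only: orth_grad[OF x fx])
  then show ?thesis by (simp add: divg_def covY inner_vec_sum mult.commute)
qed

text \<open>The optimal constant is \<open>n - 2\<close>, but any positive one suffices for the Riccati argument.\<close>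

lemma raychaudhuri:
  assumes x: "x \<in> W" and fx: "f x = 0"
  shows "(\<Sum>k\<in>UNIV. X x $ k * pderiv_at k (divg G X) x) \<le>
    - (divg G X x)\<^sup>2 / real CARD('n) - (\<Sum>j\<in>UNIV. \<Sum>l\<in>UNIV. chr_ricci G j l x * X x $ j * X x $ l)"
proof -
  let ?A = "\<chi> j i. cov G X i x $ j"
  have A: "shape x = ?A" by (simp add: shape_def[OF x fx])
  have "(trace ?A)\<^sup>2 \<le> real CARD('n) * trace (?A ** ?A)"
    unfolding A[symmetric]
    by (rule lorentz_trace_square[OF lorentz_G[OF x] _ shape_null[OF x fx] _ XX0[OF x fx] X_nonzero[OF x fx]])
       (simp_all add: shape_X[OF x fx] acc0[OF x fx] orth_grad[OF x fx] shape_symmetric[OF x fx])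
  moreover have "trace ?A = divg G X x" by (simp add: trace_def divg_def)
  moreover have "trace (?A ** ?A) = (\<Sum>i\<in>UNIV. \<Sum>k\<in>UNIV. cov G X i x $ k * cov G X k x $ i)"
    by (simp add: trace_def matrix_matrix_mult_def mult.commute)
  ultimately have "(divg G X x)\<^sup>2 / real CARD('n) \<le> (\<Sum>i\<in>UNIV. \<Sum>k\<in>UNIV. cov G X i x $ k * cov G X k x $ i)"
    by (simp add: divide_le_eq mult.commute)
  then show ?thesis
    unfolding bochner[OF x smooth_X] divg_acc[OF x fx] by simp
qed

end

section \<open>The divergence does not depend on the chart\<close>

text \<open>In the contracted Christoffel symbol two of the three derivative terms cancel because
  the inverse metric is symmetric. The remaining form involves only first derivatives of
  \<open>X\<close> and of \<open>G\<close> along \<open>X\<close>, which makes its behaviour under a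
  change of chart computable.\<close>

lemma (in metric_chart) divg_trace:
  assumes x: "x \<in> W"
  shows "divg G X x = trace (\<chi> a i. pderiv_at i (\<lambda>y. X y $ a) x)
    + (1/2) * trace (matrix_inv (G x) ** (\<chi> a b. \<Sum>k\<in>UNIV. X x $ k * pderiv_at k (\<lambda>y. G y $ a $ b) x))"
proof -
  let ?I = "\<lambda>i l. matrix_inv (G x) $ i $ l" and ?dG = "\<lambda>k i j. pderiv_at k (\<lambda>y. G y $ i $ j) x"
  have I: "?I i l = ?I l i" for i l
    using arg_cong[OF inv_G_sym[OF x], of "\<lambda>M. M $ i $ l"] by (simp add: transpose_def)
  have c: "(\<Sum>i\<in>UNIV. chr G i i k x) = (1/2) * (\<Sum>i\<in>UNIV. \<Sum>l\<in>UNIV. ?I i l * ?dG k l i)" for k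
  proof -
    have sw: "(\<Sum>i\<in>UNIV. \<Sum>l\<in>UNIV. ?I i l * ?dG i l k) = (\<Sum>i\<in>UNIV. \<Sum>l\<in>UNIV. ?I i l * ?dG l i k)"
      by (subst sum.swap) (intro sum.cong refl, simp only: I)
    have "(\<Sum>i\<in>UNIV. chr G i i k x) = (1/2) * ((\<Sum>i\<in>UNIV. \<Sum>l\<in>UNIV. ?I i l * ?dG i l k)
        + (\<Sum>i\<in>UNIV. \<Sum>l\<in>UNIV. ?I i l * ?dG k l i) - (\<Sum>i\<in>UNIV. \<Sum>l\<in>UNIV. ?I i l * ?dG l i k))"
      by (simp only: chr_def sum_distrib_left[symmetric] distrib_left right_diff_distrib sum.distrib sum_subtractf)
    then show ?thesis by (simp only: sw) simp
  qed
  have "(\<Sum>i\<in>UNIV. \<Sum>k\<in>UNIV. chr G i i k x * X x $ k) = (\<Sum>k\<in>UNIV. (\<Sum>i\<in>UNIV. chr G i i k x) * X x $ k)"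
    by (subst sum.swap) (simp only: sum_distrib_right)
  also have "\<dots> = (1/2) * (\<Sum>k\<in>UNIV. \<Sum>i\<in>UNIV. \<Sum>l\<in>UNIV. ?I i l * (X x $ k * ?dG k l i))"
    unfolding c by (simp only: sum_distrib_left sum_distrib_right mult_ac)
  also have "(\<Sum>k\<in>UNIV. \<Sum>i\<in>UNIV. \<Sum>l\<in>UNIV. ?I i l * (X x $ k * ?dG k l i))
      = (\<Sum>i\<in>UNIV. \<Sum>l\<in>UNIV. \<Sum>k\<in>UNIV. ?I i l * (X x $ k * ?dG k l i))" by (rule sum_rotate3)
  also have "\<dots> = trace (matrix_inv (G x) ** (\<chi> a b. \<Sum>k\<in>UNIV. X x $ k * ?dG k a b))"
    by (simp add: trace_def matrix_matrix_mult_def sum_distrib_left)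
  finally show ?thesis
    by (simp add: divg_def cov_def sum.distrib trace_def)
qed

lemma matrix_add_rdistrib: "((A :: real^'n^'m) + B) ** C = A ** C + B ** C"
  by (simp add: vec_eq_iff matrix_matrix_mult_def distrib_right sum.distrib)

lemma trace_transpose: "trace (transpose (A :: real^'n^'n)) = trace A"
  by (simp add: trace_def transpose_def)

lemma trace_cyclic3:
  fixes A B C :: "real^'n^'n"
  shows "trace (A ** B ** C) = trace (C ** A ** B)"
  using trace_mul_sym[of "A ** B" C] by (simp only: matrix_mul_assoc)

text \<open>\<open>X'\<close> need only be the image of \<open>X\<close> along the hypersurface. By \<open>E\<close> the derivatives then differ
  by \<open>Y \<otimes> g(X, \<cdot>)\<close>, which is trace free because \<open>H\<close> and \<open>H'\<close> force \<open>g(X, Y) = 0\<close>.\<close>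

lemma divg_invariant:
  fixes \<phi> :: "real^'n \<Rightarrow> real^'n"
  defines "J \<equiv> \<lambda>z. \<chi> a i. pderiv_at i (\<lambda>z. \<phi> z $ a) z"
  assumes m: "metric_chart W G" and m': "metric_chart W' G'"
    and U: "open U" "x \<in> U" "U \<subseteq> W" and \<phi>: "smooth_on U \<phi>" "\<phi> ` U \<subseteq> W'"
    and GJ: "\<And>z. z \<in> U \<Longrightarrow> G z = transpose (J z) ** G' (\<phi> z) ** J z"
    and X: "smooth_on W X" and X': "smooth_on W' X'"
    and eq: "X' (\<phi> x) = J x *v X x"
    and E: "\<And>i a. pderiv_at i (\<lambda>z. X' (\<phi> z) $ a - (J z *v X z) $ a) x = (G x *v X x) $ i * Y $ a"
    and H: "\<And>i. pderiv_at i (\<lambda>y. X y \<bullet> (G y *v X y)) x = 0"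
    and H': "\<And>i. pderiv_at i (\<lambda>y. X' y \<bullet> (G' y *v X' y)) (\<phi> x) = 0"
    and nz: "G x *v X x \<noteq> 0"
  shows "divg G X x = divg G' X' (\<phi> x)"
proof -
  interpret m: metric_chart W G by (rule m)
  interpret m': metric_chart W' G' by (rule m')
  have x: "x \<in> W" and y: "\<phi> x \<in> W'" using U \<phi>(2) by auto
  define K where "K = matrix_inv (J x)"
  have "det (G x) \<noteq> 0" using m.invertible_G[OF x] by (simp add: invertible_det_nz)
  then have "invertible (J x)"
    unfolding GJ[OF U(2)] by (simp add: det_mul invertible_det_nz)
  then have JK: "J x ** K = mat 1" and KJ: "K ** J x = mat 1"
    by (simp_all add: K_def matrix_inv_inverse)
  have d\<phi>: "\<phi> differentiable (at x)" by (rule smooth_on_differentiable[OF \<phi>(1) U(2)])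
  have s\<phi>: "smooth_on U (\<lambda>z. \<phi> z $ a)" for a by (rule smooth_on_nth[OF U(1) \<phi>(1)])
  have sJ: "smooth_on U (\<lambda>z. J z $ a $ i)" for a i
    unfolding J_def by (simp, rule smooth_on_pderiv[OF s\<phi>])
  have sX: "smooth_on U (\<lambda>z. X z $ a)" for a
    by (rule smooth_on_subset[OF smooth_on_nth[OF m.open_W X] U(3)])
  have sX\<phi>: "smooth_on U (\<lambda>z. X' (\<phi> z))"
    by (rule smooth_on_compose[OF U(1) \<phi>(2) \<phi>(1) X'])
  have sG\<phi>: "smooth_on U (\<lambda>z. G' (\<phi> z) $ a $ b)" for a b
    by (rule smooth_on_compose[OF U(1) \<phi>(2) \<phi>(1) m'.smooth_G])
  have sJX: "smooth_on U (\<lambda>z. J z *v X z)"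
  proof (rule smooth_on_vecI[OF U(1)])
    show "smooth_on U (\<lambda>z. (J z *v X z) $ a)" for a
      unfolding matrix_vector_mult_def vec_lambda_beta
      by (rule smooth_on_sum[OF U(1) smooth_on_mult[OF U(1) sJ sX]])
  qed
  note d = smooth_on_differentiable[OF _ U(2)]
  define DJ where "DJ = (\<chi> a i. \<Sum>k\<in>UNIV. X x $ k * pderiv_at k (\<lambda>z. J z $ a $ i) x)"
  define DX where "DX = (\<chi> a i. pderiv_at i (\<lambda>y. X y $ a) x)"
  define DX' where "DX' = (\<chi> a i. pderiv_at i (\<lambda>y. X' y $ a) (\<phi> x))"
  define DG where "DG = (\<chi> a b. \<Sum>k\<in>UNIV. X x $ k * pderiv_at k (\<lambda>y. G y $ a $ b) x)"
  define DG' where "DG' = (\<chi> a b. \<Sum>k\<in>UNIV. X' (\<phi> x) $ k * pderiv_at k (\<lambda>y. G' y $ a $ b) (\<phi> x))"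
  have chain: "pderiv_at i (\<lambda>z. u (\<phi> z)) x = (\<Sum>c\<in>UNIV. J x $ c $ i * pderiv_at c u (\<phi> x))"
    if "u differentiable (at (\<phi> x))" for i and u :: "real^'n \<Rightarrow> real"
    using pderiv_compose[OF d\<phi> that] by (simp add: J_def)
  \<comment> \<open>The product rule for \<open>G = J^T (G' o \<phi>) J\<close> along
    \<open>X\<close>. The middle factor contributes the derivative of \<open>G'\<close> along
    \<open>X'\<close>, because \<open>J\<close> maps \<open>X\<close> to \<open>X'\<close> at this
    point.\<close>
  have DGe: "DG = transpose DJ ** G' (\<phi> x) ** J x + transpose (J x) ** DG' ** J x + transpose (J x) ** G' (\<phi> x) ** DJ"
  proof -
    have G': "(\<Sum>k\<in>UNIV. X x $ k * pderiv_at k (\<lambda>z. G' (\<phi> z) $ c $ e) x) = DG' $ c $ e" for c e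
    proof -
      have "(\<Sum>k\<in>UNIV. X x $ k * pderiv_at k (\<lambda>z. G' (\<phi> z) $ c $ e) x)
         = (\<Sum>k\<in>UNIV. \<Sum>b\<in>UNIV. J x $ b $ k * X x $ k * pderiv_at b (\<lambda>y. G' y $ c $ e) (\<phi> x))"
        by (simp add: chain[OF smooth_on_differentiable[OF m'.smooth_G y]] sum_distrib_left mult_ac)
      also have "\<dots> = (\<Sum>b\<in>UNIV. (\<Sum>k\<in>UNIV. J x $ b $ k * X x $ k) * pderiv_at b (\<lambda>y. G' y $ c $ e) (\<phi> x))"
        by (subst sum.swap) (simp only: sum_distrib_right)
      finally show ?thesis by (simp add: DG'_def eq matrix_vector_mult_def)
    qed
    have "DG $ a $ b = (\<Sum>c\<in>UNIV. \<Sum>e\<in>UNIV. DJ $ e $ a * G' (\<phi> x) $ e $ c * J x $ c $ b)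
        + (\<Sum>c\<in>UNIV. \<Sum>e\<in>UNIV. J x $ e $ a * DG' $ e $ c * J x $ c $ b)
        + (\<Sum>c\<in>UNIV. \<Sum>e\<in>UNIV. J x $ e $ a * G' (\<phi> x) $ e $ c * DJ $ c $ b)" for a b
    proof -
      have Gz: "G z $ a $ b = (\<Sum>c\<in>UNIV. \<Sum>e\<in>UNIV. J z $ e $ a * G' (\<phi> z) $ e $ c * J z $ c $ b)" if "z \<in> U" for z
        by (simp add: GJ[OF that] matrix_matrix_mult_def transpose_def sum_distrib_right)
      have "pderiv_at k (\<lambda>y. G y $ a $ b) x = (\<Sum>c\<in>UNIV. \<Sum>e\<in>UNIV.
          pderiv_at k (\<lambda>z. J z $ e $ a) x * G' (\<phi> x) $ e $ c * J x $ c $ b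
          + J x $ e $ a * pderiv_at k (\<lambda>z. G' (\<phi> z) $ e $ c) x * J x $ c $ b
          + J x $ e $ a * G' (\<phi> x) $ e $ c * pderiv_at k (\<lambda>z. J z $ c $ b) x)" for k
      proof -
        have "pderiv_at k (\<lambda>y. G y $ a $ b) x
            = pderiv_at k (\<lambda>z. \<Sum>c\<in>UNIV. \<Sum>e\<in>UNIV. J z $ e $ a * G' (\<phi> z) $ e $ c * J z $ c $ b) x"
          by (rule pderiv_cong[OF U(1,2)])
             (simp_all add: Gz d[OF sJ] d[OF sG\<phi>] differentiable_mult)
        also have "\<dots> = (\<Sum>c\<in>UNIV. \<Sum>e\<in>UNIV.
          pderiv_at k (\<lambda>z. J z $ e $ a) x * G' (\<phi> x) $ e $ c * J x $ c $ b
          + J x $ e $ a * pderiv_at k (\<lambda>z. G' (\<phi> z) $ e $ c) x * J x $ c $ b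
          + J x $ e $ a * G' (\<phi> x) $ e $ c * pderiv_at k (\<lambda>z. J z $ c $ b) x)"
          by (simp add: pderiv_sum pderiv_mult d[OF sJ] d[OF sG\<phi>] differentiable_mult distrib_right)
        finally show ?thesis .
      qed
      then have "DG $ a $ b = (\<Sum>k\<in>UNIV. \<Sum>c\<in>UNIV. \<Sum>e\<in>UNIV.
          (X x $ k * pderiv_at k (\<lambda>z. J z $ e $ a) x) * G' (\<phi> x) $ e $ c * J x $ c $ b
          + J x $ e $ a * (X x $ k * pderiv_at k (\<lambda>z. G' (\<phi> z) $ e $ c) x) * J x $ c $ b
          + J x $ e $ a * G' (\<phi> x) $ e $ c * (X x $ k * pderiv_at k (\<lambda>z. J z $ c $ b) x))"
        by (simp add: DG_def sum_distrib_left distrib_left mult_ac)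
      also have "\<dots> = (\<Sum>c\<in>UNIV. \<Sum>e\<in>UNIV. DJ $ e $ a * G' (\<phi> x) $ e $ c * J x $ c $ b
          + J x $ e $ a * DG' $ e $ c * J x $ c $ b + J x $ e $ a * G' (\<phi> x) $ e $ c * DJ $ c $ b)"
        unfolding G'[symmetric] DJ_def vec_lambda_beta
        by (subst sum_rotate3) (simp only: sum.distrib sum_distrib_left[symmetric] sum_distrib_right[symmetric])
      finally show ?thesis by (simp only: sum.distrib)
    qed
    then show ?thesis
      by (simp add: vec_eq_iff matrix_matrix_mult_def transpose_def sum_distrib_right)
  qed
  have inv: "matrix_inv (G x) = K ** matrix_inv (G' (\<phi> x)) ** transpose K"
  proof -
    have tK: "transpose K ** transpose (J x) = mat 1"
      using arg_cong[OF JK, of transpose] by (simp add: matrix_transpose_mul)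
    have "(K ** matrix_inv (G' (\<phi> x)) ** transpose K) ** G x
       = K ** matrix_inv (G' (\<phi> x)) ** (transpose K ** transpose (J x)) ** G' (\<phi> x) ** J x"
      unfolding GJ[OF U(2)] by (simp only: matrix_mul_assoc)
    also have "\<dots> = K ** (matrix_inv (G' (\<phi> x)) ** G' (\<phi> x)) ** J x"
      unfolding tK by (simp only: matrix_mul_assoc matrix_mul_rid)
    also have "\<dots> = mat 1" by (simp add: m'.inv_G[OF y] KJ)
    finally have 1: "(K ** matrix_inv (G' (\<phi> x)) ** transpose K) ** G x = mat 1" .
    have "(K ** matrix_inv (G' (\<phi> x)) ** transpose K) ** (G x ** matrix_inv (G x)) = matrix_inv (G x)"
      unfolding matrix_mul_assoc[of _ "G x"] 1 by simp
    then show ?thesis by (simp add: m.inv_G[OF x])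
  qed
  \<comment> \<open>Differentiating the two Jacobian factors contributes
    \<open>2 * trace (K ** DJ)\<close>. With the factor 1/2 of \<open>divg_trace\<close> this
    matches the term \<open>trace (K ** DJ)\<close> by which \<open>trace DX'\<close> exceeds
    \<open>trace DX\<close>.\<close>
  have trG: "trace (matrix_inv (G x) ** DG) = 2 * trace (K ** DJ) + trace (matrix_inv (G' (\<phi> x)) ** DG')"
  proof -
    let ?I = "matrix_inv (G' (\<phi> x))" and ?G = "G' (\<phi> x)"
    have tK: "transpose K ** transpose (J x) = mat 1"
      using arg_cong[OF JK, of transpose] by (simp add: matrix_transpose_mul)
    have 1: "trace (K ** ?I ** transpose K ** (transpose DJ ** ?G ** J x)) = trace (K ** DJ)"
    proof -
      have "trace (K ** ?I ** transpose K ** (transpose DJ ** ?G ** J x))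
          = trace ((K ** ?I) ** (transpose K ** transpose DJ ** ?G ** J x))" by (simp only: matrix_mul_assoc)
      also have "\<dots> = trace ((transpose K ** transpose DJ ** ?G) ** (J x ** K) ** ?I)"
        by (subst trace_mul_sym) (simp only: matrix_mul_assoc)
      also have "\<dots> = trace (transpose K ** transpose DJ ** (?G ** ?I))"
        unfolding JK by (simp only: matrix_mul_assoc matrix_mul_rid)
      also have "\<dots> = trace (transpose (DJ ** K))"
        by (simp add: m'.inv_G[OF y] matrix_transpose_mul)
      finally show ?thesis by (simp only: trace_transpose trace_mul_sym[of DJ])
    qed
    have 2: "trace (K ** ?I ** transpose K ** (transpose (J x) ** DG' ** J x)) = trace (?I ** DG')"
    proof -
      have "trace (K ** ?I ** transpose K ** (transpose (J x) ** DG' ** J x))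
         = trace (K ** (?I ** (transpose K ** transpose (J x)) ** DG' ** J x))" by (simp only: matrix_mul_assoc)
      also have "\<dots> = trace ((?I ** DG') ** (J x ** K))"
        unfolding tK by (subst trace_mul_sym) (simp only: matrix_mul_assoc matrix_mul_rid)
      finally show ?thesis by (simp add: JK)
    qed
    have 3: "trace (K ** ?I ** transpose K ** (transpose (J x) ** ?G ** DJ)) = trace (K ** DJ)"
    proof -
      have "K ** ?I ** transpose K ** (transpose (J x) ** ?G ** DJ)
         = K ** (?I ** (transpose K ** transpose (J x)) ** ?G) ** DJ" by (simp only: matrix_mul_assoc)
      then show ?thesis unfolding tK by (simp add: m'.inv_G[OF y])
    qed
    show ?thesis
      unfolding inv DGe matrix_add_ldistrib trace_add 1 2 3 by simp
  qed
  \<comment> \<open>The derivative of \<open>J X\<close>, corrected by \<open>E\<close>. Symmetry of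
    the second derivatives of \<phi> turns the derivative of \<open>J\<close> in direction
    \<open>i\<close>, applied to \<open>X\<close>, into the derivative of \<open>J\<close> along
    \<open>X\<close>.\<close>
  have DXe: "DX' ** J x = DJ + J x ** DX + outer Y (G x *v X x)"
  proof -
    have "(\<Sum>c\<in>UNIV. J x $ c $ i * DX' $ a $ c) = DJ $ a $ i + (\<Sum>b\<in>UNIV. J x $ a $ b * DX $ b $ i) + Y $ a * (G x *v X x) $ i" for a i
    proof -
      have "pderiv_at i (\<lambda>z. X' (\<phi> z) $ a) x = (\<Sum>c\<in>UNIV. J x $ c $ i * DX' $ a $ c)"
        using chain[OF smooth_on_differentiable[OF smooth_on_nth[OF m'.open_W X'] y]] by (simp add: DX'_def)
      moreover have "pderiv_at i (\<lambda>z. (J z *v X z) $ a) x = DJ $ a $ i + (\<Sum>b\<in>UNIV. J x $ a $ b * DX $ b $ i)"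
      proof -
        have c: "pderiv_at i (\<lambda>z. J z $ a $ b) x = pderiv_at b (\<lambda>z. J z $ a $ i) x" for b
          unfolding J_def vec_lambda_beta by (rule pderiv_commute[OF U(1) s\<phi> U(2)])
        have "pderiv_at i (\<lambda>z. \<Sum>b\<in>UNIV. J z $ a $ b * X z $ b) x
           = (\<Sum>b\<in>UNIV. pderiv_at i (\<lambda>z. J z $ a $ b) x * X x $ b + J x $ a $ b * pderiv_at i (\<lambda>z. X z $ b) x)"
          by (simp add: pderiv_sum pderiv_mult d[OF sJ] d[OF sX] differentiable_mult)
        then show ?thesis
          unfolding c by (simp add: matrix_vector_mult_def DJ_def DX_def sum.distrib mult.commute)
      qed
      moreover have "pderiv_at i (\<lambda>z. X' (\<phi> z) $ a - (J z *v X z) $ a) x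
          = pderiv_at i (\<lambda>z. X' (\<phi> z) $ a) x - pderiv_at i (\<lambda>z. (J z *v X z) $ a) x"
        by (intro pderiv_diff d smooth_on_nth U(1) sX\<phi> sJX)
      ultimately show ?thesis using E[of i a] by (simp add: mult.commute)
    qed
    then show ?thesis
      by (simp add: vec_eq_iff matrix_matrix_mult_def outer_def mult.commute)
  qed
  \<comment> \<open>The squared lengths of \<open>X' o \<phi>\<close> and of \<open>J X\<close> both
    have zero differential at \<open>x\<close> by \<open>H'\<close> and \<open>H\<close>.
    Subtracting the two product rules leaves \<open>2 (G X)_i g'(Y, X') = 0\<close> for every
    \<open>i\<close>, and some \<open>(G X)_i\<close> is nonzero.\<close>
  have YX: "Y \<bullet> (G' (\<phi> x) *v X' (\<phi> x)) = 0"
  proof -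
    let ?P = "\<lambda>z. X' (\<phi> z)" and ?Q = "\<lambda>z. J z *v X z" and ?G = "\<lambda>z. G' (\<phi> z)"
    have sP: "smooth_on U (\<lambda>z. ?P z $ a)" "smooth_on U (\<lambda>z. ?Q z $ a)" for a
      by (intro smooth_on_nth U(1) sX\<phi> sJX)+
    have P: "pderiv_at i (\<lambda>z. ?P z \<bullet> (?G z *v ?P z)) x = 0" for i
    proof -
      have "(\<lambda>y. X' y \<bullet> (G' y *v X' y)) differentiable (at (\<phi> x))"
        unfolding inner_vec_sum matrix_vector_mult_def vec_lambda_beta
        by (intro differentiable_sum differentiable_mult ballI finite_class.finite_UNIV
            smooth_on_differentiable[OF smooth_on_nth[OF m'.open_W X'] y] smooth_on_differentiable[OF m'.smooth_G y])
      from chain[OF this] show ?thesis by (simp add: H')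
    qed
    have Q: "pderiv_at i (\<lambda>z. ?Q z \<bullet> (?G z *v ?Q z)) x = 0" for i
    proof -
      have "X z \<bullet> (G z *v X z) = ?Q z \<bullet> (?G z *v ?Q z)" if "z \<in> U" for z
        by (simp add: GJ[OF that] matrix_vector_mul_assoc[symmetric] matrix_inner_transpose[of "J z"])
      then have "pderiv_at i (\<lambda>z. ?Q z \<bullet> (?G z *v ?Q z)) x = pderiv_at i (\<lambda>y. X y \<bullet> (G y *v X y)) x"
      proof (rule pderiv_cong[OF U(1,2)])
        show "(\<lambda>y. X y \<bullet> (G y *v X y)) differentiable (at x)"
          unfolding inner_vec_sum matrix_vector_mult_def vec_lambda_beta
          by (intro differentiable_sum differentiable_mult ballI finite_class.finite_UNIV
              d[OF sX] smooth_on_differentiable[OF m.smooth_G x])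
      qed
      then show ?thesis by (simp add: H)
    qed
    have e: "(\<chi> a. pderiv_at i (\<lambda>z. ?P z $ a) x) - (\<chi> a. pderiv_at i (\<lambda>z. ?Q z $ a) x) = (G x *v X x) $ i *\<^sub>R Y" for i
      using E[of i] pderiv_diff[OF d[OF sP(1)] d[OF sP(2)], of i] by (simp add: vec_eq_iff)
    have "2 * ((G x *v X x) $ i * (Y \<bullet> (G' (\<phi> x) *v X' (\<phi> x)))) = 0" for i
    proof -
      let ?p = "\<chi> a. pderiv_at i (\<lambda>z. ?P z $ a) x" and ?q = "\<chi> a. pderiv_at i (\<lambda>z. ?Q z $ a) x"
      let ?v = "?G x *v X' (\<phi> x)"
      have s: "X' (\<phi> x) \<bullet> (?G x *v u) = u \<bullet> ?v" for u by (rule m'.inner_G_commute[OF y])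
      have "?p \<bullet> ?v + X' (\<phi> x) \<bullet> ((\<chi> j k. pderiv_at i (\<lambda>y. ?G y $ j $ k) x) *v X' (\<phi> x)) + ?p \<bullet> ?v = 0"
        using P[of i] by (simp add: pderiv_bilinear[OF d[OF sP(1)] d[OF sP(1)] d[OF sG\<phi>]] s)
      moreover have "?q \<bullet> ?v + X' (\<phi> x) \<bullet> ((\<chi> j k. pderiv_at i (\<lambda>y. ?G y $ j $ k) x) *v X' (\<phi> x)) + ?q \<bullet> ?v = 0"
        using Q[of i] by (simp add: pderiv_bilinear[OF d[OF sP(2)] d[OF sP(2)] d[OF sG\<phi>]] s eq[symmetric])
      ultimately have "2 * ((?p - ?q) \<bullet> ?v) = 0" by (simp add: inner_diff_left)
      then show ?thesis by (simp only: e inner_scaleR_left)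
    qed
    then have "(G x *v X x) $ i = 0 \<or> Y \<bullet> (G' (\<phi> x) *v X' (\<phi> x)) = 0" for i by simp
    then show ?thesis using nz by (auto simp: vec_eq_iff)
  qed
  have "trace (outer Y (G x *v X x) ** K) = 0"
  proof -
    have "transpose K *v (G x *v X x) = G' (\<phi> x) *v X' (\<phi> x)"
    proof -
      have "transpose K *v (G x *v X x) = (transpose K ** transpose (J x)) *v (G' (\<phi> x) *v (J x *v X x))"
        unfolding GJ[OF U(2)] by (simp only: matrix_vector_mul_assoc matrix_mul_assoc)
      moreover have "transpose K ** transpose (J x) = mat 1"
        using arg_cong[OF JK, of transpose] by (simp add: matrix_transpose_mul)
      ultimately show ?thesis by (simp add: eq)
    qed
    then show ?thesis by (simp add: outer_mult_right trace_outer YX)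
  qed
  moreover have "DX' = DJ ** K + J x ** DX ** K + outer Y (G x *v X x) ** K"
  proof -
    have "DX' ** (J x ** K) = (DJ + J x ** DX + outer Y (G x *v X x)) ** K"
      by (simp only: matrix_mul_assoc DXe)
    then show ?thesis by (simp add: JK matrix_add_rdistrib)
  qed
  moreover have "trace (J x ** DX ** K) = trace DX"
    by (simp add: trace_cyclic3 KJ)
  ultimately have "trace DX' = trace (K ** DJ) + trace DX"
    by (simp add: trace_add trace_mul_sym[of DJ K])
  then show ?thesis
    unfolding m.divg_trace[OF x] m'.divg_trace[OF y]
      DX_def[symmetric] DX'_def[symmetric] DG_def[symmetric] DG'_def[symmetric] trG by simp
qed

section \<open>Ordinary differential equations\<close>

text \<open>Smoothness gives continuity of the derivative in each fixed direction. Bounding it on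
  the compact ball along the finitely many basis vectors bounds its operator norm.\<close>

lemma smooth_lipschitz_cball:
  fixes F :: "'a::euclidean_space \<Rightarrow> 'b::real_normed_vector"
  assumes "smooth_on U F" "cball x r \<subseteq> U"
  shows "\<exists>B\<ge>0. B-lipschitz_on (cball x r) F"
proof -
  have "\<exists>B. \<forall>y\<in>cball x r. norm (frechet_derivative F (at y) b) \<le> B" for b
  proof -
    have "continuous_on (cball x r) (\<lambda>y. frechet_derivative F (at y) b)"
      using continuous_on_subset[OF smooth_on_continuous_on[OF smooth_on_frechet[OF assms(1)]] assms(2)] .
    then have "bounded ((\<lambda>y. frechet_derivative F (at y) b) ` cball x r)"
      by (intro compact_imp_bounded compact_continuous_image compact_cball)
    then show ?thesis unfolding bounded_iff by blast
  qed
  then obtain B where B: "\<And>b y. y \<in> cball x r \<Longrightarrow> norm (frechet_derivative F (at y) b) \<le> B b" by metis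
  define C where "C = (\<Sum>b\<in>Basis. \<bar>B b\<bar>)"
  have C0: "C \<ge> 0" unfolding C_def by (intro sum_nonneg) simp
  have "C-lipschitz_on (cball x r) F"
  proof (rule lipschitz_onI[OF _ C0])
    fix y z assume yz: "y \<in> cball x r" "z \<in> cball x r"
    have D: "(F has_derivative frechet_derivative F (at p)) (at p)" if "p \<in> cball x r" for p
      by (rule smooth_on_has_derivative[OF assms(1)]) (use that assms(2) in blast)
    have "norm (F y - F z) \<le> C * norm (y - z)"
    proof (rule differentiable_bound[OF convex_cball has_derivative_at_withinI[OF D] _ yz])
      fix p assume p: "p \<in> cball x r"
      show "onorm (frechet_derivative F (at p)) \<le> C"
      proof (rule onorm_le)
        fix v
        have "frechet_derivative F (at p) v = (\<Sum>b\<in>Basis. (v \<bullet> b) *\<^sub>R frechet_derivative F (at p) b)"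
          using linear_euclidean_expansion[OF has_derivative_linear[OF D[OF p]], of v] by simp
        also have "norm \<dots> \<le> (\<Sum>b\<in>Basis. norm v * \<bar>B b\<bar>)"
        proof (rule sum_norm_le)
          fix b :: 'a assume b: "b \<in> Basis"
          have "norm (frechet_derivative F (at p) b) \<le> \<bar>B b\<bar>" using B[OF p, of b] by linarith
          then show "norm ((v \<bullet> b) *\<^sub>R frechet_derivative F (at p) b) \<le> norm v * \<bar>B b\<bar>"
            using Basis_le_norm[OF b, of v] by (simp add: mult_mono)
        qed
        finally show "norm (frechet_derivative F (at p) v) \<le> C * norm v"
          by (simp add: C_def sum_distrib_left mult.commute)
      qed
    qed
    then show "dist (F y) (F z) \<le> C * dist y z" by (simp add: dist_norm)
  qed
  then show ?thesis using C0 by blast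
qed

lemma picard_global:
  fixes F :: "'a::euclidean_space \<Rightarrow> 'a"
  assumes F: "B-lipschitz_on UNIV F"
  shows "\<exists>e>0. \<exists>y. y 0 = x0 \<and> (\<forall>t\<in>{-e<..<e}. (y has_vector_derivative F (y t)) (at t))"
proof -
  have B: "B \<ge> 0" by (rule lipschitz_on_nonneg[OF F])
  \<comment> \<open>The integral operator compares values at \<open>c t\<close> and at
    \<open>0\<close>, each contributing at most \<open>2 * e * B\<close> times the distance. This
    choice makes the sum at most 1/2, and \<open>B + 1\<close> covers \<open>B = 0\<close>.\<close>
  define e where "e = 1 / (8 * (B + 1))"
  have e: "e > 0" "4 * e * B \<le> 1/2" using B by (auto simp: e_def field_simps)
  have Fc: "continuous_on UNIV F" by (rule lipschitz_on_continuous_on[OF F])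
  \<comment> \<open>Clamping time to \<open>{-e..e}\<close> lets the operator act on bounded
    continuous functions on the whole line, a complete metric space to which Banach's theorem
    applies.\<close>
  define c where "c t = max (-e) (min e t)" for t :: real
  have c: "c t \<in> {-e..e}" for t using e by (auto simp: c_def)
  have cc: "continuous_on UNIV c" unfolding c_def by (intro continuous_intros)
  \<comment> \<open>The integral starts at \<open>-e\<close> so that its bounds are always in order;
    the initial time is restored by subtracting the value at \<open>0\<close>.\<close>
  define I where "I \<phi> s = integral {-e..s} (\<lambda>t. F (apply_bcontfun \<phi> t))" for \<phi> :: "real \<Rightarrow>\<^sub>C 'a" and s
  have Fphi: "continuous_on S (\<lambda>t. F (apply_bcontfun \<phi> t))" for \<phi> :: "real \<Rightarrow>\<^sub>C 'a" and S
    by (rule continuous_on_compose2[OF Fc]) auto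
  have int: "(\<lambda>t. F (apply_bcontfun \<phi> t)) integrable_on {a..b}" for \<phi> :: "real \<Rightarrow>\<^sub>C 'a" and a b
    by (rule integrable_continuous_interval[OF Fphi])
  have Ic: "continuous_on {-e..e} (I \<phi>)" for \<phi>
    unfolding I_def by (rule indefinite_integral_continuous_1[OF int])
  define T where "T \<phi> t = x0 + (I \<phi> (c t) - I \<phi> 0)" for \<phi> t
  have Tb: "T \<phi> \<in> bcontfun" for \<phi>
  proof -
    have "continuous_on UNIV (\<lambda>t. I \<phi> (c t))"
      by (rule continuous_on_compose2[OF Ic cc]) (use c in auto)
    moreover have "bounded (range (T \<phi>))"
    proof -
      have "compact ((\<lambda>s. x0 + (I \<phi> s - I \<phi> 0)) ` {-e..e})"
        by (intro compact_continuous_image continuous_intros Ic) simp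
      then have "bounded ((\<lambda>s. x0 + (I \<phi> s - I \<phi> 0)) ` {-e..e})" by (rule compact_imp_bounded)
      moreover have "range (T \<phi>) \<subseteq> (\<lambda>s. x0 + (I \<phi> s - I \<phi> 0)) ` {-e..e}" using c by (auto simp: T_def)
      ultimately show ?thesis by (rule bounded_subset)
    qed
    ultimately show ?thesis unfolding bcontfun_def T_def by (auto intro!: continuous_intros)
  qed
  have Id: "norm (I \<phi> s - I \<psi> s) \<le> 2 * e * (B * dist \<phi> \<psi>)" if "s \<in> {-e..e}" for \<phi> \<psi> s
  proof -
    have "I \<phi> s - I \<psi> s = integral {-e..s} (\<lambda>t. F (apply_bcontfun \<phi> t) - F (apply_bcontfun \<psi> t))"
      unfolding I_def by (rule integral_diff[OF int int, symmetric])
    also have "norm \<dots> \<le> (B * dist \<phi> \<psi>) * (s - (-e))"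
    proof (rule integral_bound)
      show "norm (F (apply_bcontfun \<phi> t) - F (apply_bcontfun \<psi> t)) \<le> B * dist \<phi> \<psi>" for t
      proof -
        have "dist (F (apply_bcontfun \<phi> t)) (F (apply_bcontfun \<psi> t)) \<le> B * dist (apply_bcontfun \<phi> t) (apply_bcontfun \<psi> t)"
          by (rule lipschitz_onD[OF F]) auto
        also have "\<dots> \<le> B * dist \<phi> \<psi>" by (rule mult_left_mono[OF dist_bounded B])
        finally show ?thesis by (simp add: dist_norm)
      qed
      show "continuous_on {-e..s} (\<lambda>t. F (apply_bcontfun \<phi> t) - F (apply_bcontfun \<psi> t))"
        by (intro continuous_on_diff Fphi)
    qed (use that in auto)
    also have "\<dots> \<le> (B * dist \<phi> \<psi>) * (2 * e)"
      by (rule mult_left_mono) (use that B in auto)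
    finally show ?thesis by (simp add: mult_ac)
  qed
  have "dist (Bcontfun (T \<phi>)) (Bcontfun (T \<psi>)) \<le> (1/2) * dist \<phi> \<psi>" for \<phi> \<psi>
  proof (rule dist_bound)
    fix t
    have "dist (T \<phi> t) (T \<psi> t) = norm ((I \<phi> (c t) - I \<psi> (c t)) - (I \<phi> 0 - I \<psi> 0))"
      by (simp add: T_def dist_norm algebra_simps)
    also have "\<dots> \<le> 2 * e * (B * dist \<phi> \<psi>) + 2 * e * (B * dist \<phi> \<psi>)"
      by (rule order_trans[OF norm_triangle_ineq4 add_mono[OF Id[OF c] Id]]) (use e(1) in simp)
    also have "\<dots> = (4 * e * B) * dist \<phi> \<psi>" by (simp add: algebra_simps)
    also have "\<dots> \<le> (1/2) * dist \<phi> \<psi>" by (rule mult_right_mono[OF e(2)]) simp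
    finally show "dist (apply_bcontfun (Bcontfun (T \<phi>)) t) (apply_bcontfun (Bcontfun (T \<psi>)) t) \<le> (1/2) * dist \<phi> \<psi>"
      by (simp add: Bcontfun_inverse Tb)
  qed
  then have "\<exists>!\<phi>. Bcontfun (T \<phi>) = \<phi>"
    by (intro banach_fix_type[of "1/2"]) auto
  then obtain \<phi> where "Bcontfun (T \<phi>) = \<phi>" by blast
  then have fixp: "T \<phi> t = apply_bcontfun \<phi> t" for t
    using Bcontfun_inverse[OF Tb[of \<phi>]] by metis
  define y where "y = apply_bcontfun \<phi>"
  have "y 0 = x0" using fixp[of 0] e by (simp add: y_def T_def c_def)
  moreover have "(y has_vector_derivative F (y t)) (at t)" if t: "t \<in> {-e<..<e}" for t
  proof -
    have "(I \<phi> has_vector_derivative F (y t)) (at t within {-e..e})"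
      unfolding I_def y_def
      by (rule integral_has_vector_derivative[OF Fphi]) (use t in auto)
    then have "(I \<phi> has_vector_derivative F (y t)) (at t)"
      using at_within_interior[of t "{-e..e}"] t by simp
    then have "((\<lambda>s. x0 + (I \<phi> s - I \<phi> 0)) has_vector_derivative F (y t)) (at t)"
      by (auto intro!: derivative_eq_intros)
    then show ?thesis
    proof (rule has_vector_derivative_transform_within_open[where S="{-e<..<e}"])
      show "x0 + (I \<phi> s - I \<phi> 0) = y s" if "s \<in> {-e<..<e}" for s
        using fixp[of s] that by (simp add: T_def c_def y_def)
    qed (use t in auto)
  qed
  ultimately show ?thesis using e(1) by blast
qed

text \<open>Precomposing with the closest-point projection onto a small ball makes the field
  globally Lipschitz without changing it on the ball, where the solution stays for a short
  time.\<close>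

lemma picard_local:
  fixes F :: "'a::euclidean_space \<Rightarrow> 'a"
  assumes "open U" "x0 \<in> U" "smooth_on U F"
  shows "\<exists>e>0. \<exists>y. y 0 = x0 \<and> (\<forall>t\<in>{-e<..<e}. y t \<in> U \<and> (y has_vector_derivative F (y t)) (at t))"
proof -
  obtain r where r: "r > 0" "cball x0 r \<subseteq> U" using assms(1,2) open_contains_cball by blast
  obtain B where B: "B-lipschitz_on (cball x0 r) F" using smooth_lipschitz_cball[OF assms(3) r(2)] by blast
  let ?\<pi> = "closest_point (cball x0 r)"
  have ne: "cball x0 r \<noteq> {}" using r(1) by simp
  have "1-lipschitz_on UNIV ?\<pi>"
    by (rule lipschitz_onI) (simp_all add: closest_point_lipschitz[OF convex_cball closed_cball ne])
  moreover have "range ?\<pi> \<subseteq> cball x0 r" using closest_point_in_set[OF closed_cball ne] by blast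
  ultimately have "(B * 1)-lipschitz_on UNIV (F \<circ> ?\<pi>)"
    by (intro lipschitz_on_compose lipschitz_on_subset[OF B])
  from picard_global[OF this] obtain e y where e: "e > 0" and y: "y 0 = x0"
    and dy: "\<And>t. t \<in> {-e<..<e} \<Longrightarrow> (y has_vector_derivative (F \<circ> ?\<pi>) (y t)) (at t)" by blast
  have "isCont y 0" using dy[of 0] e by (auto intro: has_vector_derivative_continuous)
  then obtain d where d: "d > 0" "\<And>t. dist t 0 < d \<Longrightarrow> dist (y t) (y 0) < r"
    using r(1) unfolding continuous_at_eps_delta by metis
  have "y t \<in> U \<and> (y has_vector_derivative F (y t)) (at t)" if t: "t \<in> {- min d e<..<min d e}" for t
  proof -
    have "dist t 0 < d" using t by (auto simp: dist_real_def abs_if)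
    then have "y t \<in> cball x0 r" using d(2)[of t] y by (simp add: dist_commute)
    moreover have "t \<in> {-e<..<e}" using t by auto
    ultimately show ?thesis using dy[of t] r(2) by (auto simp: closest_point_self)
  qed
  moreover have "min d e > 0" using d e by simp
  ultimately show ?thesis using y by blast
qed

section \<open>The Riccati inequality on the whole line\<close>

text \<open>A negative value stays negative, and then the inverse of \<theta> increases at rate at
  least \<open>1 / n\<close>, so it would reach 0 in finite time.\<close>

lemma riccati_negative:
  fixes \<theta> :: "real \<Rightarrow> real"
  assumes n: "n > 0" and d: "\<And>t. (\<theta> has_real_derivative \<theta>' t) (at t)"
    and le: "\<And>t. \<theta>' t \<le> - (\<theta> t)\<^sup>2 / n"
  shows "\<theta> a \<ge> 0"
proof (rule ccontr)
  assume "\<not> \<theta> a \<ge> 0"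
  then have neg: "\<theta> a < 0" by simp
  have lt: "\<theta> t < 0" if "a \<le> t" for t
  proof -
    have "\<theta> t \<le> \<theta> a"
    proof (rule DERIV_nonpos_imp_nonincreasing[OF that])
      fix s
      have "\<theta>' s \<le> 0" using order_trans[OF le[of s], of 0] n by simp
      then show "\<exists>y. DERIV \<theta> s :> y \<and> y \<le> 0" using d by blast
    qed
    then show ?thesis using neg by simp
  qed
  \<comment> \<open>By this time the inverse of \<theta>, starting from its value at
    \<open>a\<close>, has grown by at least its initial absolute value, although it must still be
    negative.\<close>
  define b where "b = a + n * \<bar>inverse (\<theta> a)\<bar>"
  have ab: "a \<le> b" using n by (simp add: b_def)
  have "inverse (\<theta> a) - a / n \<le> inverse (\<theta> b) - b / n"
  proof (rule DERIV_nonneg_imp_nondecreasing[OF ab])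
    fix t assume t: "a \<le> t" "t \<le> b"
    have nz: "\<theta> t \<noteq> 0" using lt[OF t(1)] by simp
    have "((\<lambda>t. inverse (\<theta> t) - t / n) has_real_derivative (- (inverse (\<theta> t) * \<theta>' t * inverse (\<theta> t)) - 1 / n)) (at t)"
      using n by (auto intro!: derivative_eq_intros d nz)
    moreover have "1 / n \<le> - (inverse (\<theta> t) * \<theta>' t * inverse (\<theta> t))"
    proof -
      have "(\<theta> t)\<^sup>2 / n \<le> - \<theta>' t" using le[of t] by simp
      then have "(\<theta> t)\<^sup>2 / n * (inverse (\<theta> t))\<^sup>2 \<le> - \<theta>' t * (inverse (\<theta> t))\<^sup>2"
        by (rule mult_right_mono) simp
      moreover have "(\<theta> t)\<^sup>2 / n * (inverse (\<theta> t))\<^sup>2 = 1 / n" using nz by (simp add: field_simps)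
      ultimately have "1 / n \<le> - \<theta>' t * (inverse (\<theta> t))\<^sup>2" by (simp only:)
      moreover have "inverse (\<theta> t) * \<theta>' t * inverse (\<theta> t) = \<theta>' t * (inverse (\<theta> t))\<^sup>2"
        by (simp add: power2_eq_square)
      ultimately show ?thesis by linarith
    qed
    ultimately show "\<exists>y. DERIV (\<lambda>t. inverse (\<theta> t) - t / n) t :> y \<and> y \<ge> 0" by fastforce
  qed
  moreover have "b / n - a / n = \<bar>inverse (\<theta> a)\<bar>" using n by (simp add: b_def field_simps)
  moreover have "inverse (\<theta> b) < 0" using lt[OF ab] by simp
  ultimately show False by linarith
qed

text \<open>The inequality is preserved by passing from \<theta>(t) to - \<theta>(-t), so the
  previous lemma in both time directions forces \<theta> = 0, against strictness.\<close>

lemma riccati_strict_False: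
  fixes \<theta> :: "real \<Rightarrow> real"
  assumes n: "n > 0" and d: "\<And>t. (\<theta> has_real_derivative \<theta>' t) (at t)"
    and lt: "\<And>t. \<theta>' t < - (\<theta> t)\<^sup>2 / n"
  shows False
proof -
  have 1: "\<theta> t \<ge> 0" for t
    by (rule riccati_negative[OF n d]) (use lt in \<open>simp add: less_imp_le\<close>)
  have 2: "- \<theta> (- t) \<ge> 0" for t
  proof (rule riccati_negative[OF n, of "\<lambda>t. - \<theta> (- t)" "\<lambda>t. \<theta>' (- t)"])
    show "((\<lambda>t. - \<theta> (- t)) has_real_derivative \<theta>' (- t)) (at t)" for t
      using DERIV_minus[OF DERIV_chain2[OF d[of "- t"] DERIV_minus[OF DERIV_ident]]] by simp
    show "\<theta>' (- t) \<le> - (- \<theta> (- t))\<^sup>2 / n" for t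
      using lt[of "- t"] by simp
  qed
  have 0: "\<theta> t = 0" for t using 1[of t] 2[of "- t"] by simp
  then have "\<theta> = (\<lambda>t. 0)" by blast
  then have "(\<theta> has_real_derivative 0) (at 0)" by simp
  then have "\<theta>' 0 = 0" using DERIV_unique[OF d[of 0]] by blast
  then show False using lt[of 0] 0[of 0] by simp
qed

section \<open>Charts and tangent vectors\<close>

locale smooth_manifold =
  fixes A :: "('m::{t2_space, second_countable_topology}, 'n::finite) chart set"
  assumes atlas: "smooth_structure A"
begin

definition "overlap c d = chart_map c ` (chart_dom c \<inter> chart_dom d)"

lemma chart_exists: "\<exists>c\<in>A. p \<in> chart_dom c"
  using atlas unfolding smooth_structure_def by blast

lemma chart_props:
  assumes "c \<in> A"
  shows "open (chart_dom c)" "open (chart_image c)"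
    "homeomorphism (chart_dom c) (chart_image c) (chart_map c) (chart_inv c)"
  using assms atlas unfolding smooth_structure_def is_chart_def by blast+

lemma inv_map: "c \<in> A \<Longrightarrow> p \<in> chart_dom c \<Longrightarrow> chart_inv c (chart_map c p) = p"
  using chart_props(3) homeomorphism_apply1 by blast

lemma map_inv: "c \<in> A \<Longrightarrow> x \<in> chart_image c \<Longrightarrow> chart_map c (chart_inv c x) = x"
  using chart_props(3) homeomorphism_apply2 by blast

lemma inv_in: "c \<in> A \<Longrightarrow> x \<in> chart_image c \<Longrightarrow> chart_inv c x \<in> chart_dom c"
  using chart_props(3)[of c] unfolding homeomorphism_def by blast

lemma map_in: "p \<in> chart_dom c \<Longrightarrow> chart_map c p \<in> chart_image c"
  by (simp add: chart_image_def)

lemma continuous_map: "c \<in> A \<Longrightarrow> continuous_on (chart_dom c) (chart_map c)"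
  using chart_props(3)[of c] unfolding homeomorphism_def by blast

lemma continuous_inv: "c \<in> A \<Longrightarrow> continuous_on (chart_image c) (chart_inv c)"
  using chart_props(3)[of c] unfolding homeomorphism_def by blast

lemma overlap_iff:
  assumes "c \<in> A"
  shows "x \<in> overlap c d \<longleftrightarrow> x \<in> chart_image c \<and> chart_inv c x \<in> chart_dom d"
proof
  assume "x \<in> overlap c d"
  then obtain p where "p \<in> chart_dom c" "p \<in> chart_dom d" "x = chart_map c p"
    unfolding overlap_def by blast
  then show "x \<in> chart_image c \<and> chart_inv c x \<in> chart_dom d"
    using inv_map[OF assms, of p] map_in[of p c] by simp
next
  assume x: "x \<in> chart_image c \<and> chart_inv c x \<in> chart_dom d"
  then have "chart_map c (chart_inv c x) = x" "chart_inv c x \<in> chart_dom c"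
    using map_inv[OF assms] inv_in[OF assms] by blast+
  with x show "x \<in> overlap c d"
    unfolding overlap_def by (intro image_eqI[of _ _ "chart_inv c x"]) simp_all
qed

lemma overlapD:
  assumes "c \<in> A" "x \<in> overlap c d"
  shows "x \<in> chart_image c" "chart_inv c x \<in> chart_dom c" "chart_inv c x \<in> chart_dom d"
    "chart_map c (chart_inv c x) = x"
  using overlap_iff[OF assms(1), THEN iffD1, OF assms(2)] inv_in[OF assms(1), of x] map_inv[OF assms(1), of x]
  by (elim conjE; simp only:)+

lemma overlap_subset: "overlap c d \<subseteq> chart_image c"
  by (auto simp: overlap_def chart_image_def)

lemma overlap_in: "p \<in> chart_dom c \<Longrightarrow> p \<in> chart_dom d \<Longrightarrow> chart_map c p \<in> overlap c d"
  by (simp add: overlap_def)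

lemma open_overlap:
  assumes "c \<in> A" "d \<in> A"
  shows "open (overlap c d)"
proof -
  have "overlap c d = chart_image c \<inter> chart_inv c -` chart_dom d"
    using overlap_iff[OF assms(1)] by blast
  then show ?thesis
    using continuous_open_preimage[OF continuous_inv chart_props(2) chart_props(1)] assms by simp
qed

lemma smooth_transition: "c \<in> A \<Longrightarrow> d \<in> A \<Longrightarrow> smooth_on (overlap c d) (transition c d)"
proof -
  assume "c \<in> A" "d \<in> A"
  then have "compatible c d" using atlas unfolding smooth_structure_def by blast
  then show ?thesis unfolding compatible_def overlap_def by (rule conjunct1)
qed

lemma transition_map: "c \<in> A \<Longrightarrow> p \<in> chart_dom c \<Longrightarrow> transition c d (chart_map c p) = chart_map d p"
  by (simp add: transition_def inv_map)

lemma transition_in: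
  assumes "c \<in> A" "x \<in> overlap c d"
  shows "transition c d x \<in> overlap d c"
proof -
  have x: "x \<in> chart_image c" "chart_inv c x \<in> chart_dom d"
    using overlap_iff[OF assms(1)] assms(2) by blast+
  show ?thesis unfolding transition_def comp_def by (rule overlap_in[OF x(2) inv_in[OF assms(1) x(1)]])
qed

lemma inv_transition:
  assumes "c \<in> A" "d \<in> A" "x \<in> overlap c d"
  shows "chart_inv d (transition c d x) = chart_inv c x"
proof -
  have x: "chart_inv c x \<in> chart_dom d"
    using overlap_iff[OF assms(1)] assms(3) by blast
  show ?thesis unfolding transition_def comp_def by (rule inv_map[OF assms(2) x])
qed

lemma transition_transition:
  assumes "c \<in> A" "d \<in> A" "x \<in> overlap c d"
  shows "transition d e (transition c d x) = transition c e x"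
  using inv_transition[OF assms] by (simp add: transition_def)

lemma transition_self: "c \<in> A \<Longrightarrow> x \<in> chart_image c \<Longrightarrow> transition c c x = x"
  by (simp add: transition_def map_inv)

definition "jac c d x = frechet_derivative (transition c d) (at x)"

lemma jac_has_derivative:
  "c \<in> A \<Longrightarrow> d \<in> A \<Longrightarrow> x \<in> overlap c d \<Longrightarrow> (transition c d has_derivative jac c d x) (at x)"
  unfolding jac_def by (rule smooth_on_has_derivative[OF smooth_transition])

lemma jac_linear: "c \<in> A \<Longrightarrow> d \<in> A \<Longrightarrow> x \<in> overlap c d \<Longrightarrow> linear (jac c d x)"
  by (rule has_derivative_linear[OF jac_has_derivative])

lemma jac_chain:
  assumes "c \<in> A" "d \<in> A" "e \<in> A" "p \<in> chart_dom c" "p \<in> chart_dom d" "p \<in> chart_dom e"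
  shows "jac d e (chart_map d p) (jac c d (chart_map c p) v) = jac c e (chart_map c p) v"
proof -
  let ?x = "chart_map c p"
  have x: "?x \<in> overlap c d" "?x \<in> overlap c e" using assms by (simp_all add: overlap_in)
  have tx: "transition c d ?x = chart_map d p" by (rule transition_map[OF assms(1,4)])
  have y: "transition c d ?x \<in> overlap d e" unfolding tx using assms by (simp add: overlap_in)
  have "((\<lambda>z. transition d e (transition c d z)) has_derivative (\<lambda>v. jac d e (transition c d ?x) (jac c d ?x v))) (at ?x)"
    by (rule has_derivative_compose[OF jac_has_derivative[OF assms(1,2) x(1)] jac_has_derivative[OF assms(2,3) y]])
  then have "(transition c e has_derivative (\<lambda>v. jac d e (transition c d ?x) (jac c d ?x v))) (at ?x)"
    by (rule has_derivative_transform_within_open[OF _ open_overlap[OF assms(1,2)] x(1)])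
       (rule transition_transition[OF assms(1,2)])
  then have "(\<lambda>v. jac d e (transition c d ?x) (jac c d ?x v)) = jac c e ?x"
    by (rule has_derivative_unique[OF _ jac_has_derivative[OF assms(1,3) x(2)]])
  then show ?thesis unfolding tx by (rule fun_cong)
qed

lemma jac_self:
  assumes "c \<in> A" "p \<in> chart_dom c"
  shows "jac c c (chart_map c p) v = v"
proof -
  have x: "chart_map c p \<in> overlap c c" using assms by (simp add: overlap_in)
  have "(transition c c has_derivative (\<lambda>v. v)) (at (chart_map c p))"
    by (rule has_derivative_transform_within_open[OF has_derivative_ident open_overlap[OF assms(1,1)] x])
       (rule transition_self[OF assms(1) subsetD[OF overlap_subset], symmetric])
  then have "jac c c (chart_map c p) = (\<lambda>v. v)"
    by (rule has_derivative_unique[OF jac_has_derivative[OF assms(1,1) x]])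
  then show ?thesis by simp
qed

lemma jac_matrix:
  assumes "c \<in> A" "d \<in> A" "x \<in> overlap c d"
  shows "jac c d x v = (\<chi> a i. pderiv_at i (\<lambda>z. transition c d z $ a) x) *v v"
proof -
  have dt: "transition c d differentiable (at x)"
    by (rule smooth_on_differentiable[OF smooth_transition[OF assms(1,2)] assms(3)])
  have "jac c d x v $ a = (\<Sum>i\<in>UNIV. v $ i * pderiv_at i (\<lambda>z. transition c d z $ a) x)" for a
    unfolding jac_def differentiable_nth(2)[OF dt, symmetric]
    by (rule frechet_derivative_pderiv[OF differentiable_nth(1)[OF dt]])
  then show ?thesis by (simp add: vec_eq_iff matrix_vector_mult_def mult.commute)
qed

text \<open>On a chart around \<open>p\<close> this inverts taking components, as
  \<open>tvec_of_apply\<close> and \<open>tvec_of_tangent_apply\<close> show; coordinate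
  computations are lifted to tangent vectors through it.\<close>

definition tvec_of :: "('m, 'n) chart \<Rightarrow> 'm \<Rightarrow> real^'n \<Rightarrow> ('m, 'n) tvec" where
  "tvec_of c p v = (\<lambda>d. if d \<in> A \<and> p \<in> chart_dom d then jac c d (chart_map c p) v else 0)"

lemma coord_vec_eq: "coord_vec A c p i = tvec_of c p (axis i 1)"
  unfolding coord_vec_def tvec_of_def jac_def ..

lemma tvec_of_tangent: "c \<in> A \<Longrightarrow> p \<in> chart_dom c \<Longrightarrow> tvec_of c p v \<in> tangent_space A p"
proof -
  assume c: "c \<in> A" "p \<in> chart_dom c"
  let ?u = "tvec_of c p v"
  have in_dom: "?u d = jac c d (chart_map c p) v" if "d \<in> A" "p \<in> chart_dom d" for d
    unfolding tvec_of_def using that by simp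
  show ?thesis
    unfolding tangent_space_def
  proof (intro CollectI conjI ballI allI impI)
    fix d e assume "d \<in> A" "e \<in> A" "p \<in> chart_dom d \<and> p \<in> chart_dom e"
    then have de: "d \<in> A" "e \<in> A" "p \<in> chart_dom d" "p \<in> chart_dom e" by simp_all
    show "?u e = frechet_derivative (transition d e) (at (chart_map d p)) (?u d)"
      unfolding in_dom[OF de(1,3)] in_dom[OF de(2,4)] jac_def[symmetric]
      by (rule jac_chain[OF c(1) de(1,2) c(2) de(3,4), symmetric])
  next
    fix d assume "\<not> (d \<in> A \<and> p \<in> chart_dom d)"
    then show "?u d = 0" unfolding tvec_of_def by (rule if_not_P)
  qed
qed

lemma tvec_of_apply: "c \<in> A \<Longrightarrow> p \<in> chart_dom c \<Longrightarrow> tvec_of c p v c = v"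
  by (simp add: tvec_of_def jac_self)

lemma tangent_jac:
  assumes "u \<in> tangent_space A p" "c \<in> A" "d \<in> A" "p \<in> chart_dom c" "p \<in> chart_dom d"
  shows "u d = jac c d (chart_map c p) (u c)"
  unfolding jac_def
  using CollectD[OF assms(1)[unfolded tangent_space_def], THEN conjunct1, THEN bspec, OF assms(2), THEN bspec, OF assms(3)]
    assms(4,5) by simp

lemma tangent_outside:
  assumes "u \<in> tangent_space A p" "\<not> (d \<in> A \<and> p \<in> chart_dom d)"
  shows "u d = 0"
  using CollectD[OF assms(1)[unfolded tangent_space_def], THEN conjunct2, THEN spec, THEN mp, OF assms(2)] .

lemma tvec_of_tangent_apply:
  "u \<in> tangent_space A p \<Longrightarrow> c \<in> A \<Longrightarrow> p \<in> chart_dom c \<Longrightarrow> tvec_of c p (u c) = u"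
proof (rule ext)
  fix d assume *: "u \<in> tangent_space A p" "c \<in> A" "p \<in> chart_dom c"
  show "tvec_of c p (u c) d = u d"
  proof (cases "d \<in> A \<and> p \<in> chart_dom d")
    case True
    then show ?thesis using tangent_jac[OF *(1,2) _ *(3), of d] by (simp add: tvec_of_def)
  next
    case False
    then have "u d = 0" by (rule tangent_outside[OF *(1)])
    then show ?thesis unfolding tvec_of_def if_not_P[OF False] by (rule sym)
  qed
qed

lemma tangent_eqI:
  assumes "u \<in> tangent_space A p" "v \<in> tangent_space A p" "c \<in> A" "p \<in> chart_dom c" "u c = v c"
  shows "u = v"
proof -
  have "u = tvec_of c p (u c)" by (rule tvec_of_tangent_apply[OF assms(1,3,4), symmetric])
  also have "\<dots> = v" unfolding assms(5) by (rule tvec_of_tangent_apply[OF assms(2,3,4)])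
  finally show ?thesis .
qed

lemma tvec_of_linear:
  assumes "c \<in> A" "p \<in> chart_dom c"
  shows "tvec_of c p (a *\<^sub>R u + b *\<^sub>R v) = (\<lambda>d. a *\<^sub>R tvec_of c p u d + b *\<^sub>R tvec_of c p v d)"
proof
  fix d
  show "tvec_of c p (a *\<^sub>R u + b *\<^sub>R v) d = a *\<^sub>R tvec_of c p u d + b *\<^sub>R tvec_of c p v d"
  proof (cases "d \<in> A \<and> p \<in> chart_dom d")
    case True
    then have "linear (jac c d (chart_map c p))" using assms by (intro jac_linear overlap_in) auto
    then show ?thesis using True by (simp add: tvec_of_def linear_add linear_scale)
  qed (auto simp: tvec_of_def)
qed

end

locale lorentz_space = smooth_manifold A
  for A :: "('m::{t2_space, second_countable_topology}, 'n::finite) chart set" +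
  fixes g :: "('m, 'n) metric"
  assumes metric: "lorentzian_metric A g"
begin

lemma g_sym: "u \<in> tangent_space A p \<Longrightarrow> v \<in> tangent_space A p \<Longrightarrow> g p u v = g p v u"
  and g_linear: "u \<in> tangent_space A p \<Longrightarrow> v \<in> tangent_space A p \<Longrightarrow> w \<in> tangent_space A p \<Longrightarrow>
        g p (\<lambda>c. a *\<^sub>R u c + b *\<^sub>R v c) w = a * g p u w + b * g p v w"
  and smooth_gmat: "c \<in> A \<Longrightarrow> smooth_on (chart_image c) (\<lambda>x. gmat A g c x $ i $ j)"
  and frame: "\<exists>(e :: 'n \<Rightarrow> ('m, 'n) tvec) k. (\<forall>i. e i \<in> tangent_space A p) \<and>
        (\<forall>i j. g p (e i) (e j) = (if i \<noteq> j then 0 else if i = k then -1 else 1))"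
  using metric[unfolded lorentzian_metric_def] by (elim conjE; blast)+

lemma g_coords_left:
  assumes "c \<in> A" "p \<in> chart_dom c" "w \<in> tangent_space A p"
  shows "g p (tvec_of c p v) w = (\<Sum>i\<in>UNIV. v $ i * g p (coord_vec A c p i) w)"
proof -
  have "g p (tvec_of c p (a *\<^sub>R x + b *\<^sub>R y)) w = a * g p (tvec_of c p x) w + b * g p (tvec_of c p y) w" for a b x y
    unfolding tvec_of_linear[OF assms(1,2)]
    by (rule g_linear[OF tvec_of_tangent[OF assms(1,2)] tvec_of_tangent[OF assms(1,2)] assms(3)])
  from this[of 1 _ 1] this[of _ _ 0]
  have lin: "linear (\<lambda>v. g p (tvec_of c p v) w)"
    by (intro linearI) simp_all
  have "v = (\<Sum>i\<in>UNIV. v $ i *\<^sub>R axis i 1)"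
    using basis_expansion[of v] by (simp add: scalar_mult_eq_scaleR)
  then have "g p (tvec_of c p v) w = (\<lambda>v. g p (tvec_of c p v) w) (\<Sum>i\<in>UNIV. v $ i *\<^sub>R axis i 1)"
    by simp
  also have "\<dots> = (\<Sum>i\<in>UNIV. v $ i * g p (tvec_of c p (axis i 1)) w)"
    unfolding linear_sum[OF lin] linear_scale[OF lin] by simp
  finally show ?thesis by (simp only: coord_vec_eq)
qed

lemma g_coords:
  assumes c: "c \<in> A" "p \<in> chart_dom c" and u: "u \<in> tangent_space A p" and w: "w \<in> tangent_space A p"
  shows "g p u w = u c \<bullet> (gmat A g c (chart_map c p) *v w c)"
proof -
  have T: "coord_vec A c p i \<in> tangent_space A p" for i
    unfolding coord_vec_eq by (rule tvec_of_tangent[OF c])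
  have "g p u w = (\<Sum>i\<in>UNIV. u c $ i * g p (coord_vec A c p i) w)"
    using g_coords_left[OF c w, of "u c"] by (simp add: tvec_of_tangent_apply[OF u c])
  also have "\<dots> = (\<Sum>i\<in>UNIV. u c $ i * (\<Sum>j\<in>UNIV. w c $ j * g p (coord_vec A c p j) (coord_vec A c p i)))"
    using g_coords_left[OF c T, of "w c"] by (simp add: tvec_of_tangent_apply[OF w c] g_sym[OF T w])
  also have "\<dots> = u c \<bullet> (gmat A g c (chart_map c p) *v w c)"
    by (simp add: inner_vec_sum matrix_vector_mult_def gmat_def inv_map[OF c] Let_def g_sym[OF T T] mult.commute)
  finally show ?thesis .
qed

lemma lorentz_gmat:
  assumes c: "c \<in> A" and x: "x \<in> chart_image c"
  shows "lorentz_form (gmat A g c x)" "transpose (gmat A g c x) = gmat A g c x"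
proof -
  define p where "p = chart_inv c x"
  have p: "p \<in> chart_dom c" "chart_map c p = x" using inv_in[OF c x] map_inv[OF c x] by (simp_all add: p_def)
  obtain e :: "'n \<Rightarrow> ('m, 'n) tvec" and k where
    ek: "(\<forall>i. e i \<in> tangent_space A p) \<and> (\<forall>i j. g p (e i) (e j) = (if i \<noteq> j then 0 else if i = k then -1 else 1))"
    using frame[of p] by (elim exE)
  have e: "e i \<in> tangent_space A p" "g p (e i) (e j) = (if i \<noteq> j then 0 else if i = k then -1 else 1)" for i j
    using ek[THEN conjunct1, THEN spec] ek[THEN conjunct2, THEN spec, THEN spec] .
  let ?E = "\<chi> a j. e j c $ a" and ?G = "gmat A g c x"
  have "(transpose ?E ** ?G ** ?E) $ i $ j = g p (e i) (e j)" for i j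
  proof -
    have "(transpose ?E ** ?G ** ?E) $ i $ j = (\<Sum>b\<in>UNIV. \<Sum>a\<in>UNIV. e i c $ a * ?G $ a $ b * e j c $ b)"
      by (simp add: matrix_matrix_mult_def transpose_def sum_distrib_right)
    also have "\<dots> = (\<Sum>a\<in>UNIV. \<Sum>b\<in>UNIV. e i c $ a * ?G $ a $ b * e j c $ b)" by (rule sum.swap)
    also have "\<dots> = g p (e i) (e j)"
      using g_coords[OF c p(1) e(1) e(1), of i j]
      by (simp add: p(2) inner_vec_sum matrix_vector_mult_def sum_distrib_left mult.assoc)
    finally show ?thesis .
  qed
  then have "transpose ?E ** ?G ** ?E = minkowski k"
    unfolding vec_eq_iff by (simp add: e(2) minkowski_def)
  then show "lorentz_form ?G" unfolding lorentz_form_def by blast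
  have T: "coord_vec A c p i \<in> tangent_space A p" for i
    unfolding coord_vec_eq by (rule tvec_of_tangent[OF c p(1)])
  show "transpose ?G = ?G"
    unfolding vec_eq_iff by (simp add: transpose_def gmat_def Let_def p_def[symmetric] g_sym[OF T T])
qed

lemma metric_chart_gmat:
  assumes "c \<in> A" "open W" "W \<subseteq> chart_image c"
  shows "metric_chart W (gmat A g c)"
  using assms lorentz_gmat[OF assms(1)] smooth_on_subset[OF smooth_gmat[OF assms(1)] assms(3)]
  by unfold_locales blast+

lemma gmat_transform:
  assumes c: "c \<in> A" and d: "d \<in> A" and x: "x \<in> overlap c d"
  defines "J \<equiv> \<chi> a i. pderiv_at i (\<lambda>z. transition c d z $ a) x"
  shows "gmat A g c x = transpose J ** gmat A g d (transition c d x) ** J"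
proof -
  define p where "p = chart_inv c x"
  have p: "p \<in> chart_dom c" "p \<in> chart_dom d" "chart_map c p = x"
    unfolding p_def by (rule overlapD[OF c x])+
  have td: "transition c d x = chart_map d p" using transition_map[OF c p(1)] p(3) by simp
  have J: "tvec_of c p v d = J *v v" for v
    using jac_matrix[OF c d x] p d by (simp add: tvec_of_def J_def)
  have "v \<bullet> (gmat A g c x *v w) = v \<bullet> ((transpose J ** gmat A g d (transition c d x) ** J) *v w)" for v w
  proof -
    have "g p (tvec_of c p v) (tvec_of c p w) = v \<bullet> (gmat A g c x *v w)"
      using g_coords[OF c p(1) tvec_of_tangent[OF c p(1)] tvec_of_tangent[OF c p(1)]]
      by (simp add: p(3) tvec_of_apply[OF c p(1)])
    moreover have "g p (tvec_of c p v) (tvec_of c p w) = (J *v v) \<bullet> (gmat A g d (transition c d x) *v (J *v w))"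
      using g_coords[OF d p(2) tvec_of_tangent[OF c p(1)] tvec_of_tangent[OF c p(1)]]
      by (simp add: td J)
    ultimately show ?thesis
      by (simp add: matrix_inner_transpose matrix_vector_mul_assoc[symmetric])
  qed
  then have "gmat A g c x *v w = (transpose J ** gmat A g d (transition c d x) ** J) *v w" for w
    by (meson vector_eq_ldot)
  then show ?thesis by (simp add: matrix_eq)
qed

lemma christoffel_eq: "christoffel A g c i j k = chr (gmat A g c) i j k"
  by (rule ext) (simp only: christoffel_def chr_def)

lemma ricci_coeff_eq: "ricci_coeff A g c j l x = chr_ricci (gmat A g c) j l x"
  by (simp only: ricci_coeff_def riemann_def chr_ricci_def christoffel_eq)

end

section \<open>Null hypersurfaces\<close>

lemma orthogonal_complement_proportional:
  fixes a b :: "real^'n"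
  assumes "\<And>w. w \<bullet> a = 0 \<Longrightarrow> w \<bullet> b = 0"
  shows "\<exists>r. b = r *\<^sub>R a"
proof -
  \<comment> \<open>For \<open>a = 0\<close> division by zero yields 0, so \<open>?w\<close> is
    \<open>b\<close> itself and the hypothesis still makes it orthogonal to itself.\<close>
  let ?r = "(b \<bullet> a) / (a \<bullet> a)"
  let ?w = "b - ?r *\<^sub>R a"
  have wa: "?w \<bullet> a = 0" by (cases "a = 0") (simp_all add: inner_diff_left)
  then have "?w \<bullet> ?w = 0" using assms[OF wa] by (simp add: inner_diff_right)
  then have "b = ?r *\<^sub>R a" by simp
  then show ?thesis by blast
qed

locale closed_null_hypersurface = lorentz_space A g
  for A :: "('m::{t2_space, second_countable_topology}, 'n::finite) chart set"
    and g :: "('m, 'n) metric" +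
  fixes \<zeta> :: "'m \<Rightarrow> ('m, 'n) tvec" and L :: "'m set"
  assumes timelike: "timelike_vector_field A g \<zeta>"
    and conformal_field: "conformal_vector_field A g \<zeta>"
    and null_L: "null_hypersurface A g L"
    and closed_L: "closed L"
begin

lemma zeta: "\<zeta> p \<in> tangent_space A p" "g p (\<zeta> p) (\<zeta> p) < 0"
  "c \<in> A \<Longrightarrow> smooth_on (chart_image c) (\<lambda>x. \<zeta> (chart_inv c x) c)"
  using timelike unfolding timelike_vector_field_def smooth_vector_field_def by blast+

definition "slice_at s k p \<longleftrightarrow> slice_chart A L s k \<and> p \<in> chart_dom s"

lemma slice_exists: "p \<in> L \<Longrightarrow> \<exists>s k. slice_at s k p"
  using null_L unfolding null_hypersurface_def embedded_hypersurface_def slice_at_def by blast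

lemma slice_atD:
  assumes "slice_at s k p"
  shows "s \<in> A" "p \<in> chart_dom s" "q \<in> chart_dom s \<Longrightarrow> q \<in> L \<longleftrightarrow> chart_map s q $ k = 0"
  using assms unfolding slice_at_def slice_chart_def by blast+

text \<open>In the chart \<open>c\<close>, \<open>fc c s k\<close> is the defining function of \<open>L\<close> given by the slice chart \<open>(s, k)\<close>, and
  \<open>Wc c s k\<close> is the region where \<open>\<zeta>\<close> is transversal to its level sets.\<close>

definition "fc c s k = (\<lambda>x. transition c s x $ k)"
definition "Zc c = (\<lambda>x. \<zeta> (chart_inv c x) c)"
definition "Wc c s k = {x \<in> overlap c s. Zc c x \<bullet> grad_vec (fc c s k) x \<noteq> 0}"
abbreviation "Gc c \<equiv> gmat A g c"
abbreviation "Xc c s k \<equiv> null_transversal (Gc c) (Zc c) (fc c s k)"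

lemma smooth_fc: "c \<in> A \<Longrightarrow> s \<in> A \<Longrightarrow> smooth_on (overlap c s) (fc c s k)"
  unfolding fc_def by (rule smooth_on_nth[OF open_overlap smooth_transition])

lemma fc_map: "c \<in> A \<Longrightarrow> p \<in> chart_dom c \<Longrightarrow> fc c s k (chart_map c p) = chart_map s p $ k"
  by (simp add: fc_def transition_map)

lemma fc_zero_iff:
  assumes "slice_at s k p" "c \<in> A" "x \<in> overlap c s"
  shows "fc c s k x = 0 \<longleftrightarrow> chart_inv c x \<in> L"
proof -
  note x = overlapD[OF assms(2,3)]
  have "fc c s k x = chart_map s (chart_inv c x) $ k"
    by (simp add: fc_def transition_def)
  then show ?thesis using slice_atD(3)[OF assms(1) x(3)] by simp
qed

lemma open_Wc:
  assumes "c \<in> A" "s \<in> A"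
  shows "open (Wc c s k)"
proof -
  have "continuous_on (overlap c s) (\<lambda>x. Zc c x \<bullet> grad_vec (fc c s k) x)"
  proof (intro continuous_on_inner smooth_on_continuous_on)
    show "smooth_on (overlap c s) (Zc c)"
      unfolding Zc_def by (rule smooth_on_subset[OF zeta(3)[OF assms(1)] overlap_subset])
    show "smooth_on (overlap c s) (grad_vec (fc c s k))"
      by (rule smooth_on_vecI[OF open_overlap[OF assms]])
         (simp add: grad_vec_def smooth_on_pderiv[OF smooth_fc[OF assms]])
  qed
  moreover have "Wc c s k = overlap c s \<inter> (\<lambda>x. Zc c x \<bullet> grad_vec (fc c s k) x) -` (- {0})"
    by (auto simp: Wc_def)
  ultimately show ?thesis
    using continuous_open_preimage[OF _ open_overlap[OF assms] open_Compl[OF closed_singleton]] by simp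
qed

lemma grad_fc:
  assumes "c \<in> A" "s \<in> A" "x \<in> overlap c s"
  shows "v \<bullet> grad_vec (fc c s k) x = jac c s x v $ k"
  unfolding jac_matrix[OF assms]
  by (simp add: inner_vec_sum grad_vec_def fc_def matrix_vector_mult_def mult.commute)

lemma Wc_overlap: "x \<in> Wc c s k \<Longrightarrow> x \<in> overlap c s"
  by (simp add: Wc_def)

lemma fc_zero:
  assumes "p \<in> L" "slice_at s k p" "c \<in> A" "p \<in> chart_dom c"
  shows "fc c s k (chart_map c p) = 0"
  using fc_map[OF assms(3,4)] slice_atD(3)[OF assms(2) slice_atD(2)[OF assms(2)]] assms(1) by simp

text \<open>A normal vector is orthogonal to the kernel of the differential of every slice coordinate, so
  all slice charts at \<open>p\<close> see the same normal direction.\<close>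

lemma normal_exists:
  assumes p: "p \<in> L"
  obtains u where "u \<in> hypersurface_tangent_space A L p" "u \<in> tangent_space A p" "u \<noteq> (\<lambda>c. 0)"
    "\<And>w. w \<in> hypersurface_tangent_space A L p \<Longrightarrow> g p u w = 0"
  using null_L p unfolding null_hypersurface_def hypersurface_tangent_space_def by blast

lemma normal_gradient:
  assumes p: "slice_at s k p" and c: "c \<in> A" "p \<in> chart_dom c"
    and v: "v \<in> tangent_space A p" "\<And>w. w \<in> hypersurface_tangent_space A L p \<Longrightarrow> g p v w = 0"
  shows "\<exists>r. Gc c (chart_map c p) *v v c = r *\<^sub>R grad_vec (fc c s k) (chart_map c p)"
proof (rule orthogonal_complement_proportional)
  let ?x = "chart_map c p"
  have x: "?x \<in> overlap c s" by (rule overlap_in[OF c(2) slice_atD(2)[OF p]])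
  fix w :: "real^'n" assume w: "w \<bullet> grad_vec (fc c s k) ?x = 0"
  have T: "tvec_of c p w \<in> tangent_space A p" by (rule tvec_of_tangent[OF c])
  have "tvec_of c p w s $ k = 0"
    using w slice_atD[OF p] unfolding grad_fc[OF c(1) slice_atD(1)[OF p] x] by (simp add: tvec_of_def)
  then have "tvec_of c p w \<in> hypersurface_tangent_space A L p"
    using T p unfolding hypersurface_tangent_space_def slice_at_def by blast
  then have "g p (tvec_of c p w) v = 0"
    using v(2) g_sym[OF T v(1)] by simp
  then show "w \<bullet> (Gc c ?x *v v c) = 0"
    by (simp add: g_coords[OF c T v(1)] tvec_of_apply[OF c])
qed

text \<open>A normal that is also tangent is orthogonal to itself, hence null. A nonzero null vector
  is never orthogonal to the timelike \<zeta>, and \<open>g(u, \<zeta>)\<close> is \<open>r\<close>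
  times the derivative of the defining function along \<zeta>; so \<zeta> is transversal to
  \<open>L\<close>.\<close>

lemma normal_properties:
  assumes p: "p \<in> L" and s: "slice_at s k p" and c: "c \<in> A" "p \<in> chart_dom c"
  defines "x \<equiv> chart_map c p"
  obtains u r where "u \<in> tangent_space A p" "\<And>w. w \<in> hypersurface_tangent_space A L p \<Longrightarrow> g p u w = 0"
    "g p u u = 0" "r \<noteq> 0" "Gc c x *v u c = r *\<^sub>R grad_vec (fc c s k) x" "Zc c x \<bullet> grad_vec (fc c s k) x \<noteq> 0"
    "matrix_inv (Gc c x) *v grad_vec (fc c s k) x = inverse r *\<^sub>R u c"
proof -
  obtain u where u: "u \<in> hypersurface_tangent_space A L p" "u \<in> tangent_space A p" "u \<noteq> (\<lambda>c. 0)"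
    "\<And>w. w \<in> hypersurface_tangent_space A L p \<Longrightarrow> g p u w = 0"
    using normal_exists[OF p] by blast
  obtain r where r: "Gc c x *v u c = r *\<^sub>R grad_vec (fc c s k) x"
    using normal_gradient[OF s c u(2,4)] unfolding x_def by blast
  have null: "g p u u = 0" by (rule u(4)[OF u(1)])
  have xi: "x \<in> chart_image c" unfolding x_def by (rule map_in[OF c(2)])
  have Z: "Zc c x = \<zeta> p c" by (simp add: Zc_def x_def inv_map[OF c])
  have lor: "lorentz_form (Gc c x)" by (rule lorentz_gmat(1)[OF c(1) xi])
  have inv: "matrix_inv (Gc c x) ** Gc c x = mat 1"
    by (rule lorentz_formE[OF lor]) (rule matrix_inv_inverse(2))
  have uc: "u c \<noteq> 0"
  proof
    assume "u c = 0"
    then have "tvec_of c p 0 = u" using tvec_of_tangent_apply[OF u(2) c] by simp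
    then have "u = tvec_of c p (0 *\<^sub>R 0 + 0 *\<^sub>R 0)" by simp
    then have "u = (\<lambda>c. 0)" unfolding tvec_of_linear[OF c] by simp
    then show False using u(3) by simp
  qed
  have eq: "matrix_inv (Gc c x) *v (Gc c x *v u c) = u c"
    by (simp add: matrix_vector_mul_assoc inv)
  have r0: "r \<noteq> 0" using eq uc by (auto simp: r)
  have "u c \<bullet> (Gc c x *v \<zeta> p c) \<noteq> 0"
  proof
    assume "u c \<bullet> (Gc c x *v \<zeta> p c) = 0"
    moreover have "u c \<bullet> (Gc c x *v u c) = 0" using null g_coords[OF c u(2) u(2)] by (simp add: x_def)
    moreover have "\<zeta> p c \<bullet> (Gc c x *v \<zeta> p c) < 0" using zeta(2)[of p] g_coords[OF c zeta(1) zeta(1)] by (simp add: x_def)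
    ultimately have "u c = 0" using lorentz_timelike_null_orthogonal[OF lor] by blast
    then show False using uc by simp
  qed
  moreover have "u c \<bullet> (Gc c x *v \<zeta> p c) = \<zeta> p c \<bullet> (Gc c x *v u c)"
    using g_sym[OF u(2) zeta(1)] g_coords[OF c u(2) zeta(1)] g_coords[OF c zeta(1) u(2)] by (simp add: x_def)
  ultimately have w0: "Zc c x \<bullet> grad_vec (fc c s k) x \<noteq> 0"
    by (simp add: r Z)
  have "matrix_inv (Gc c x) *v grad_vec (fc c s k) x = inverse r *\<^sub>R (matrix_inv (Gc c x) *v (r *\<^sub>R grad_vec (fc c s k) x))"
    using r0 by (simp add: matrix_vector_mult_scaleR)
  then have V: "matrix_inv (Gc c x) *v grad_vec (fc c s k) x = inverse r *\<^sub>R u c"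
    using eq by (simp add: r)
  show ?thesis by (rule that[OF u(2,4) null r0 r w0 V])
qed

lemma in_Wc:
  assumes "p \<in> L" "slice_at s k p" "c \<in> A" "p \<in> chart_dom c"
  shows "chart_map c p \<in> Wc c s k"
proof -
  have "chart_map c p \<in> overlap c s" by (rule overlap_in[OF assms(4) slice_atD(2)[OF assms(2)]])
  moreover have "Zc c (chart_map c p) \<bullet> grad_vec (fc c s k) (chart_map c p) \<noteq> 0"
    by (rule normal_properties[OF assms])
  ultimately show ?thesis by (simp add: Wc_def)
qed

text \<open>In the slice chart \<open>L\<close> is a piece of a hyperplane, so a straight line with
  tangential velocity stays in it; the curve is its image in the chart \<open>c\<close>.\<close>

lemma slice_curve:
  assumes s: "slice_at s k p" and c: "c \<in> A" and x: "x \<in> overlap c s" "fc c s k x = 0"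
    and v: "v \<bullet> grad_vec (fc c s k) x = 0"
  shows "\<exists>\<beta>. \<beta> 0 = x \<and> (\<beta> has_vector_derivative v) (at 0) \<and> (\<forall>\<^sub>F t in at 0. fc c s k (\<beta> t) = 0)"
proof -
  have sA: "s \<in> A" by (rule slice_atD(1)[OF s])
  define y where "y = transition c s x"
  define v' where "v' = jac c s x v"
  define l where "l t = y + t *\<^sub>R v'" for t
  have y: "y \<in> overlap s c" unfolding y_def by (rule transition_in[OF c x(1)])
  have yk: "y $ k = 0" using x(2) by (simp add: y_def fc_def)
  have vk: "v' $ k = 0" using v grad_fc[OF c sA x(1)] by (simp add: v'_def)
  have dl: "(l has_vector_derivative v') (at 0)"
    unfolding l_def by (auto intro!: derivative_eq_intros)
  have tx: "transition s c y = x"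
    unfolding y_def transition_transition[OF c sA x(1)]
    by (rule transition_self[OF c subsetD[OF overlap_subset x(1)]])
  have jv: "jac s c y v' = v"
  proof -
    note p = overlapD[OF c x(1)]
    have "y = chart_map s (chart_inv c x)" by (simp add: y_def transition_def)
    then show ?thesis
      using jac_chain[OF c sA c p(2,3,2), of v] jac_self[OF c p(2), of v] by (simp add: p(4) v'_def)
  qed
  have "((\<lambda>t. transition s c (l t)) has_derivative (\<lambda>t. jac s c (l 0) (t *\<^sub>R v'))) (at 0)"
    by (rule has_derivative_compose[OF dl[unfolded has_vector_derivative_def]])
       (use jac_has_derivative[OF sA c y] in \<open>simp add: l_def\<close>)
  moreover have "jac s c (l 0) (t *\<^sub>R v') = t *\<^sub>R v" for t
    using linear_scale[OF jac_linear[OF sA c y]] by (simp add: l_def jv)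
  ultimately have d: "((\<lambda>t. transition s c (l t)) has_vector_derivative v) (at 0)"
    by (simp add: has_vector_derivative_def)
  have "isCont l 0" by (rule has_vector_derivative_continuous[OF dl])
  then have "(l \<longlongrightarrow> y) (at 0)" by (simp add: isCont_def l_def)
  then have "\<forall>\<^sub>F t in at 0. l t \<in> overlap s c"
    using open_overlap[OF sA c] y topological_tendstoD by blast
  then have "\<forall>\<^sub>F t in at 0. fc c s k (transition s c (l t)) = 0"
  proof eventually_elim
    case (elim t)
    then show ?case
      using transition_self[OF sA subsetD[OF overlap_subset elim]]
      by (simp add: fc_def transition_transition[OF sA c elim]) (simp add: l_def yk vk)
  qed
  then show ?thesis
    using d tx by (intro exI[of _ "\<lambda>t. transition s c (l t)"]) (simp add: l_def)
qed

text \<open>Stated for every open part of \<open>Wc c s k\<close>, because the comparison of two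
  charts takes place on a smaller domain where both descriptions are valid.\<close>

lemma null_chart_Wc:
  assumes s: "slice_at s k p" and c: "c \<in> A" and W: "open W" "W \<subseteq> Wc c s k"
  shows "null_chart W (Gc c) (Zc c) (fc c s k)"
proof -
  have sA: "s \<in> A" by (rule slice_atD(1)[OF s])
  have WO: "W \<subseteq> overlap c s" using W(2) by (auto simp: Wc_def)
  have WI: "W \<subseteq> chart_image c" using WO overlap_subset by blast
  interpret metric_chart W "Gc c" by (rule metric_chart_gmat[OF c W(1) WI])
  obtain \<sigma> where \<sigma>: "\<forall>c\<in>A. \<forall>p\<in>chart_dom c. \<forall>i j.
        lie_metric A g \<zeta> c i j (chart_map c p) = 2 * \<sigma> p * Gc c (chart_map c p) $ i $ j"
    using conformal_field unfolding conformal_vector_field_def by blast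
  show ?thesis
  proof unfold_locales
    show "smooth_on W (Zc c)" unfolding Zc_def by (rule smooth_on_subset[OF zeta(3)[OF c] WI])
    show "smooth_on W (fc c s k)" by (rule smooth_on_subset[OF smooth_fc[OF c sA] WO])
  next
    fix x assume "x \<in> W"
    then show "Zc c x \<bullet> grad_vec (fc c s k) x \<noteq> 0" using W(2) by (auto simp: Wc_def)
  next
    fix x assume x: "x \<in> W" "fc c s k x = 0"
    have xo: "x \<in> overlap c s" using x(1) WO by blast
    note q = overlapD[OF c xo]
    have qL: "chart_inv c x \<in> L" using fc_zero_iff[OF s c xo] x(2) by simp
    have sq: "slice_at s k (chart_inv c x)" using s q(3) by (simp add: slice_at_def)
    obtain u r where ur: "u \<in> tangent_space A (chart_inv c x)" "g (chart_inv c x) u u = 0"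
        "Gc c x *v u c = r *\<^sub>R grad_vec (fc c s k) x" "r \<noteq> 0"
        "matrix_inv (Gc c x) *v grad_vec (fc c s k) x = inverse r *\<^sub>R u c"
      by (rule normal_properties[OF qL sq c q(2), unfolded q(4)]) (rule that; assumption)
    have "u c \<bullet> (Gc c x *v u c) = 0"
      using g_coords[OF c q(2) ur(1) ur(1)] ur(2) by (simp add: q(4))
    then have "u c \<bullet> grad_vec (fc c s k) x = 0" using ur(3,4) by simp
    then show "(matrix_inv (Gc c x) *v grad_vec (fc c s k) x) \<bullet> grad_vec (fc c s k) x = 0"
      by (simp add: ur(5))
  next
    fix x v assume "x \<in> W" "fc c s k x = 0" "v \<bullet> grad_vec (fc c s k) x = 0"
    then show "\<exists>\<beta>. \<beta> 0 = x \<and> (\<beta> has_vector_derivative v) (at 0) \<and> (\<forall>\<^sub>F t in at 0. fc c s k (\<beta> t) = 0)"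
      using slice_curve[OF s c] WO by blast
  next
    fix x assume "x \<in> W"
    then have x: "x \<in> overlap c s" using WO by blast
    note q = overlapD[OF c x]
    show "\<exists>r. \<forall>i j. (\<Sum>k\<in>UNIV. Zc c x $ k * pderiv_at k (\<lambda>y. Gc c y $ i $ j) x + Gc c x $ k $ j * pderiv_at i (\<lambda>y. Zc c y $ k) x
           + Gc c x $ i $ k * pderiv_at j (\<lambda>y. Zc c y $ k) x) = 2 * r * Gc c x $ i $ j" (is "\<exists>r. \<forall>i j. ?lie r i j")
    proof (intro exI allI)
      fix i j
      show "?lie (\<sigma> (chart_inv c x)) i j"
        using \<sigma>[rule_format, OF c q(2), of i j] unfolding q(4) lie_metric_def Zc_def .
    qed
  qed
qed

section \<open>The normalised null normal field\<close>

text \<open>The normalisation against \<zeta> fixes the scale of the normal, so this characterises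
  \<xi> without reference to charts. All coordinate expressions of \<xi> can then be compared
  through it.\<close>

definition "normal_at p v \<longleftrightarrow> v \<in> tangent_space A p \<and>
  (\<forall>w\<in>hypersurface_tangent_space A L p. g p v w = 0) \<and> g p v (\<zeta> p) = -1"

definition "\<xi> p = (SOME v. normal_at p v)"

text \<open>At \<open>p\<close> the field \<open>Xc c s k\<close> is a multiple of a normal
  \<open>u\<close>, whence existence. Conversely \<open>normal_gradient\<close> determines a normal
  up to a factor, and the value -1 on \<zeta> determines the factor.\<close>

lemma normal_at_coords:
  assumes p: "p \<in> L" and s: "slice_at s k p" and c: "c \<in> A" "p \<in> chart_dom c"
  shows "normal_at p v \<longleftrightarrow> v = tvec_of c p (Xc c s k (chart_map c p))"
proof -
  let ?x = "chart_map c p" and ?df = "grad_vec (fc c s k) (chart_map c p)"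
  let ?X = "tvec_of c p (Xc c s k (chart_map c p))"
  interpret N: null_chart "Wc c s k" "Gc c" "Zc c" "fc c s k"
    by (rule null_chart_Wc[OF s c(1) open_Wc[OF c(1) slice_atD(1)[OF s]] order_refl])
  have x: "?x \<in> Wc c s k" by (rule in_Wc[OF p s c])
  have fx: "fc c s k ?x = 0" by (rule fc_zero[OF p s c])
  have Z: "Zc c ?x = \<zeta> p c" by (simp add: Zc_def inv_map[OF c])
  obtain u r where ur: "u \<in> tangent_space A p" "\<And>w. w \<in> hypersurface_tangent_space A L p \<Longrightarrow> g p u w = 0"
      "r \<noteq> 0" "matrix_inv (Gc c ?x) *v ?df = inverse r *\<^sub>R u c"
    by (rule normal_properties[OF p s c]) (rule that; assumption)
  have XT: "?X \<in> tangent_space A p" by (rule tvec_of_tangent[OF c])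
  have "g p ?X (\<zeta> p) = -1"
    using N.XZ[OF x fx] by (simp add: g_coords[OF c XT zeta(1)] tvec_of_apply[OF c] Z)
  moreover have "g p ?X w = 0" if w: "w \<in> hypersurface_tangent_space A L p" for w
  proof -
    have wT: "w \<in> tangent_space A p" using w by (simp add: hypersurface_tangent_space_def)
    let ?m = "- inverse (N.w ?x) * inverse r"
    have "Xc c s k ?x = ?m *\<^sub>R u c + 0 *\<^sub>R u c"
      by (simp add: N.X_eq N.h0[OF x fx] N.V_def ur(4))
    then have "?X = (\<lambda>d. ?m *\<^sub>R u d + 0 *\<^sub>R u d)"
      by (simp only: tvec_of_linear[OF c] tvec_of_tangent_apply[OF ur(1) c])
    then have "g p ?X w = ?m * g p u w + 0 * g p u w"
      by (simp only: g_linear[OF ur(1) ur(1) wT])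
    then show ?thesis by (simp add: ur(2)[OF w])
  qed
  ultimately have nX: "normal_at p ?X" using XT by (simp add: normal_at_def)
  have "v = ?X" if v: "normal_at p v"
  proof (rule tangent_eqI[OF _ XT c])
    have vT: "v \<in> tangent_space A p" "\<And>w. w \<in> hypersurface_tangent_space A L p \<Longrightarrow> g p v w = 0" "g p v (\<zeta> p) = -1"
      using v by (simp_all add: normal_at_def)
    show "v \<in> tangent_space A p" by (rule vT(1))
    obtain t where t: "Gc c ?x *v v c = t *\<^sub>R ?df" using normal_gradient[OF s c vT(1,2)] by blast
    have "\<zeta> p c \<bullet> (Gc c ?x *v v c) = -1"
      using vT(3) by (simp add: g_sym[OF vT(1) zeta(1)] g_coords[OF c zeta(1) vT(1)])
    then have "t * N.w ?x = -1" by (simp add: t N.w_def Z)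
    then have "t = - inverse (N.w ?x)" using N.w_nz[OF x] by (simp add: field_simps)
    then have "Gc c ?x *v v c = Gc c ?x *v Xc c s k ?x" by (simp add: t N.GX0[OF x fx])
    then have "matrix_inv (Gc c ?x) *v (Gc c ?x *v v c) = matrix_inv (Gc c ?x) *v (Gc c ?x *v Xc c s k ?x)" by simp
    then have "v c = Xc c s k ?x" by (simp add: matrix_vector_mul_assoc N.inv_G(2)[OF x])
    then show "v c = ?X c" by (simp add: tvec_of_apply[OF c])
  qed
  then show ?thesis using nX by blast
qed

lemma xi_normal: "p \<in> L \<Longrightarrow> normal_at p (\<xi> p)"
proof -
  assume p: "p \<in> L"
  obtain s k where s: "slice_at s k p" using slice_exists[OF p] by blast
  have "normal_at p (tvec_of s p (Xc s s k (chart_map s p)))"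
    using normal_at_coords[OF p s slice_atD(1,2)[OF s]] by simp
  then show ?thesis unfolding \<xi>_def by (rule someI[where P = "normal_at p"])
qed

lemma xi_coords:
  assumes p: "p \<in> L" and s: "slice_at s k p" and c: "c \<in> A" "p \<in> chart_dom c"
  shows "\<xi> p c = Xc c s k (chart_map c p)"
  using normal_at_coords[OF p s c, THEN iffD1, OF xi_normal[OF p]] by (simp add: tvec_of_apply[OF c])

lemma xi_tangent: "p \<in> L \<Longrightarrow> \<xi> p \<in> tangent_space A p"
  using xi_normal by (simp add: normal_at_def)

lemma xi_null: "p \<in> L \<Longrightarrow> null_vector A g p (\<xi> p)"
proof -
  assume p: "p \<in> L"
  obtain s k where s: "slice_at s k p" using slice_exists[OF p] by blast
  note c = slice_atD(1,2)[OF s]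
  interpret N: null_chart "Wc s s k" "Gc s" "Zc s" "fc s s k"
    by (rule null_chart_Wc[OF s c(1) open_Wc[OF c(1) c(1)] order_refl])
  have x: "chart_map s p \<in> Wc s s k" by (rule in_Wc[OF p s c])
  have fx: "fc s s k (chart_map s p) = 0" by (rule fc_zero[OF p s c])
  have "g p (\<xi> p) (\<xi> p) = 0"
    using g_coords[OF c xi_tangent[OF p] xi_tangent[OF p]] N.XX0[OF x fx] by (simp add: xi_coords[OF p s c])
  moreover have "\<xi> p \<noteq> (\<lambda>c. 0)"
    using N.X_nonzero[OF x fx] xi_coords[OF p s c] by auto
  ultimately show ?thesis using xi_tangent[OF p] by (simp add: null_vector_def)
qed

section \<open>The null expansion\<close>

text \<open>In both charts the extended field restricts to \<xi> along \<open>L\<close>. Hence the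
  difference of the two fields, pulled back to \<open>c\<close>, vanishes where the defining
  function does, and its differential is proportional to \<open>df\<close>, as
  \<open>divg_invariant\<close> requires.\<close>

lemma divg_chart_independent:
  assumes p: "p \<in> L" and s: "slice_at s k p" and c: "c \<in> A" "p \<in> chart_dom c"
    and s': "slice_at s' k' p" and c': "c' \<in> A" "p \<in> chart_dom c'"
  shows "divg (Gc c) (Xc c s k) (chart_map c p) = divg (Gc c') (Xc c' s' k') (chart_map c' p)"
proof -
  let ?x = "chart_map c p" and ?\<phi> = "transition c c'"
  let ?W = "Wc c s k" and ?W' = "Wc c' s' k'"
  let ?X = "Xc c s k" and ?X' = "Xc c' s' k'"
  let ?J = "\<lambda>z. \<chi> a i. pderiv_at i (\<lambda>z. ?\<phi> z $ a) z"
  have oW: "open ?W" "open ?W'" using open_Wc slice_atD(1)[OF s] slice_atD(1)[OF s'] c(1) c'(1) by blast+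
  interpret N: null_chart ?W "Gc c" "Zc c" "fc c s k"
    by (rule null_chart_Wc[OF s c(1) oW(1) order_refl])
  interpret N': null_chart ?W' "Gc c'" "Zc c'" "fc c' s' k'"
    by (rule null_chart_Wc[OF s' c'(1) oW(2) order_refl])
  define U where "U = (?W \<inter> overlap c c') \<inter> ?\<phi> -` ?W'"
  have cont: "continuous_on (?W \<inter> overlap c c') ?\<phi>"
    by (rule continuous_on_subset[OF smooth_on_continuous_on[OF smooth_transition[OF c(1) c'(1)]]]) simp
  have U: "open U" unfolding U_def
    by (rule continuous_open_preimage[OF cont open_Int[OF oW(1) open_overlap[OF c(1) c'(1)]] oW(2)])
  have \<phi>x: "?\<phi> ?x = chart_map c' p" by (rule transition_map[OF c])
  have x: "?x \<in> ?W" by (rule in_Wc[OF p s c])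
  have x': "chart_map c' p \<in> ?W'" by (rule in_Wc[OF p s' c'])
  have xU: "?x \<in> U" using x x' overlap_in[OF c(2) c'(2)] by (simp add: U_def \<phi>x)
  have UW: "U \<subseteq> ?W" by (auto simp: U_def)
  have fx: "fc c s k ?x = 0" by (rule fc_zero[OF p s c])
  have fx': "fc c' s' k' (chart_map c' p) = 0" by (rule fc_zero[OF p s' c'])
  \<comment> \<open>A third instance, on the common domain \<open>U\<close>: the difference of the
    two fields makes sense only there, and \<open>derivative_proportional\<close> is applied to
    it.\<close>
  interpret NU: null_chart U "Gc c" "Zc c" "fc c s k"
    by (rule null_chart_Wc[OF s c(1) U UW])
  have s\<phi>: "smooth_on U ?\<phi>"
    by (rule smooth_on_subset[OF smooth_transition[OF c(1) c'(1)]]) (auto simp: U_def)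
  have sJ: "smooth_on U (\<lambda>z. ?J z $ a $ i)" for a i
    by (simp, rule smooth_on_pderiv[OF smooth_on_nth[OF U s\<phi>]])
  have sE: "smooth_on U (\<lambda>z. ?X' (?\<phi> z) $ a - (?J z *v ?X z) $ a)" for a
  proof (rule smooth_on_diff[OF U])
    show "smooth_on U (\<lambda>z. ?X' (?\<phi> z) $ a)"
      by (rule smooth_on_nth[OF U smooth_on_compose[OF U _ s\<phi> N'.smooth_X]]) (auto simp: U_def)
    show "smooth_on U (\<lambda>z. (?J z *v ?X z) $ a)"
      unfolding matrix_vector_mult_def vec_lambda_beta[of "\<lambda>i. \<Sum>j\<in>UNIV. ?J _ $ i $ j * ?X _ $ j"]
      by (rule smooth_on_sum[OF U smooth_on_mult[OF U sJ smooth_on_nth[OF U NU.smooth_X]]])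
  qed
  have E0: "?X' (?\<phi> z) = ?J z *v ?X z" if z: "z \<in> U" "fc c s k z = 0" for z
  proof -
    have zo: "z \<in> overlap c s" "z \<in> overlap c c'" using z(1) by (auto simp: U_def Wc_def)
    note q = overlapD[OF c(1) zo(1)] overlapD(3)[OF c(1) zo(2)]
    define b where "b = chart_inv c z"
    have bL: "b \<in> L" using fc_zero_iff[OF s c(1) zo(1)] z(2) by (simp add: b_def)
    have bd: "b \<in> chart_dom c" "b \<in> chart_dom c'" "b \<in> chart_dom s" "chart_map c b = z"
      using q by (simp_all add: b_def)
    have \<phi>z: "?\<phi> z = chart_map c' b" by (simp add: b_def transition_def)
    have "?\<phi> z \<in> overlap c' s'" using z(1) by (auto simp: U_def Wc_def)
    then have "b \<in> chart_dom s'" using overlapD(3)[OF c'(1), of "?\<phi> z" s'] inv_map[OF c'(1) bd(2)] by (simp add: \<phi>z)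
    then have sb: "slice_at s k b" "slice_at s' k' b"
      using s s' bd(3) by (simp_all add: slice_at_def)
    have "\<xi> b c' = jac c c' z (\<xi> b c)"
      using tangent_jac[OF xi_tangent[OF bL] c(1) c'(1) bd(1,2)] by (simp add: bd(4))
    then show ?thesis
      using xi_coords[OF bL sb(1) c(1) bd(1)] xi_coords[OF bL sb(2) c'(1) bd(2)]
      by (simp add: bd(4) \<phi>z[symmetric] jac_matrix[OF c(1) c'(1) zo(2)])
  qed
  \<comment> \<open>\<open>derivative_proportional\<close> yields a multiple of \<open>df\<close>,
    while \<open>divg_invariant\<close> wants a multiple of \<open>G X = - df / w\<close>; the extra
    factor \<open>- w\<close> converts one into the other.\<close>
  define Y where "Y = (\<chi> a. - N.w ?x * (Zc c ?x \<bullet> grad_vec (\<lambda>z. ?X' (?\<phi> z) $ a - (?J z *v ?X z) $ a) ?x * inverse (NU.w ?x)))"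
  have "divg (Gc c) ?X ?x = divg (Gc c') ?X' (?\<phi> ?x)"
  proof (rule divg_invariant[where Y = Y, OF N.metric_chart_axioms N'.metric_chart_axioms U xU UW s\<phi>])
    show "?\<phi> ` U \<subseteq> ?W'" by (auto simp: U_def)
    show "Gc c z = transpose (?J z) ** Gc c' (?\<phi> z) ** ?J z" if "z \<in> U" for z
      by (rule gmat_transform[OF c(1) c'(1)]) (use that in \<open>auto simp: U_def\<close>)
    show "smooth_on ?W ?X" by (rule N.smooth_X)
    show "smooth_on ?W' ?X'" by (rule N'.smooth_X)
    show "?X' (?\<phi> ?x) = ?J ?x *v ?X ?x" by (rule E0[OF xU fx])
    show "pderiv_at i (\<lambda>z. ?X' (?\<phi> z) $ a - (?J z *v ?X z) $ a) ?x = (Gc c ?x *v ?X ?x) $ i * Y $ a" for i a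
      using NU.derivative_proportional[OF xU fx sE[of a]] E0 N.w_nz[OF x]
      by (simp add: N.GX0[OF x fx] Y_def)
    show "pderiv_at i (\<lambda>y. ?X y \<bullet> (Gc c y *v ?X y)) ?x = 0" for i by (rule N.dH0[OF x fx])
    show "pderiv_at i (\<lambda>y. ?X' y \<bullet> (Gc c' y *v ?X' y)) (?\<phi> ?x) = 0" for i
      unfolding \<phi>x by (rule N'.dH0[OF x' fx'])
    show "Gc c ?x *v ?X ?x \<noteq> 0" using N.XZ[OF x fx] N.inner_G_commute[OF x, of "?X ?x"] by auto
  qed
  then show ?thesis by (simp add: \<phi>x)
qed

end

section \<open>Null generators\<close>

lemma smooth_on_ident: "smooth_on S (\<lambda>x. x)"
proof -
  have "Ck_on k S (\<lambda>x. x)" for k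
    by (cases k) (simp_all add: Ck_on_const)
  then show ?thesis by (simp add: smooth_on_def)
qed

lemma isCont_closure_mem:
  fixes F :: "'a::t2_space \<Rightarrow> 'b::topological_space"
  assumes "isCont F b" "closed C" "b \<in> closure I" "open S" "b \<in> S" "\<And>t. t \<in> I \<inter> S \<Longrightarrow> F t \<in> C"
  shows "F b \<in> C"
proof (rule ccontr)
  assume "F b \<notin> C"
  then obtain T where T: "open T" "b \<in> T" "\<forall>t\<in>T. F t \<in> - C"
    using assms(1) open_Compl[OF assms(2)] unfolding continuous_at_open by (metis ComplI)
  have "open (S \<inter> T)" "b \<in> S \<inter> T" using T assms(4,5) by auto
  then have "I \<inter> (S \<inter> T) \<noteq> {}" using assms(3) unfolding closure_iff_nhds_not_empty by (metis order_refl)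
  then show False using T(3) assms(6) by blast
qed

text \<open>\<open>F\<close> and \<open>H\<close> have the same first-order expansion at
  \<open>b\<close>, and at each nearby point \<open>K\<close> takes one of their values, in no
  prescribed order. This permits gluing at either end of an interval.\<close>

lemma has_vector_derivative_piecewise:
  fixes F H :: "real \<Rightarrow> 'a::real_normed_vector"
  assumes F: "(F has_vector_derivative v) (at b)" and H: "(H has_vector_derivative v) (at b)"
    and S: "open S" "b \<in> S" and K: "\<And>t. t \<in> S \<Longrightarrow> K t = F t \<or> K t = H t" and b: "K b = F b" "F b = H b"
  shows "(K has_vector_derivative v) (at b)"
  unfolding has_vector_derivative_def has_derivative_at_alt
proof (intro conjI allI impI)
  show "bounded_linear (\<lambda>x. x *\<^sub>R v)" by (rule bounded_linear_scaleR_left)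
  fix e :: real assume e: "0 < e"
  obtain d1 where d1: "d1 > 0" "\<And>y. norm (y - b) < d1 \<Longrightarrow> norm (F y - F b - (y - b) *\<^sub>R v) \<le> e * norm (y - b)"
    using F e unfolding has_vector_derivative_def has_derivative_at_alt by blast
  obtain d2 where d2: "d2 > 0" "\<And>y. norm (y - b) < d2 \<Longrightarrow> norm (H y - H b - (y - b) *\<^sub>R v) \<le> e * norm (y - b)"
    using H e unfolding has_vector_derivative_def has_derivative_at_alt by blast
  obtain d3 where d3: "d3 > 0" "ball b d3 \<subseteq> S" using S open_contains_ball by blast
  show "\<exists>d>0. \<forall>y. norm (y - b) < d \<longrightarrow> norm (K y - K b - (y - b) *\<^sub>R v) \<le> e * norm (y - b)"
  proof (intro exI[of _ "min d1 (min d2 d3)"] conjI allI impI)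
    fix y assume y: "norm (y - b) < min d1 (min d2 d3)"
    then have "y \<in> S" using d3(2) by (auto simp: dist_norm norm_minus_commute)
    then have "K y = F y \<or> K y = H y" by (rule K)
    then show "norm (K y - K b - (y - b) *\<^sub>R v) \<le> e * norm (y - b)"
    proof
      assume Ky: "K y = F y"
      show ?thesis unfolding Ky b(1) by (rule d1(2)) (use y in simp)
    next
      assume Ky: "K y = H y"
      show ?thesis unfolding Ky b by (rule d2(2)) (use y in simp)
    qed
  qed (use d1 d2 d3 in simp)
qed

text \<open>The distance bound puts \<open>t\<close> on the same side of \<open>a\<close> as
  \<open>b\<close>. If they differed, points of \<open>I\<close> close to the farther one, together
  with \<open>a\<close>, would enclose the nearer one and place it in \<open>I\<close>.\<close>

lemma interval_boundary_isolated:
  fixes I :: "real set"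
  assumes I: "is_interval I" and a: "a \<in> I" and b: "b \<in> closure I" "b \<notin> I"
    and t: "t \<in> closure I" "t \<notin> I" "\<bar>t - b\<bar> < \<bar>b - a\<bar>"
  shows "t = b"
proof -
  have mid: "m \<in> I" if "i \<in> I" "j \<in> I" "i \<le> m" "m \<le> j" for i j m
    using I that unfolding is_interval_1 by blast
  have near: "\<exists>i\<in>I. \<bar>i - c\<bar> < e" if "c \<in> closure I" "e > 0" for c e
    using that unfolding closure_approachable dist_real_def by blast
  show ?thesis
  proof (rule ccontr)
    assume "t \<noteq> b"
    then consider "a < b" "t < b" | "a < b" "t > b" | "a > b" "t < b" | "a > b" "t > b"
      using a b(2) by (metis linorder_neqE)
    then show False
    proof cases
      case 1
      then obtain i where "i \<in> I" "\<bar>i - b\<bar> < b - t" using near[OF b(1), of "b - t"] by auto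
      then show ?thesis using mid[OF a, of i t] t 1 by (auto simp: abs_if split: if_splits)
    next
      case 2
      then obtain i where "i \<in> I" "\<bar>i - t\<bar> < t - b" using near[OF t(1), of "t - b"] by auto
      then show ?thesis using mid[OF a, of i b] b(2) 2 by (auto simp: abs_if split: if_splits)
    next
      case 3
      then obtain i where "i \<in> I" "\<bar>i - t\<bar> < b - t" using near[OF t(1), of "b - t"] by auto
      then show ?thesis using mid[OF _ a, of i b] b(2) 3 by (auto simp: abs_if split: if_splits)
    next
      case 4
      then obtain i where "i \<in> I" "\<bar>i - b\<bar> < t - b" using near[OF b(1), of "t - b"] by auto
      then show ?thesis using mid[OF _ a, of i t] t 4 by (auto simp: abs_if split: if_splits)
    qed
  qed
qed

context closed_null_hypersurface
begin

text \<open>A condition at a single time, so that after gluing two curves only the junction needs a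
  new argument. Asking for every chart costs nothing by \<open>flow_at_chartI\<close>.\<close>

definition "flow_at \<gamma> t \<longleftrightarrow> \<gamma> t \<in> L \<and> isCont \<gamma> t \<and>
  (\<forall>c\<in>A. \<gamma> t \<in> chart_dom c \<longrightarrow> ((chart_map c \<circ> \<gamma>) has_vector_derivative \<xi> (\<gamma> t) c) (at t))"

definition "flow I \<gamma> \<longleftrightarrow> open I \<and> is_interval I \<and> I \<noteq> {} \<and> (\<forall>t\<in>I. flow_at \<gamma> t)"

lemma flow_at_cong:
  assumes "flow_at \<gamma> t" "open S" "t \<in> S" "\<And>r. r \<in> S \<Longrightarrow> \<gamma>' r = \<gamma> r"
  shows "flow_at \<gamma>' t"
proof -
  have eq: "\<gamma>' t = \<gamma> t" by (rule assms(4)[OF assms(3)])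
  have "\<forall>\<^sub>F r in nhds t. \<gamma>' r = \<gamma> r"
    using assms(2-4) eventually_nhds by blast
  then have "isCont \<gamma>' t" using assms(1) isCont_cong by (metis flow_at_def)
  moreover have "((chart_map c \<circ> \<gamma>') has_vector_derivative \<xi> (\<gamma> t) c) (at t)" if "c \<in> A" "\<gamma> t \<in> chart_dom c" for c
  proof (rule has_vector_derivative_transform_within_open[OF _ assms(2,3)])
    show "((chart_map c \<circ> \<gamma>) has_vector_derivative \<xi> (\<gamma> t) c) (at t)"
      using assms(1) that unfolding flow_at_def by blast
  qed (simp add: assms(4))
  ultimately show ?thesis using assms(1) unfolding flow_at_def eq by blast
qed

lemma flow_at_chartI:
  assumes L: "\<gamma> t \<in> L" and cont: "isCont \<gamma> t" and c: "c \<in> A" "\<gamma> t \<in> chart_dom c"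
    and der: "((chart_map c \<circ> \<gamma>) has_vector_derivative \<xi> (\<gamma> t) c) (at t)"
  shows "flow_at \<gamma> t"
proof -
  obtain S where S: "open S" "t \<in> S" "\<forall>r\<in>S. \<gamma> r \<in> chart_dom c"
    using cont chart_props(1)[OF c(1)] c(2) unfolding continuous_at_open by blast
  have "((chart_map d \<circ> \<gamma>) has_vector_derivative \<xi> (\<gamma> t) d) (at t)" if d: "d \<in> A" "\<gamma> t \<in> chart_dom d" for d
  proof -
    have x: "chart_map c (\<gamma> t) \<in> overlap c d" by (rule overlap_in[OF c(2) d(2)])
    have "((\<lambda>r. transition c d ((chart_map c \<circ> \<gamma>) r)) has_derivative (\<lambda>h. jac c d (chart_map c (\<gamma> t)) (h *\<^sub>R \<xi> (\<gamma> t) c))) (at t)"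
      by (rule has_derivative_compose[OF der[unfolded has_vector_derivative_def]])
         (use jac_has_derivative[OF c(1) d(1) x] in simp)
    moreover have "jac c d (chart_map c (\<gamma> t)) (h *\<^sub>R \<xi> (\<gamma> t) c) = h *\<^sub>R \<xi> (\<gamma> t) d" for h
      using linear_scale[OF jac_linear[OF c(1) d(1) x]] tangent_jac[OF xi_tangent[OF L] c(1) d(1) c(2) d(2)] by simp
    ultimately have "((\<lambda>r. transition c d ((chart_map c \<circ> \<gamma>) r)) has_vector_derivative \<xi> (\<gamma> t) d) (at t)"
      by (simp add: has_vector_derivative_def)
    then show ?thesis
      by (rule has_vector_derivative_transform_within_open[OF _ S(1,2)])
         (use S(3) in \<open>simp add: transition_map[OF c(1)]\<close>)
  qed
  then show ?thesis using L cont unfolding flow_at_def by blast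
qed

text \<open>The differential equation is solved in a slice chart, for a field modified so that its
  solution through a point of \<open>L\<close> cannot leave \<open>L\<close>.\<close>

lemma local_flow:
  assumes p: "p \<in> L"
  shows "\<exists>e>0. \<exists>\<eta>. \<eta> b = p \<and> (\<forall>t\<in>{b - e<..<b + e}. flow_at \<eta> t)"
proof -
  obtain s k where s: "slice_at s k p" using slice_exists[OF p] by blast
  note sA = slice_atD(1)[OF s] and ps = slice_atD(2)[OF s]
  let ?W = "Wc s s k" and ?X = "Xc s s k"
  have oW: "open ?W" by (rule open_Wc[OF sA sA])
  interpret N: null_chart ?W "Gc s" "Zc s" "fc s s k"
    by (rule null_chart_Wc[OF s sA oW order_refl])
  \<comment> \<open>Off \<open>L\<close> the field \<open>?X\<close> need not be tangent to the
    level sets of the \<open>k\<close>-th coordinate. Evaluated after projection to the slice, it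
    has zero \<open>k\<close>-th component everywhere, so that coordinate stays constantly zero
    along the solution, which then solves the original equation.\<close>
  define pr where "pr x = (\<chi> i. if i = k then 0 else x $ i)" for x :: "real^'n"
  define U where "U = pr -` ?W"
  have spr: "smooth_on S pr" if "open S" for S
  proof (rule smooth_on_vecI[OF that])
    fix i
    show "smooth_on S (\<lambda>x. pr x $ i)"
      using smooth_on_nth[OF that smooth_on_ident, of i] by (cases "i = k") (simp_all add: pr_def smooth_on_const)
  qed
  have oU: "open U"
    unfolding U_def by (rule open_vimage[OF oW smooth_on_continuous_on[OF spr[OF open_UNIV]]])
  have sF: "smooth_on U (\<lambda>x. ?X (pr x))"
    by (rule smooth_on_compose[OF oU _ spr[OF oU] N.smooth_X]) (auto simp: U_def)
  let ?x0 = "chart_map s p"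
  have x0k: "?x0 $ k = 0" using slice_atD(3)[OF s ps] p by simp
  have pr0: "pr x = x" if "x $ k = 0" for x using that by (auto simp: pr_def vec_eq_iff)
  have x0: "?x0 \<in> U" using in_Wc[OF p s sA ps] by (simp add: U_def pr0[OF x0k])
  obtain e y where e: "e > 0" and y0: "y 0 = ?x0" and yU: "\<And>t. t \<in> {-e<..<e} \<Longrightarrow> y t \<in> U"
    and dy: "\<And>t. t \<in> {-e<..<e} \<Longrightarrow> (y has_vector_derivative ?X (pr (y t))) (at t)"
    using picard_local[OF oU x0 sF] by blast
  have fW: "fc s s k z = z $ k" if "z \<in> ?W" for z
    using transition_self[OF sA subsetD[OF overlap_subset Wc_overlap[OF that]]] by (simp add: fc_def)
  have Xk: "?X (pr (y t)) $ k = 0" if t: "t \<in> {-e<..<e}" for t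
  proof -
    have z: "pr (y t) \<in> ?W" using yU[OF t] by (simp add: U_def)
    have "fc s s k (pr (y t)) = 0" unfolding fW[OF z] by (simp add: pr_def)
    from N.Xf[OF z this] have "jac s s (pr (y t)) (?X (pr (y t))) $ k = 0"
      by (simp only: grad_fc[OF sA sA Wc_overlap[OF z]])
    moreover have "jac s s (pr (y t)) v = v" for v
      using jac_self[OF sA overlapD(2)[OF sA Wc_overlap[OF z]]] by (simp add: overlapD(4)[OF sA Wc_overlap[OF z]])
    ultimately show ?thesis by simp
  qed
  have yk: "y t $ k = 0" if t: "t \<in> {-e<..<e}" for t
  proof -
    have "\<exists>c. \<forall>t\<in>{-e<..<e}. y t $ k = c"
    proof (rule has_derivative_zero_constant)
      fix t assume t: "t \<in> {-e<..<e}"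
      have "((\<lambda>t. y t $ k) has_derivative (\<lambda>h. (h *\<^sub>R ?X (pr (y t))) $ k)) (at t)"
        using bounded_linear.has_derivative[OF bounded_linear_vec_nth dy[OF t, unfolded has_vector_derivative_def]] .
      then show "((\<lambda>t. y t $ k) has_derivative (\<lambda>h. 0)) (at t within {-e<..<e})"
        using Xk[OF t] by (simp add: has_derivative_at_withinI)
    qed simp
    then show ?thesis using t e y0 x0k by (metis greaterThanLessThan_iff neg_less_0_iff_less)
  qed
  define \<eta> where "\<eta> t = chart_inv s (y (t - b))" for t
  have "flow_at \<eta> t" if t: "t \<in> {b - e<..<b + e}" for t
  proof -
    have in_I: "r - b \<in> {-e<..<e}" if "r \<in> {b - e<..<b + e}" for r using that by auto
    have yW: "y (r - b) \<in> ?W" if "r \<in> {b - e<..<b + e}" for r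
      using yU[OF in_I[OF that]] by (simp add: U_def pr0[OF yk[OF in_I[OF that]]])
    note q = overlapD[OF sA Wc_overlap[OF yW]]
    have \<eta>L: "\<eta> t \<in> L"
      using slice_atD(3)[OF s q(2)[OF t]] yk[OF in_I[OF t]] by (simp add: \<eta>_def q(4)[OF t])
    have sq: "slice_at s k (\<eta> t)" using s q(2)[OF t] by (simp add: slice_at_def \<eta>_def)
    have "((\<lambda>r. r - b) has_vector_derivative 1) (at t)"
      by (auto intro!: derivative_eq_intros)
    from vector_diff_chain_at[OF this dy[OF in_I[OF t]]]
    have dys: "((\<lambda>r. y (r - b)) has_vector_derivative ?X (y (t - b))) (at t)"
      by (simp add: o_def pr0[OF yk[OF in_I[OF t]]])
    show ?thesis
    proof (rule flow_at_chartI[where \<gamma> = \<eta> and t = t and c = s, OF \<eta>L _ sA slice_atD(2)[OF sq]])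
      have "isCont (\<lambda>r. y (r - b)) t" by (rule has_vector_derivative_continuous[OF dys])
      moreover have "isCont (chart_inv s) (y (t - b))"
        using continuous_inv[OF sA] q(1)[OF t] chart_props(2)[OF sA] by (simp add: continuous_on_eq_continuous_at)
      ultimately show "isCont \<eta> t" unfolding \<eta>_def by (rule isCont_o2)
      have "\<xi> (\<eta> t) s = ?X (y (t - b))"
        using xi_coords[OF \<eta>L sq sA slice_atD(2)[OF sq]] by (simp add: \<eta>_def q(4)[OF t])
      then show "((chart_map s \<circ> \<eta>) has_vector_derivative \<xi> (\<eta> t) s) (at t)"
        using has_vector_derivative_transform_within_open[OF dys open_greaterThanLessThan t, of "chart_map s \<circ> \<eta>"]
        by (simp add: \<eta>_def q(4))
    qed
  qed
  moreover have "\<eta> b = p" by (simp add: \<eta>_def y0 inv_map[OF sA ps])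
  ultimately show ?thesis using e by blast
qed

lemma flow_velocity:
  assumes "flow_at \<gamma> t"
  shows "velocity A \<gamma> t = \<xi> (\<gamma> t)"
proof
  fix c
  show "velocity A \<gamma> t c = \<xi> (\<gamma> t) c"
  proof (cases "c \<in> A \<and> \<gamma> t \<in> chart_dom c")
    case True
    then have "((chart_map c \<circ> \<gamma>) has_vector_derivative \<xi> (\<gamma> t) c) (at t)"
      using assms unfolding flow_at_def by blast
    then show ?thesis using True by (simp add: velocity_def vector_derivative_at)
  next
    case False
    moreover have "\<gamma> t \<in> L" using assms by (simp add: flow_at_def)
    ultimately have "\<xi> (\<gamma> t) c = 0" using tangent_outside[OF xi_tangent] by blast
    then show ?thesis unfolding velocity_def if_not_P[OF False] by (rule sym)
  qed
qed

text \<open>Near \<open>t\<close> the velocity is \<open>Xc c s k\<close> along the curve, so its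
  derivative is that of the field along itself; \<open>acc0\<close> equates this with minus the
  Christoffel term.\<close>

lemma flow_geodesic_eq:
  assumes I: "flow I \<gamma>" and t: "t \<in> I" and c: "c \<in> A" "\<gamma> t \<in> chart_dom c"
  shows "((\<lambda>s. velocity A \<gamma> s c) has_vector_derivative
           (\<chi> i. - (\<Sum>j\<in>UNIV. \<Sum>k\<in>UNIV. christoffel A g c i j k (chart_map c (\<gamma> t)) *
                      velocity A \<gamma> t c $ j * velocity A \<gamma> t c $ k))) (at t)"
proof -
  have fl: "flow_at \<gamma> r" if "r \<in> I" for r using I that by (simp add: flow_def)
  have tL: "\<gamma> r \<in> L" if "r \<in> I" for r using fl[OF that] by (simp add: flow_at_def)
  obtain s k where s: "slice_at s k (\<gamma> t)" using slice_exists[OF tL[OF t]] by blast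
  note sA = slice_atD(1)[OF s]
  have oW: "open (Wc c s k)" by (rule open_Wc[OF c(1) sA])
  interpret N: null_chart "Wc c s k" "Gc c" "Zc c" "fc c s k"
    by (rule null_chart_Wc[OF s c(1) oW order_refl])
  let ?X = "Xc c s k" and ?x = "chart_map c (\<gamma> t)"
  have x: "?x \<in> Wc c s k" by (rule in_Wc[OF tL[OF t] s c])
  have fx: "fc c s k ?x = 0" by (rule fc_zero[OF tL[OF t] s c])
  have cont: "isCont \<gamma> t" using fl[OF t] by (simp add: flow_at_def)
  have "open (chart_dom c \<inter> chart_dom s)" using chart_props(1) c(1) sA by blast
  then obtain S where S: "open S" "t \<in> S" "\<forall>r\<in>S. \<gamma> r \<in> chart_dom c \<inter> chart_dom s"
    using cont c(2) slice_atD(2)[OF s] unfolding continuous_at_open by blast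
  have oS: "open (S \<inter> I)" "t \<in> S \<inter> I" using S I t by (auto simp: flow_def)
  have vel: "velocity A \<gamma> r c = ?X (chart_map c (\<gamma> r))" if r: "r \<in> S \<inter> I" for r
  proof -
    have "slice_at s k (\<gamma> r)" using s S(3) r by (auto simp: slice_at_def)
    then show ?thesis
      using xi_coords[OF tL _ c(1)] flow_velocity[OF fl] S(3) r by auto
  qed
  have dX: "(?X has_derivative frechet_derivative ?X (at ?x)) (at ?x)"
    by (rule smooth_on_has_derivative[OF N.smooth_X x])
  have "((chart_map c \<circ> \<gamma>) has_vector_derivative ?X ?x) (at t)"
    using fl[OF t] c unfolding xi_coords[OF tL[OF t] s c, symmetric] flow_at_def by blast
  from has_derivative_compose[OF this[unfolded has_vector_derivative_def], of ?X "frechet_derivative ?X (at ?x)"]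
  have "((\<lambda>r. ?X (chart_map c (\<gamma> r))) has_derivative (\<lambda>h. frechet_derivative ?X (at ?x) (h *\<^sub>R ?X ?x))) (at t)"
    using dX by (simp add: o_def)
  then have "((\<lambda>r. ?X (chart_map c (\<gamma> r))) has_vector_derivative frechet_derivative ?X (at ?x) (?X ?x)) (at t)"
    unfolding has_vector_derivative_def linear_scale[OF has_derivative_linear[OF dX]] .
  then have der: "((\<lambda>r. velocity A \<gamma> r c) has_vector_derivative frechet_derivative ?X (at ?x) (?X ?x)) (at t)"
    by (rule has_vector_derivative_transform_within_open[OF _ oS]) (simp add: vel)
  have "frechet_derivative ?X (at ?x) (?X ?x) $ i
      = - (\<Sum>j\<in>UNIV. \<Sum>k\<in>UNIV. chr (Gc c) i j k ?x * ?X ?x $ j * ?X ?x $ k)" for i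
  proof -
    have "?X differentiable (at ?x)" using dX by (auto simp: differentiable_def)
    note d = differentiable_nth[OF this]
    have "frechet_derivative ?X (at ?x) (?X ?x) $ i = (\<Sum>j\<in>UNIV. ?X ?x $ j * pderiv_at j (\<lambda>y. ?X y $ i) ?x)"
      using frechet_derivative_pderiv[OF d(1)] by (simp only: d(2))
    moreover have "acc (Gc c) ?X ?x $ i = 0" using N.acc0[OF x fx] by simp
    moreover have "acc (Gc c) ?X ?x $ i = (\<Sum>j\<in>UNIV. ?X ?x $ j * pderiv_at j (\<lambda>y. ?X y $ i) ?x)
        + (\<Sum>j\<in>UNIV. \<Sum>k\<in>UNIV. chr (Gc c) i j k ?x * ?X ?x $ j * ?X ?x $ k)"
      by (simp add: N.acc_nth cov_def distrib_left sum.distrib sum_distrib_left mult_ac)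
    ultimately show ?thesis by linarith
  qed
  then have "frechet_derivative ?X (at ?x) (?X ?x) = (\<chi> i. - (\<Sum>j\<in>UNIV. \<Sum>k\<in>UNIV. christoffel A g c i j k ?x *
                      velocity A \<gamma> t c $ j * velocity A \<gamma> t c $ k))"
    by (simp add: vec_eq_iff christoffel_eq vel[OF oS(2)])
  then show ?thesis using der by simp
qed

lemma flow_null_geodesic:
  assumes I: "flow I \<gamma>"
  shows "null_geodesic A g I \<gamma>"
proof -
  have fl: "flow_at \<gamma> r" if "r \<in> I" for r using I that by (simp add: flow_def)
  have "continuous_on I \<gamma>"
    using fl by (auto intro!: continuous_at_imp_continuous_on simp: flow_at_def)
  moreover have "(chart_map c \<circ> \<gamma>) differentiable (at t)" if "t \<in> I" "c \<in> A" "\<gamma> t \<in> chart_dom c" for t c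
    using fl[OF that(1)] that unfolding flow_at_def by (blast intro: differentiableI_vector)
  ultimately have "geodesic A g I \<gamma>"
    using I flow_geodesic_eq[OF I] unfolding geodesic_def flow_def by blast
  moreover have "null_vector A g (\<gamma> t) (velocity A \<gamma> t)" if "t \<in> I" for t
    using fl[OF that] xi_null unfolding flow_velocity[OF fl[OF that]] flow_at_def by blast
  ultimately show ?thesis by (simp add: null_geodesic_def)
qed

section \<open>Maximal generators\<close>

text \<open>Zorn's lemma is applied to graphs, which forget the values of \<gamma> outside
  \<open>I\<close> and turn extension of curves into inclusion of sets. The union of a chain of
  graphs is single valued because any two of its members are comparable.\<close>

lemma maximal_flow:
  "\<exists>I \<gamma>. flow I \<gamma> \<and> (\<forall>I' \<gamma>'. flow I' \<gamma>' \<and> I \<subseteq> I' \<and> (\<forall>t\<in>I. \<gamma>' t = \<gamma> t) \<longrightarrow> I' = I)"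
proof -
  define gr where "gr I \<gamma> = (\<lambda>t. (t, \<gamma> t)) ` I" for I :: "real set" and \<gamma> :: "real \<Rightarrow> 'm"
  define \<G> where "\<G> = {gr I \<gamma> | I \<gamma>. flow I \<gamma>}"
  have gr_iff: "(t, x) \<in> gr I \<gamma> \<longleftrightarrow> t \<in> I \<and> x = \<gamma> t" for t x I \<gamma> by (auto simp: gr_def)
  obtain p where p: "p \<in> L"
    using null_L unfolding null_hypersurface_def embedded_hypersurface_def by blast
  obtain e \<eta> where e: "e > 0" "\<forall>t\<in>{0 - e<..<0 + e}. flow_at \<eta> t" using local_flow[OF p, of 0] by blast
  then have "flow {0 - e<..<0 + e} \<eta>" by (simp add: flow_def is_interval_oo)
  then have ne: "\<G> \<noteq> {}" by (auto simp: \<G>_def)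
  have "\<exists>M\<in>\<G>. \<forall>X\<in>\<G>. M \<subseteq> X \<longrightarrow> X = M"
  proof (rule subset_Zorn_nonempty[OF ne])
    fix C assume C: "C \<noteq> {}" "subset.chain \<G> C"
    have CG: "\<exists>I \<gamma>. flow I \<gamma> \<and> G = gr I \<gamma>" if "G \<in> C" for G
      using C(2) that unfolding subset_chain_def \<G>_def by blast
    have chain: "G \<subseteq> H \<or> H \<subseteq> G" if "G \<in> C" "H \<in> C" for G H
      using C(2) that unfolding subset_chain_def by blast
    have sv: "x = x'" if tx: "(t, x) \<in> \<Union>C" "(t, x') \<in> \<Union>C" for t x x'
    proof -
      obtain G H where GH: "G \<in> C" "H \<in> C" "(t, x) \<in> G" "(t, x') \<in> H" using tx by blast
      then obtain K where K: "K \<in> C" "(t, x) \<in> K" "(t, x') \<in> K" using chain[OF GH(1,2)] by blast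
      then show ?thesis using CG[OF K(1)] by (auto simp: gr_iff)
    qed
    define I where "I = fst ` \<Union>C"
    define \<gamma> where "\<gamma> t = (SOME x. (t, x) \<in> \<Union>C)" for t
    have \<gamma>: "\<gamma> t = x" if "(t, x) \<in> \<Union>C" for t x
      using sv[OF _ that] someI[of "\<lambda>x. (t, x) \<in> \<Union>C", OF that] unfolding \<gamma>_def by blast
    have UC: "\<Union>C = gr I \<gamma>"
    proof (intro set_eqI iffI)
      fix z assume z: "z \<in> \<Union>C"
      obtain t x where tx: "z = (t, x)" by (cases z)
      have "t \<in> I" unfolding I_def using imageI[OF z, of fst] by (simp add: tx)
      moreover have "x = \<gamma> t" using \<gamma> z by (simp add: tx)
      ultimately show "z \<in> gr I \<gamma>" by (simp add: tx gr_iff)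
    next
      fix z assume "z \<in> gr I \<gamma>"
      then obtain t where t: "t \<in> I" "z = (t, \<gamma> t)" by (auto simp: gr_def)
      from t(1) obtain x where "(t, x) \<in> \<Union>C" unfolding I_def by (metis imageE prod.collapse)
      then show "z \<in> \<Union>C" using t(2) \<gamma> by simp
    qed
    have sub: "\<exists>J \<delta>. flow J \<delta> \<and> t \<in> J \<and> J \<subseteq> I \<and> (\<forall>r\<in>J. \<gamma> r = \<delta> r) \<and> gr J \<delta> \<in> C" if t: "t \<in> I" for t
    proof -
      obtain x G where G: "G \<in> C" "(t, x) \<in> G" using t unfolding I_def by auto
      obtain J \<delta> where J: "flow J \<delta>" "G = gr J \<delta>" using CG[OF G(1)] by blast
      have "r \<in> I \<and> \<gamma> r = \<delta> r" if "r \<in> J" for r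
      proof -
        have "(r, \<delta> r) \<in> \<Union>C" using that G(1) J(2) by (auto simp: gr_iff)
        then show ?thesis using \<gamma> unfolding I_def by (metis fst_conv imageI)
      qed
      then show ?thesis using J G by (auto simp: gr_iff)
    qed
    have "flow I \<gamma>"
      unfolding flow_def
    proof (intro conjI ballI)
      show "open I"
      proof (rule Topological_Spaces.openI)
        fix t assume "t \<in> I"
        then obtain J \<delta> where "flow J \<delta>" "t \<in> J" "J \<subseteq> I" using sub by blast
        then show "\<exists>T. open T \<and> t \<in> T \<and> T \<subseteq> I" unfolding flow_def by blast
      qed
      show "I \<noteq> {}"
      proof -
        obtain G where G: "G \<in> C" using C(1) by blast
        then obtain J \<delta> where J: "flow J \<delta>" "G = gr J \<delta>" using CG by blast
        then obtain t where "t \<in> J" by (auto simp: flow_def)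
        then have "(t, \<delta> t) \<in> \<Union>C" using G J(2) by (auto simp: gr_iff)
        then show ?thesis unfolding I_def by blast
      qed
      show "is_interval I"
        unfolding is_interval_1
      proof (intro ballI allI impI)
        fix a b x assume ab: "a \<in> I" "b \<in> I" "a \<le> x \<and> x \<le> b"
        obtain J1 \<delta>1 where 1: "flow J1 \<delta>1" "a \<in> J1" "J1 \<subseteq> I" "gr J1 \<delta>1 \<in> C" using sub[OF ab(1)] by blast
        obtain J2 \<delta>2 where 2: "flow J2 \<delta>2" "b \<in> J2" "J2 \<subseteq> I" "gr J2 \<delta>2 \<in> C" using sub[OF ab(2)] by blast
        have between: "x \<in> I" if "flow J \<delta>" "a \<in> J" "b \<in> J" "J \<subseteq> I" for J \<delta>
        proof -
          have "is_interval J" using that(1) by (simp add: flow_def)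
          then have "x \<in> J" using that(2,3) ab(3) unfolding is_interval_1 by blast
          then show ?thesis using that(4) by (rule subsetD[rotated])
        qed
        have dom: "J \<subseteq> J'" if "gr J \<delta> \<subseteq> gr J' \<delta>'" for J J' \<delta> \<delta>'
          using that by (auto simp: gr_def)
        from chain[OF 1(4) 2(4)] show "x \<in> I"
        proof
          assume "gr J1 \<delta>1 \<subseteq> gr J2 \<delta>2"
          then show ?thesis using between[OF 2(1) _ 2(2,3)] dom 1(2) by blast
        next
          assume "gr J2 \<delta>2 \<subseteq> gr J1 \<delta>1"
          then show ?thesis using between[OF 1(1,2) _ 1(3)] dom 2(2) by blast
        qed
      qed
      fix t assume "t \<in> I"
      then obtain J \<delta> where J: "flow J \<delta>" "t \<in> J" "\<forall>r\<in>J. \<gamma> r = \<delta> r" using sub by blast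
      show "flow_at \<gamma> t" by (rule flow_at_cong[of \<delta> t J]) (use J in \<open>auto simp: flow_def\<close>)
    qed
    then show "\<Union>C \<in> \<G>" unfolding UC \<G>_def by blast
  qed
  then obtain M where M: "M \<in> \<G>" "\<forall>X\<in>\<G>. M \<subseteq> X \<longrightarrow> X = M" by (rule bexE)
  obtain I \<gamma> where I: "flow I \<gamma>" "M = gr I \<gamma>" using M(1) unfolding \<G>_def by blast
  have "I' = I" if "flow I' \<gamma>'" "I \<subseteq> I'" "\<forall>t\<in>I. \<gamma>' t = \<gamma> t" for I' \<gamma>'
  proof -
    have "M \<subseteq> gr I' \<gamma>'" using that(2,3) by (auto simp: I(2) gr_def)
    moreover have "gr I' \<gamma>' \<in> \<G>" using that(1) unfolding \<G>_def by blast
    ultimately have eq: "gr I' \<gamma>' = gr I \<gamma>" unfolding I(2)[symmetric] by (rule M(2)[THEN bspec, THEN mp, rotated])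
    have dom: "fst ` gr J \<delta> = J" for J \<delta> by (simp add: gr_def image_image)
    show ?thesis using arg_cong[OF eq, of "image fst"] by (simp only: dom)
  qed
  then have "\<forall>I' \<gamma>'. flow I' \<gamma>' \<and> I \<subseteq> I' \<and> (\<forall>t\<in>I. \<gamma>' t = \<gamma> t) \<longrightarrow> I' = I"
    by (intro allI impI, elim conjE)
  with I(1) show ?thesis by (intro exI conjI)
qed

lemma maximal_flow_inextendible:
  assumes I: "flow I \<gamma>"
    and max: "\<And>I' \<gamma>'. flow I' \<gamma>' \<Longrightarrow> I \<subseteq> I' \<Longrightarrow> (\<forall>t\<in>I. \<gamma>' t = \<gamma> t) \<Longrightarrow> I' = I"
  shows "inextendible A g I \<gamma>"
  unfolding inextendible_def
proof (rule notI, elim exE conjE)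
  fix J \<delta> assume geo: "geodesic A g J \<delta>" and IJ: "I \<subset> J" and eq: "\<forall>t\<in>I. \<delta> t = \<gamma> t"
  have J: "open J" "is_interval J" "continuous_on J \<delta>" using geo by (auto simp: geodesic_def)
  have Io: "open I" "is_interval I" "I \<noteq> {}" and fl: "\<And>t. t \<in> I \<Longrightarrow> flow_at \<gamma> t" using I by (auto simp: flow_def)
  \<comment> \<open>Otherwise \<open>I\<close> would be open and closed in the connected set
    \<open>J\<close>. Hence some endpoint \<open>b\<close> of \<open>I\<close> lies in
    \<open>J\<close>.\<close>
  have "\<not> J \<inter> closure I \<subseteq> I"
  proof
    assume "J \<inter> closure I \<subseteq> I"
    then have "I = J \<inter> closure I" using IJ closure_subset by blast
    then have "closedin (top_of_set J) I" unfolding closedin_closed using closed_closure by blast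
    moreover have "openin (top_of_set J) I" using Io(1) IJ unfolding openin_open by blast
    moreover have "connected J" using J(2) by (simp add: is_interval_connected_1)
    ultimately show False using Io(3) IJ unfolding connected_clopen by blast
  qed
  then obtain b where b: "b \<in> J" "b \<in> closure I" "b \<notin> I" by blast
  have cont: "isCont \<delta> b" using J b(1) by (simp add: continuous_on_eq_continuous_at)
  have bL: "\<delta> b \<in> L"
    by (rule isCont_closure_mem[OF cont closed_L b(2) J(1) b(1)]) (use eq fl in \<open>auto simp: flow_at_def\<close>)
  obtain s k where s: "slice_at s k (\<delta> b)" using slice_exists[OF bL] by blast
  note sA = slice_atD(1)[OF s] and bs = slice_atD(2)[OF s]
  interpret N: null_chart "Wc s s k" "Gc s" "Zc s" "fc s s k"
    by (rule null_chart_Wc[OF s sA open_Wc[OF sA sA] order_refl])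
  let ?X = "Xc s s k"
  obtain S where S: "open S" "b \<in> S" "\<forall>t\<in>S. \<delta> t \<in> chart_dom s"
    using cont chart_props(1)[OF sA] bs unfolding continuous_at_open by blast
  have vel: "velocity A \<delta> t s = ?X (chart_map s (\<delta> t))" if t: "t \<in> I \<inter> S" for t
  proof -
    have \<gamma>t: "\<delta> t = \<gamma> t" "\<gamma> t \<in> chart_dom s" using eq S(3) t by auto
    have tL: "\<gamma> t \<in> L" using fl t by (simp add: flow_at_def)
    have "flow_at \<delta> t" by (rule flow_at_cong[OF fl Io(1)]) (use t eq in auto)
    then have "velocity A \<delta> t = \<xi> (\<gamma> t)" using flow_velocity \<gamma>t(1) by simp
    moreover have "slice_at s k (\<gamma> t)" using s \<gamma>t(2) by (simp add: slice_at_def)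
    ultimately show ?thesis using xi_coords[OF tL _ sA \<gamma>t(2)] \<gamma>t(1) by simp
  qed
  \<comment> \<open>The velocity of \<delta> agrees with the null normal field on \<open>I\<close>;
    both are continuous at \<open>b\<close>, so the closed condition that their difference is zero
    passes to the limit.\<close>
  have "velocity A \<delta> b s - ?X (chart_map s (\<delta> b)) \<in> {0}"
  proof (rule isCont_closure_mem[OF _ closed_singleton b(2) S(1,2)])
    have "isCont (\<lambda>t. velocity A \<delta> t s) b"
      using geo b(1) sA bs unfolding geodesic_def by (blast intro: has_vector_derivative_continuous)
    moreover have "isCont (chart_map s) (\<delta> b)"
      using continuous_map[OF sA] chart_props(1)[OF sA] bs by (simp add: continuous_on_eq_continuous_at)
    then have "isCont (\<lambda>t. chart_map s (\<delta> t)) b" by (rule isCont_o2[OF cont])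
    then have "isCont (\<lambda>t. ?X (chart_map s (\<delta> t))) b"
      by (rule isCont_o2)
         (use smooth_on_continuous_on[OF N.smooth_X] N.open_W in_Wc[OF bL s sA bs] in \<open>simp add: continuous_on_eq_continuous_at\<close>)
    ultimately show "isCont (\<lambda>t. velocity A \<delta> t s - ?X (chart_map s (\<delta> t))) b"
      by (rule isCont_diff)
  qed (simp add: vel)
  then have vb: "velocity A \<delta> b s = \<xi> (\<delta> b) s" using xi_coords[OF bL s sA bs] by simp
  have "(chart_map s \<circ> \<delta>) differentiable (at b)" using geo b(1) sA bs unfolding geodesic_def by blast
  then have d\<delta>: "((chart_map s \<circ> \<delta>) has_vector_derivative \<xi> (\<delta> b) s) (at b)"
    using vb sA bs by (simp add: velocity_def vector_derivative_works)
  obtain e \<eta> where e: "e > 0" and \<eta>: "\<eta> b = \<delta> b" "\<And>t. t \<in> {b - e<..<b + e} \<Longrightarrow> flow_at \<eta> t"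
    using local_flow[OF bL, of b] by blast
  obtain a where a: "a \<in> I" using Io(3) by blast
  \<comment> \<open>Small enough for the local solution \<eta> to exist, and at most the distance to
    \<open>a\<close>, so that by \<open>interval_boundary_isolated\<close> the only endpoint of
    \<open>I\<close> inside \<open>K\<close> is \<open>b\<close>.\<close>
  define r where "r = min e \<bar>b - a\<bar>"
  have r: "r > 0" "r \<le> e" "r \<le> \<bar>b - a\<bar>" using e a b(3) by (auto simp: r_def)
  define K where "K = {b - r<..<b + r}"
  have K: "open K" "b \<in> K" "\<And>t. t \<in> K \<Longrightarrow> t \<in> {b - e<..<b + e}" "\<And>t. t \<in> K \<Longrightarrow> \<bar>t - b\<bar> < \<bar>b - a\<bar>"
    using r by (auto simp: K_def)
  \<comment> \<open>Membership in \<open>I\<close> decides, which treats left and right endpoints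
    alike. On \<open>I\<close> this is \<gamma>, off the closure of \<open>I\<close> it is \<eta>,
    and at \<open>b\<close> both pieces have velocity \<xi>.\<close>
  define \<gamma>2 where "\<gamma>2 t = (if t \<in> I then \<gamma> t else \<eta> t)" for t
  have g2b: "\<gamma>2 b = \<delta> b" using b(3) \<eta>(1) by (simp add: \<gamma>2_def)
  have cases2: "\<gamma>2 t = \<delta> t \<or> \<gamma>2 t = \<eta> t" for t using eq by (simp add: \<gamma>2_def)
  have \<eta>b: "flow_at \<eta> b" by (rule \<eta>(2)[OF K(3)[OF K(2)]])
  have "flow_at \<gamma>2 b"
  proof (rule flow_at_chartI[where \<gamma> = \<gamma>2 and t = b and c = s])
    show "\<gamma>2 b \<in> L" "s \<in> A" "\<gamma>2 b \<in> chart_dom s" using bL sA bs by (simp_all add: g2b)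
    show "isCont \<gamma>2 b"
      unfolding continuous_at_open g2b
    proof (intro allI impI)
      fix T assume T: "open T \<and> \<delta> b \<in> T"
      obtain T1 where T1: "open T1" "b \<in> T1" "\<forall>t\<in>T1. \<delta> t \<in> T" using cont T unfolding continuous_at_open by blast
      have "isCont \<eta> b" using \<eta>b by (simp add: flow_at_def)
      then obtain T2 where T2: "open T2" "b \<in> T2" "\<forall>t\<in>T2. \<eta> t \<in> T"
        using T \<eta>(1) unfolding continuous_at_open by metis
      show "\<exists>S. open S \<and> b \<in> S \<and> (\<forall>t\<in>S. \<gamma>2 t \<in> T)"
      proof (intro exI[of _ "T1 \<inter> T2"] conjI ballI)
        fix t assume "t \<in> T1 \<inter> T2"
        then show "\<gamma>2 t \<in> T" using cases2[of t] T1(3) T2(3) by auto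
      qed (use T1 T2 in auto)
    qed
    have d\<eta>: "((chart_map s \<circ> \<eta>) has_vector_derivative \<xi> (\<delta> b) s) (at b)"
      using \<eta>b sA bs \<eta>(1) unfolding flow_at_def by metis
    show "((chart_map s \<circ> \<gamma>2) has_vector_derivative \<xi> (\<gamma>2 b) s) (at b)"
      unfolding g2b
    proof (rule has_vector_derivative_piecewise[OF d\<delta> d\<eta> open_UNIV UNIV_I])
      show "(chart_map s \<circ> \<gamma>2) t = (chart_map s \<circ> \<delta>) t \<or> (chart_map s \<circ> \<gamma>2) t = (chart_map s \<circ> \<eta>) t" for t
        using cases2[of t] by auto
    qed (simp_all add: g2b \<eta>(1))
  qed
  moreover have "flow_at \<gamma>2 t" if t: "t \<in> I" for t
    by (rule flow_at_cong[OF fl[OF t] Io(1) t]) (simp add: \<gamma>2_def)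
  moreover have "flow_at \<gamma>2 t" if t: "t \<in> K" "t \<notin> I" "t \<noteq> b" for t
  proof (rule flow_at_cong[OF \<eta>(2)[OF K(3)[OF t(1)]]])
    show "open (- closure I)" by (rule open_Compl[OF closed_closure])
    show "t \<in> - closure I"
      using interval_boundary_isolated[OF Io(2) a b(2,3) _ t(2) K(4)[OF t(1)]] t(3) by blast
    show "\<gamma>2 q = \<eta> q" if "q \<in> - closure I" for q
      using that closure_subset by (auto simp: \<gamma>2_def)
  qed
  ultimately have fl2: "flow_at \<gamma>2 t" if "t \<in> I \<union> K" for t using that by blast
  have "I \<inter> K \<noteq> {}"
    using b(2) K(1,2) unfolding closure_iff_nhds_not_empty by (metis order_refl)
  then have "is_interval (I \<union> K)"
    using Io(2) connected_Un[of I K] by (simp add: is_interval_connected_1 K_def)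
  then have "flow (I \<union> K) \<gamma>2" using fl2 Io K(1) by (simp add: flow_def open_Un)
  then have "I \<union> K = I" by (rule max) (auto simp: \<gamma>2_def)
  then show False using K(2) b(3) by blast
qed

section \<open>Contradiction along a complete generator\<close>

lemma no_complete_flow:
  assumes complete: "null_complete A g"
    and ricci_pos: "\<And>p u. null_vector A g p u \<Longrightarrow> ricci A g p u > 0"
  shows False
proof -
  obtain I \<gamma> where max: "flow I \<gamma> \<and> (\<forall>I' \<gamma>'. flow I' \<gamma>' \<and> I \<subseteq> I' \<and> (\<forall>t\<in>I. \<gamma>' t = \<gamma> t) \<longrightarrow> I' = I)"
    using maximal_flow by (elim exE)
  then have I: "flow I \<gamma>" by (rule conjunct1)
  have "inextendible A g I \<gamma>"
    by (rule maximal_flow_inextendible[OF I])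
       (rule max[THEN conjunct2, THEN spec, THEN spec, THEN mp], intro conjI)
  with flow_null_geodesic[OF I] have "null_geodesic A g I \<gamma> \<and> inextendible A g I \<gamma>" by (rule conjI)
  then have "I = UNIV" by (rule complete[unfolded null_complete_def, THEN spec, THEN spec, THEN mp])
  then have fl: "flow_at \<gamma> t" for t using I by (simp add: flow_def)
  have L: "\<gamma> t \<in> L" for t using fl by (simp add: flow_at_def)
  \<comment> \<open>The same choice of chart as in \<open>ricci\<close>, so that
    \<open>ricci\<close> unfolds to the coefficients in the chart in which \<theta> is
    evaluated.\<close>
  define ch where "ch p = (SOME c. c \<in> A \<and> p \<in> chart_dom c)" for p
  have ch: "ch p \<in> A" "p \<in> chart_dom (ch p)" for p
    using someI_ex[of "\<lambda>c. c \<in> A \<and> p \<in> chart_dom c"] chart_exists[of p] unfolding ch_def by blast+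
  define sk where "sk p = (SOME z. slice_at (fst z) (snd z) p)" for p
  have sk: "slice_at (fst (sk p)) (snd (sk p)) p" if "p \<in> L" for p
  proof -
    have "\<exists>z. slice_at (fst z) (snd z) p" using slice_exists[OF that] by simp
    then show ?thesis unfolding sk_def by (rule someI_ex[where P = "\<lambda>z. slice_at (fst z) (snd z) p"])
  qed
  define sl where "sl p = fst (sk p)" for p
  define kl where "kl p = snd (sk p)" for p
  have sl: "slice_at (sl p) (kl p) p" if "p \<in> L" for p using sk[OF that] by (simp only: sl_def kl_def)
  define \<theta> where "\<theta> t = divg (Gc (ch (\<gamma> t))) (Xc (ch (\<gamma> t)) (sl (\<gamma> t)) (kl (\<gamma> t))) (chart_map (ch (\<gamma> t)) (\<gamma> t))" for t
  have "\<exists>d. (\<theta> has_real_derivative d) (at t) \<and> d < - (\<theta> t)\<^sup>2 / real CARD('n)" for t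
  proof -
    define c where "c = ch (\<gamma> t)"
    define s where "s = sl (\<gamma> t)"
    define k where "k = kl (\<gamma> t)"
    have c: "c \<in> A" "\<gamma> t \<in> chart_dom c" using ch by (simp_all add: c_def)
    have s: "slice_at s k (\<gamma> t)" using sl[OF L] by (simp add: s_def k_def)
    note sA = slice_atD(1)[OF s] and ts = slice_atD(2)[OF s]
    interpret N: null_chart "Wc c s k" "Gc c" "Zc c" "fc c s k"
    by (rule null_chart_Wc[OF s c(1) open_Wc[OF c(1) sA] order_refl])
    let ?X = "Xc c s k" and ?x = "chart_map c (\<gamma> t)" and ?u = "divg (Gc c) (Xc c s k)"
    have x: "?x \<in> Wc c s k" by (rule in_Wc[OF L s c])
    have fx: "fc c s k ?x = 0" by (rule fc_zero[OF L s c])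
    have Xx: "\<xi> (\<gamma> t) c = ?X ?x" by (rule xi_coords[OF L s c])
    have du: "?u differentiable (at ?x)" by (rule smooth_on_differentiable[OF N.smooth_divg[OF N.smooth_X] x])
    have "((chart_map c \<circ> \<gamma>) has_vector_derivative ?X ?x) (at t)"
      using fl[of t] c unfolding Xx[symmetric] flow_at_def by blast
    from has_derivative_compose[OF this[unfolded has_vector_derivative_def], of ?u "frechet_derivative ?u (at ?x)"]
    have "((\<lambda>r. ?u (chart_map c (\<gamma> r))) has_derivative (\<lambda>h. frechet_derivative ?u (at ?x) (h *\<^sub>R ?X ?x))) (at t)"
      using differentiable_frechetD[OF du] by (simp add: o_def)
    moreover have "frechet_derivative ?u (at ?x) (h *\<^sub>R ?X ?x) = h * frechet_derivative ?u (at ?x) (?X ?x)" for h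
      using linear_scale[OF linear_frechet_derivative[OF du]] by simp
    ultimately have der: "((\<lambda>r. ?u (chart_map c (\<gamma> r))) has_real_derivative frechet_derivative ?u (at ?x) (?X ?x)) (at t)"
      by (simp add: has_field_derivative_def mult_commute_abs)
    have cont: "isCont \<gamma> t" using fl by (simp add: flow_at_def)
    have "open (chart_dom c \<inter> chart_dom s)" using chart_props(1) c(1) sA by blast
    then obtain S where S: "open S" "t \<in> S" "\<forall>r\<in>S. \<gamma> r \<in> chart_dom c \<inter> chart_dom s"
      using cont c(2) ts unfolding continuous_at_open by blast
    \<comment> \<open>In the definition of \<theta> the chart and the slice chart change with the
      point. \<open>divg_chart_independent\<close> allows those chosen at \<open>t\<close> to be
      kept fixed for nearby times, so \<theta> can be differentiated.\<close>
    have \<theta>: "\<theta> r = ?u (chart_map c (\<gamma> r))" if "r \<in> S" for r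
      unfolding \<theta>_def
    proof (rule divg_chart_independent[OF L sl[OF L] ch])
      show "slice_at s k (\<gamma> r)" using s S(3) that by (auto simp: slice_at_def)
    qed (use c(1) S(3) that in auto)
    have "(\<theta> has_real_derivative frechet_derivative ?u (at ?x) (?X ?x)) (at t)"
      by (rule has_field_derivative_transform_within_open[OF der S(1,2)]) (simp add: \<theta>)
    moreover have "frechet_derivative ?u (at ?x) (?X ?x) < - (\<theta> t)\<^sup>2 / real CARD('n)"
    proof -
      have "ricci A g (\<gamma> t) (\<xi> (\<gamma> t)) = (\<Sum>j\<in>UNIV. \<Sum>l\<in>UNIV. chr_ricci (Gc c) j l ?x * ?X ?x $ j * ?X ?x $ l)"
        unfolding ricci_def Let_def ch_def[symmetric] c_def[symmetric] ricci_coeff_eq Xx ..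
      moreover have "0 < ricci A g (\<gamma> t) (\<xi> (\<gamma> t))" by (rule ricci_pos[OF xi_null[OF L]])
      moreover have "frechet_derivative ?u (at ?x) (?X ?x) \<le> - (?u ?x)\<^sup>2 / real CARD('n)
          - (\<Sum>j\<in>UNIV. \<Sum>l\<in>UNIV. chr_ricci (Gc c) j l ?x * ?X ?x $ j * ?X ?x $ l)"
        unfolding frechet_derivative_pderiv[OF du] by (rule N.raychaudhuri[OF x fx])
      ultimately show ?thesis unfolding \<theta>[OF S(2)] by linarith
    qed
    ultimately show ?thesis by blast
  qed
  then have "\<forall>t. \<exists>d. (\<theta> has_real_derivative d) (at t) \<and> d < - (\<theta> t)\<^sup>2 / real CARD('n)" by (rule allI)
  then obtain \<theta>' where "\<forall>t. (\<theta> has_real_derivative \<theta>' t) (at t) \<and> \<theta>' t < - (\<theta> t)\<^sup>2 / real CARD('n)"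
    by (rule choice[THEN exE])
  then have "(\<theta> has_real_derivative \<theta>' t) (at t)" "\<theta>' t < - (\<theta> t)\<^sup>2 / real CARD('n)" for t
    by simp_all
  then show False by (rule riccati_strict_False[rotated]) simp
qed

end

theorem proposition12:
  fixes A :: "('m::{t2_space, second_countable_topology}, 'n::finite) chart set"
    and g :: "('m, 'n) metric"
    and \<zeta> :: "'m \<Rightarrow> ('m, 'n) tvec"
  assumes "lorentzian_manifold A g"
    and "time_orientable A g"
    and "null_complete A g"
    and "timelike_vector_field A g \<zeta>"
    and "conformal_vector_field A g \<zeta>"
    and "\<And>p u. null_vector A g p u \<Longrightarrow> ricci A g p u > 0"
  shows "\<not> (\<exists>L. null_hypersurface A g L \<and> closed L)"
proof
  assume "\<exists>L. null_hypersurface A g L \<and> closed L"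
  then obtain L where L: "null_hypersurface A g L" "closed L" by blast
  interpret closed_null_hypersurface A g \<zeta> L
    using assms(1,4,5) L by unfold_locales (simp_all add: lorentzian_manifold_def)
  show False using no_complete_flow[OF assms(3,6)] .
qed

end
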